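(* Let $(\check{\mathcal O},\check\gamma,\mu)$ be a non-$\Sigma$ cooperad with multiplication (without arity $0$) in vector spaces over a field $k$, with bialgebra $(\mathscr B,\mu,\Delta)$, and let $\mathscr B'=k\oplus\mathscr B$ be obtained by adjoining a unit $1$ with $\Delta(1)=1\otimes1$. Suppose $\varepsilon_{tot}\colon\mathscr B'\to k$ is a bialgebraic counit and $\check{\mathcal O}$ is almost connected with respect to a splitting $\eta_1$, and put $|=\eta_1(1)\in\check{\mathcal O}(1)$. Let $\mathcal I$ be the two-sided ideal of $\mathscr B'$ generated by $1-|$. Then $\mathcal I$ is a coideal ($\Delta(\mathcal I)\subset\mathcal I\otimes\mathscr B'+\mathscr B'\otimes\mathcal I$ and $\varepsilon_{tot}(\mathcal I)=0$), so $\mathscr H=\mathscr B'/\mathcal I$ is a unital counital bialgebra with the induced unit and counit; moreover $\mathscr H$ is conilpotent (connected), and hence admits a unique antipode making it a Hopf algebra.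
   Context: A partition of $n\ge1$ is an ordered tuple $(n_1,\dots,n_k)$, $k\ge1$, of positive integers summing to $n$. A non-$\Sigma$ cooperad (without arity $0$): vector spaces $\check{\mathcal O}(n)$, $n\ge1$, with coassociative maps $\check\gamma_{n_1,\dots,n_k}\colon\check{\mathcal O}(n)\to\check{\mathcal O}(k)\otimes\check{\mathcal O}(n_1)\otimes\cdots\otimes\check{\mathcal O}(n_k)$ (coassociativity: $(\mathrm{id}\otimes\check\gamma_{n^1_\bullet}\otimes\cdots\otimes\check\gamma_{n^k_\bullet})\circ\check\gamma_{n_1,\dots,n_k}=\pi\circ(\check\gamma_{l_1,\dots,l_k}\otimes\mathrm{id}^{\otimes l})\circ\check\gamma_{n^1_1,\dots,n^k_{l_k}}$). With multiplication: associative $\mu_{n,m}\colon\check{\mathcal O}(n)\otimes\check{\mathcal O}(m)\to\check{\mathcal O}(n+m)$ with (1) $\check\gamma_{m_1,\dots,m_k,m'_1,\dots,m'_{k'}}\circ\mu_{n,n'}=(\mu_{k,k'}\otimes\mathrm{id})\circ\pi\circ(\check\gamma_{m_1,\dots,m_k}\otimes\check\gamma_{m'_1,\dots,m'_{k'}})$ ($\pi$ moving $\check{\mathcal O}(k')$ next to $\check{\mathcal O}(k)$), (2) $\check\gamma_{m''}\circ\mu_{n,n'}=0$ for partitions of $n+n'$ not concatenating partitions of $n$ and $n'$. $\mathscr B=\bigoplus_{n\ge1}\check{\mathcal O}(n)$, $\Delta|_{\check{\mathcal O}(n)}=\sum(\mathrm{id}\otimes\mu^{(k)})\circ\check\gamma_{n_1,\dots,n_k}$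 ($\mu^{(k)}$ iterated product); note $\Delta(\check{\mathcal O}(1))\subset\check{\mathcal O}(1)\otimes\check{\mathcal O}(1)$. A bialgebraic counit is a linear map $\varepsilon_{tot}=\sum_j\varepsilon_j$ ($\varepsilon_j\colon\check{\mathcal O}(j)\to k$, extended by $\varepsilon_{tot}(1)=1$) which is multiplicative and a two-sided counit of $\Delta$. $\check{\mathcal O}$ is pointed if there is a linear $\eta_1\colon k\to\check{\mathcal O}(1)$ with $\varepsilon_1\circ\eta_1=\mathrm{id}_k$; it is almost connected if moreover $\Delta(|)=|\otimes|$ and the coalgebra $(\check{\mathcal O}(1),\Delta,\varepsilon_1)$ with coaugmentation $\eta_1$ is conilpotent (connected in Quillen's sense): with $\bar\Delta(a)=\Delta(a)-|\otimes a-a\otimes|$, every $a\in\ker\varepsilon_1$ satisfies $\bar\Delta^{m}(a)=0$ for some $m$ (iterated reduced coproduct). A unital counital bialgebra $\mathscr H$ is conilpotent if every element of $\ker\varepsilon$ is killed by some iterate of the reduced coproduct $\bar\Delta(a)=\Delta(a)-1\otimes a-a\otimes1$. *)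

theory Defs
  imports Main "HOL.Vector_Spaces" "HOL-Library.Function_Algebras"
begin

text \<open>An element of the tensor algebra T(V) = direct sum of the tensor powers V^{(x)m} is
  represented faithfully by the linear functional it induces on multilinear forms:
  a finite sum of elementary tensors  c_j (v_j1 (x) ... (x) v_jm)  is represented by
  phi |-> sum_j c_j phi [v_j1,...,v_jm]  (phi ranging over multilinear forms on lists;
  forms are multilinear in every position for every list length).  Since V is a vector
  space over a field, two finite sums of elementary tensors are equal in T(V) iff they
  agree on all multilinear forms, so this is an injective model of T(V).\<close>

type_synonym ('v,'k) tensor = "('v list \<Rightarrow> 'k) \<Rightarrow> 'k"

definition mlin :: "('k::field \<Rightarrow> 'v::ab_group_add \<Rightarrow> 'v) \<Rightarrow> ('v list \<Rightarrow> 'k) \<Rightarrow> bool" where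
  "mlin sc \<phi> \<longleftrightarrow> (\<forall>xs ys c u v. \<phi> (xs @ (sc c u + v) # ys) = c * \<phi> (xs @ u # ys) + \<phi> (xs @ v # ys))"

definition et :: "('k::field \<Rightarrow> 'v::ab_group_add \<Rightarrow> 'v) \<Rightarrow> 'v list \<Rightarrow> ('v,'k) tensor" where
  "et sc vs = (\<lambda>\<phi>. if mlin sc \<phi> then \<phi> vs else 0)"

definition tsc :: "'k::field \<Rightarrow> ('v,'k) tensor \<Rightarrow> ('v,'k) tensor" where
  "tsc c t = (\<lambda>\<phi>. c * t \<phi>)"

definition tprod :: "('k::field \<Rightarrow> 'v::ab_group_add \<Rightarrow> 'v) \<Rightarrow> ('v,'k) tensor \<Rightarrow> ('v,'k) tensor \<Rightarrow> ('v,'k) tensor" where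
  "tprod sc s t = (\<lambda>\<phi>. if mlin sc \<phi> then s (\<lambda>xs. t (\<lambda>ys. \<phi> (xs @ ys))) else 0)"

fun tprod_list :: "('k::field \<Rightarrow> 'v::ab_group_add \<Rightarrow> 'v) \<Rightarrow> ('v,'k) tensor list \<Rightarrow> ('v,'k) tensor" where
  "tprod_list sc [] = et sc []"
| "tprod_list sc (t # ts) = tprod sc t (tprod_list sc ts)"

text \<open>Apply to a tensor of arity m the linear map V^{(x)m} -> T(V) induced by the
  multilinear (tensor-valued) map G on lists of length m.\<close>
definition tapp :: "('k::field \<Rightarrow> 'v::ab_group_add \<Rightarrow> 'v) \<Rightarrow> nat \<Rightarrow> ('v list \<Rightarrow> ('v,'k) tensor)
    \<Rightarrow> ('v,'k) tensor \<Rightarrow> ('v,'k) tensor" where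
  "tapp sc m G t = (\<lambda>\<phi>. if mlin sc \<phi> then t (\<lambda>xs. if length xs = m then G xs \<phi> else 0) else 0)"

definition tspan :: "('k::field \<Rightarrow> 'v::ab_group_add \<Rightarrow> 'v) \<Rightarrow> ('v,'k) tensor set \<Rightarrow> ('v,'k) tensor set" where
  "tspan sc S = module.span (tsc :: 'k \<Rightarrow> ('v,'k) tensor \<Rightarrow> ('v,'k) tensor) S"

definition partitions :: "nat \<Rightarrow> nat list set" where
  "partitions n = {ns. ns \<noteq> [] \<and> (\<forall>x\<in>set ns. 0 < x) \<and> sum_list ns = n}"

definition tsub :: "('k::field \<Rightarrow> 'v::ab_group_add \<Rightarrow> 'v) \<Rightarrow> (nat \<Rightarrow> 'v set) \<Rightarrow> nat list \<Rightarrow> ('v,'k) tensor set" where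
  "tsub sc Op ns = tspan sc {et sc vs | vs. length vs = Suc (length ns) \<and> vs ! 0 \<in> Op (length ns)
        \<and> (\<forall>i<length ns. vs ! Suc i \<in> Op (ns ! i))}"

text \<open>The reordering pi in coassociativity, ls = (l_1,...,l_k):
  Op(k) (x) Op(l_1)..Op(l_k) (x) Op(n^1_1)..Op(n^k_{l_k})  ->
  Op(k) (x) Op(l_1) (x) Op(n^1_1)..Op(n^1_{l_1}) (x) ... (x) Op(l_k) (x) Op(n^k_1)..Op(n^k_{l_k}).\<close>
definition pi_coass :: "nat list \<Rightarrow> 'v list \<Rightarrow> 'v list" where
  "pi_coass ls xs = hd xs # concat (map (\<lambda>i. xs ! Suc i #
       take (ls ! i) (drop (Suc (length ls) + sum_list (take i ls)) xs)) [0..<length ls])"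

text \<open>B' = k.one (+) (+)_{n>=1} Op(n), as an internal direct sum inside the space V.\<close>
definition unit_adjoined_sum :: "('k::field \<Rightarrow> 'v::ab_group_add \<Rightarrow> 'v) \<Rightarrow> (nat \<Rightarrow> 'v set) \<Rightarrow> 'v \<Rightarrow> bool" where
  "unit_adjoined_sum sc Op one \<longleftrightarrow> vector_space sc \<and> (\<forall>n\<ge>1. module.subspace sc (Op n)) \<and>
     (\<forall>v. \<exists>!p::nat \<Rightarrow> 'v. finite {n. p n \<noteq> 0} \<and> p 0 \<in> range (\<lambda>c. sc c one) \<and>
          (\<forall>n\<ge>1. p n \<in> Op n) \<and> v = (\<Sum>n\<in>{n. p n \<noteq> 0}. p n))"

text \<open>Non-Sigma cooperad (without arity 0) with multiplication, together with the
  associated bialgebra structure (mult, Dl) on B' = k.one (+) B.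
  gam ns is the structure map gamma_{n_1..n_k} on Op(n_1+..+n_k), extended by zero to the
  other summands of B'; mult is the multiplication of B' (unit one, restricting to
  mu_{n,m} : Op(n) (x) Op(m) -> Op(n+m)); Dl is the coproduct Delta of B' (Delta(1) = 1 (x) 1).\<close>
definition cooperad_mult ::
  "('k::field \<Rightarrow> 'v::ab_group_add \<Rightarrow> 'v) \<Rightarrow> (nat \<Rightarrow> 'v set) \<Rightarrow> 'v \<Rightarrow> (nat list \<Rightarrow> 'v \<Rightarrow> ('v,'k) tensor)
     \<Rightarrow> ('v \<Rightarrow> 'v \<Rightarrow> 'v) \<Rightarrow> ('v \<Rightarrow> ('v,'k) tensor) \<Rightarrow> bool" where
  "cooperad_mult sc Op one gam mult Dl \<longleftrightarrow>
     unit_adjoined_sum sc Op one \<and>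
     \<comment> \<open>structure maps\<close>
     (\<forall>n ns. ns \<in> partitions n \<longrightarrow>
        Vector_Spaces.linear sc tsc (gam ns) \<and>
        (\<forall>x\<in>Op n. gam ns x \<in> tsub sc Op ns) \<and>
        (\<forall>m\<ge>1. m \<noteq> n \<longrightarrow> (\<forall>x\<in>Op m. gam ns x = 0)) \<and> gam ns one = 0) \<and>
     \<comment> \<open>coassociativity\<close>
     (\<forall>n ns nss x. ns \<in> partitions n \<and> length nss = length ns \<and>
        (\<forall>i<length ns. nss ! i \<in> partitions (ns ! i)) \<and> x \<in> Op n \<longrightarrow>
        tapp sc (Suc (length ns))
          (\<lambda>zs. tprod sc (et sc [hd zs]) (tprod_list sc (map (\<lambda>i. gam (nss ! i) (zs ! Suc i)) [0..<length ns])))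
          (gam ns x)
        = tapp sc (Suc (length ns) + length (concat nss)) (\<lambda>zs. et sc (pi_coass (map length nss) zs))
            (tapp sc (Suc (length (concat nss))) (\<lambda>zs. tprod sc (gam (map length nss) (hd zs)) (et sc (tl zs)))
               (gam (concat nss) x))) \<and>
     \<comment> \<open>multiplication: bilinear, associative, unital, graded\<close>
     (\<forall>x. Vector_Spaces.linear sc sc (mult x)) \<and> (\<forall>y. Vector_Spaces.linear sc sc (\<lambda>x. mult x y)) \<and>
     (\<forall>x y z. mult (mult x y) z = mult x (mult y z)) \<and>
     (\<forall>x. mult one x = x \<and> mult x one = x) \<and>
     (\<forall>n m x y. n \<ge> 1 \<and> m \<ge> 1 \<and> x \<in> Op n \<and> y \<in> Op m \<longrightarrow> mult x y \<in> Op (n + m)) \<and>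
     \<comment> \<open>compatibility (1)\<close>
     (\<forall>n n' x y ms ms'. x \<in> Op n \<and> y \<in> Op n' \<and> ms \<in> partitions n \<and> ms' \<in> partitions n' \<longrightarrow>
        gam (ms @ ms') (mult x y) =
        tapp sc (length ms + length ms' + 2)
          (\<lambda>zs. et sc (mult (zs ! 0) (zs ! Suc (length ms)) # take (length ms) (tl zs) @ drop (length ms + 2) zs))
          (tprod sc (gam ms x) (gam ms' y))) \<and>
     \<comment> \<open>compatibility (2)\<close>
     (\<forall>n n' x y ms. n \<ge> 1 \<and> n' \<ge> 1 \<and> x \<in> Op n \<and> y \<in> Op n' \<and> ms \<in> partitions (n + n') \<and>
        (\<forall>i. sum_list (take i ms) \<noteq> n) \<longrightarrow> gam ms (mult x y) = 0) \<and>
     \<comment> \<open>the coproduct Delta of B'\<close>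
     Vector_Spaces.linear sc tsc Dl \<and> Dl one = et sc [one, one] \<and>
     (\<forall>n\<ge>1. \<forall>x\<in>Op n. Dl x = (\<Sum>ns\<in>partitions n.
          tapp sc (Suc (length ns)) (\<lambda>zs. et sc [hd zs, foldr mult (tl zs) one]) (gam ns x)))"

definition bialg_counit :: "('k::field \<Rightarrow> 'v::ab_group_add \<Rightarrow> 'v) \<Rightarrow> 'v \<Rightarrow> ('v \<Rightarrow> 'v \<Rightarrow> 'v)
     \<Rightarrow> ('v \<Rightarrow> ('v,'k) tensor) \<Rightarrow> ('v \<Rightarrow> 'k) \<Rightarrow> bool" where
  "bialg_counit sc one mult Dl eps \<longleftrightarrow> Vector_Spaces.linear sc (*) eps \<and> eps one = 1 \<and>
     (\<forall>x y. eps (mult x y) = eps x * eps y) \<and>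
     (\<forall>x. tapp sc 2 (\<lambda>zs. et sc [sc (eps (zs ! 0)) (zs ! 1)]) (Dl x) = et sc [x]) \<and>
     (\<forall>x. tapp sc 2 (\<lambda>zs. et sc [sc (eps (zs ! 1)) (zs ! 0)]) (Dl x) = et sc [x])"

text \<open>Reduced coproduct w.r.t. a group-like element u, and its iterates
  (riter m x has arity m+1; riter (m+1) = (rD (x) id^{(x)m}) o riter m).\<close>
definition rD :: "('k::field \<Rightarrow> 'v::ab_group_add \<Rightarrow> 'v) \<Rightarrow> ('v \<Rightarrow> ('v,'k) tensor) \<Rightarrow> 'v \<Rightarrow> 'v \<Rightarrow> ('v,'k) tensor" where
  "rD sc Dl u x = Dl x - et sc [u, x] - et sc [x, u]"

fun riter :: "('k::field \<Rightarrow> 'v::ab_group_add \<Rightarrow> 'v) \<Rightarrow> ('v \<Rightarrow> ('v,'k) tensor) \<Rightarrow> 'v \<Rightarrow> nat \<Rightarrow> 'v \<Rightarrow> ('v,'k) tensor" where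
  "riter sc Dl u 0 x = et sc [x]"
| "riter sc Dl u (Suc m) x =
     tapp sc (Suc m) (\<lambda>zs. tprod sc (rD sc Dl u (hd zs)) (et sc (tl zs))) (riter sc Dl u m x)"

text \<open>Pointed and almost connected with respect to the splitting eta_1, where
  bar = eta_1(1) (a linear map k -> Op(1) is determined by bar).\<close>
definition almost_connected :: "('k::field \<Rightarrow> 'v::ab_group_add \<Rightarrow> 'v) \<Rightarrow> (nat \<Rightarrow> 'v set)
     \<Rightarrow> ('v \<Rightarrow> ('v,'k) tensor) \<Rightarrow> ('v \<Rightarrow> 'k) \<Rightarrow> 'v \<Rightarrow> bool" where
  "almost_connected sc Op Dl eps bar \<longleftrightarrow> bar \<in> Op 1 \<and> eps bar = 1 \<and> Dl bar = et sc [bar, bar] \<and>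
     (\<forall>a\<in>Op 1. eps a = 0 \<longrightarrow> (\<exists>m. riter sc Dl bar m a = 0))"

definition ideal_gen :: "('k::field \<Rightarrow> 'v::ab_group_add \<Rightarrow> 'v) \<Rightarrow> ('v \<Rightarrow> 'v \<Rightarrow> 'v) \<Rightarrow> 'v \<Rightarrow> 'v set" where
  "ideal_gen sc mult g = \<Inter>{J. module.subspace sc J \<and> (\<forall>x\<in>J. \<forall>y. mult x y \<in> J \<and> mult y x \<in> J) \<and> g \<in> J}"

definition coideal :: "('k::field \<Rightarrow> 'v::ab_group_add \<Rightarrow> 'v) \<Rightarrow> ('v \<Rightarrow> ('v,'k) tensor) \<Rightarrow> ('v \<Rightarrow> 'k) \<Rightarrow> 'v set \<Rightarrow> bool" where
  "coideal sc Dl eps I \<longleftrightarrow> (\<forall>x\<in>I. Dl x \<in> tspan sc {et sc [a, b] | a b. a \<in> I \<or> b \<in> I}) \<and> (\<forall>x\<in>I. eps x = 0)"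

text \<open>Kernel of T(V) -> T(V/I): span of elementary tensors with some factor in I
  (H^{(x)m} = V^{(x)m} / sum_j V^{(x)j} (x) I (x) V^{(x)(m-j-1)}).  Identities in the
  quotient H = V/I and its tensor powers are stated on representatives modulo this.\<close>
definition qker :: "('k::field \<Rightarrow> 'v::ab_group_add \<Rightarrow> 'v) \<Rightarrow> 'v set \<Rightarrow> ('v,'k) tensor set" where
  "qker sc I = tspan sc {et sc vs | vs. \<exists>v\<in>set vs. v \<in> I}"

definition quotient_bialgebra :: "('k::field \<Rightarrow> 'v::ab_group_add \<Rightarrow> 'v) \<Rightarrow> 'v \<Rightarrow> ('v \<Rightarrow> 'v \<Rightarrow> 'v)
     \<Rightarrow> ('v \<Rightarrow> ('v,'k) tensor) \<Rightarrow> ('v \<Rightarrow> 'k) \<Rightarrow> 'v set \<Rightarrow> bool" where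
  "quotient_bialgebra sc one mult Dl eps I \<longleftrightarrow>
     \<comment> \<open>the structure maps descend to H\<close>
     module.subspace sc I \<and> (\<forall>x\<in>I. \<forall>y. mult x y \<in> I \<and> mult y x \<in> I) \<and>
     (\<forall>x\<in>I. Dl x \<in> qker sc I) \<and> (\<forall>x\<in>I. eps x = 0) \<and>
     \<comment> \<open>unital associative algebra\<close>
     (\<forall>x y z. mult (mult x y) z - mult x (mult y z) \<in> I) \<and>
     (\<forall>x. mult one x - x \<in> I \<and> mult x one - x \<in> I) \<and>
     \<comment> \<open>counital coassociative coalgebra\<close>
     (\<forall>x. tapp sc 2 (\<lambda>zs. tprod sc (Dl (zs ! 0)) (et sc [zs ! 1])) (Dl x)
          - tapp sc 2 (\<lambda>zs. tprod sc (et sc [zs ! 0]) (Dl (zs ! 1))) (Dl x) \<in> qker sc I) \<and>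
     (\<forall>x. tapp sc 2 (\<lambda>zs. et sc [sc (eps (zs ! 0)) (zs ! 1)]) (Dl x) - et sc [x] \<in> qker sc I) \<and>
     (\<forall>x. tapp sc 2 (\<lambda>zs. et sc [sc (eps (zs ! 1)) (zs ! 0)]) (Dl x) - et sc [x] \<in> qker sc I) \<and>
     \<comment> \<open>compatibility: Delta and eps are unital algebra maps\<close>
     (\<forall>x y. Dl (mult x y) - tapp sc 4 (\<lambda>zs. et sc [mult (zs ! 0) (zs ! 2), mult (zs ! 1) (zs ! 3)])
                              (tprod sc (Dl x) (Dl y)) \<in> qker sc I) \<and>
     Dl one - et sc [one, one] \<in> qker sc I \<and>
     (\<forall>x y. eps (mult x y) = eps x * eps y) \<and> eps one = 1"

definition quotient_conilpotent :: "('k::field \<Rightarrow> 'v::ab_group_add \<Rightarrow> 'v) \<Rightarrow> 'v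
     \<Rightarrow> ('v \<Rightarrow> ('v,'k) tensor) \<Rightarrow> ('v \<Rightarrow> 'k) \<Rightarrow> 'v set \<Rightarrow> bool" where
  "quotient_conilpotent sc one Dl eps I \<longleftrightarrow>
     (\<forall>x. eps x = 0 \<longrightarrow> (\<exists>m. riter sc Dl one m x \<in> qker sc I))"

text \<open>S (a linear map on V preserving I, i.e. a linear map H -> H) is an antipode of H.\<close>
definition quotient_antipode :: "('k::field \<Rightarrow> 'v::ab_group_add \<Rightarrow> 'v) \<Rightarrow> 'v \<Rightarrow> ('v \<Rightarrow> 'v \<Rightarrow> 'v)
     \<Rightarrow> ('v \<Rightarrow> ('v,'k) tensor) \<Rightarrow> ('v \<Rightarrow> 'k) \<Rightarrow> 'v set \<Rightarrow> ('v \<Rightarrow> 'v) \<Rightarrow> bool" where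
  "quotient_antipode sc one mult Dl eps I S \<longleftrightarrow>
     Vector_Spaces.linear sc sc S \<and> (\<forall>x\<in>I. S x \<in> I) \<and>
     (\<forall>x. tapp sc 2 (\<lambda>zs. et sc [mult (S (zs ! 0)) (zs ! 1)]) (Dl x) - et sc [sc (eps x) one] \<in> qker sc I) \<and>
     (\<forall>x. tapp sc 2 (\<lambda>zs. et sc [mult (zs ! 0) (S (zs ! 1))]) (Dl x) - et sc [sc (eps x) one] \<in> qker sc I)"

end

theory Submission
  imports Defs
begin

text \<open>Coassociativity of \<open>Dl\<close> comes from that of the cooperad through the bijection
  \<open>(ms, nss) \<mapsto> (concat nss, map length nss)\<close> between a partition with a partition of each of its parts
  and a partition with a partition of its length.  Since \<open>one - bar\<close> is a difference of group-like
  elements, it generates a coideal \<open>I\<close>.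

  Conilpotency uses the filtration \<open>Fil 0 = k one + I\<close>,
  \<open>Fil (p + 1) = {x. Dl x - x \<otimes> one \<in> Fil p \<otimes> V + V \<otimes> I}\<close>.  It is multiplicative, it contains
  \<open>Op 1\<close> because \<open>bar\<close> becomes the unit modulo \<open>I\<close>, and \<open>Dl x \<in> Fil a \<otimes> V + V \<otimes> Fil b\<close> forces
  \<open>x \<in> Fil (a + b + 1)\<close>.  For \<open>x \<in> Op n\<close> every term of \<open>Dl x\<close> has either its first factor in some
  \<open>Op k\<close> with \<open>k < n\<close>, or a product of elements of \<open>Op 1\<close> as its second factor, so induction on \<open>n\<close>
  shows that the filtration is exhaustive.  The antipode is then the geometric series of convolution
  powers of \<open>\<eta> \<epsilon> - id\<close>.\<close>

section \<open>Multilinear forms and tensors\<close>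

text \<open>Tensors are functionals on multilinear forms, so no universal property is at hand: a map
  on \<open>V \<otimes> V\<close> is evaluated through a finite sum of pairs (\<open>lft\<close>),
  and identities are tested by linear functionals. Computations with \<open>gam\<close> are
  therefore scalar: \<open>Dl\<close> paired with a bilinear form becomes a sum of values of
  \<open>gam ns x\<close> at explicit forms. The quotient by \<open>I\<close> is never built either;
  working with representatives is what produces the summand \<open>V \<otimes> I\<close> in the
  filtration.

  The main obstacle is that nilpotency is given relative to \<open>bar\<close>, inside
  \<open>Op 1\<close>, and through iterated tensors, whereas the filtration is relative to
  \<open>one\<close> and asks for membership in sums such as
  \<open>U \<otimes> V + V \<otimes> W\<close>. Slices \<open>(id \<otimes> f) t\<close> bridge the
  gap: such a membership follows once every slice by a functional vanishing on \<open>W\<close> lies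
  in \<open>U\<close>, and slices are vectors, to which the counit, nilpotency or coassociativity
  can be applied.\<close>

lemma vector_space_tsc: "vector_space (tsc :: 'k::field \<Rightarrow> ('v,'k) tensor \<Rightarrow> ('v,'k) tensor)"
  by standard (auto simp: tsc_def algebra_simps)

lemma vector_space_times: "vector_space ((*) :: 'k::field \<Rightarrow> 'k \<Rightarrow> 'k)"
  by standard (auto simp: algebra_simps)

interpretation tens: vector_space "tsc :: 'k::field \<Rightarrow> ('v,'k) tensor \<Rightarrow> ('v,'k) tensor"
  by (rule vector_space_tsc)

section \<open>Linear and bilinear maps between spaces with explicit scalings\<close>

abbreviation lin where "lin \<equiv> Vector_Spaces.linear"

lemma linI:
  assumes "vector_space a" "vector_space b" "\<And>c x y. f (a c x + y) = b c (f x) + f y"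
  shows "lin a b f"
proof -
  interpret a: vector_space a by fact
  interpret b: vector_space b by fact
  have ad: "f (x + y) = f x + f y" for x y using assms(3)[of 1 x y] by simp
  have "f 0 = 0" using ad[of 0 0] by simp
  then have "f (a c x) = b c (f x)" for c x using assms(3)[of c x 0] by simp
  with ad show ?thesis by (simp add: linear_iff assms)
qed

lemma
  assumes "lin a b f"
  shows lin_vs1: "vector_space a" and lin_vs2: "vector_space b"
    and lin_add: "f (x + y) = f x + f y" and lin_scale: "f (a c x) = b c (f x)"
  using assms by (auto simp: linear_iff)

lemma lin_0: "lin a b f \<Longrightarrow> f 0 = 0"
  using lin_add[of a b f 0 0] by simp

lemma lin_minus: "lin a b f \<Longrightarrow> f (- x) = - f x"
  using lin_add[of a b f x "- x"] lin_0[of a b f] by (simp add: add_eq_0_iff)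

lemma lin_diff: "lin a b f \<Longrightarrow> f (x - y) = f x - f y"
  using lin_add[of a b f x "- y"] lin_minus[of a b f y] by simp

lemma lin_sum: "lin a b f \<Longrightarrow> f (sum g S) = (\<Sum>i\<in>S. f (g i))"
  by (induction S rule: infinite_finite_induct) (auto simp: lin_0 lin_add)

lemma lin_sum_list: "lin a b f \<Longrightarrow> f (sum_list (map g xs)) = sum_list (map (\<lambda>i. f (g i)) xs)"
  by (induction xs) (auto simp: lin_0 lin_add)

lemma lin_comp: "lin a b f \<Longrightarrow> lin b d g \<Longrightarrow> lin a d (\<lambda>x. g (f x))"
  by (auto simp: linear_iff)

lemma lin_id: "vector_space a \<Longrightarrow> lin a a (\<lambda>x. x)"
  by (auto simp: linear_iff)

lemma lin_plus: "lin a b f \<Longrightarrow> lin a b g \<Longrightarrow> lin a b (\<lambda>x. f x + g x)"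
  by (auto simp: linear_iff vector_space_def module_def)

lemma lin_minus2: "lin a b f \<Longrightarrow> lin a b g \<Longrightarrow> lin a b (\<lambda>x. f x - g x)"
  using module.scale_right_diff_distrib[of b] by (auto simp: linear_iff module_iff_vector_space)

lemma lin_smult: "lin a b f \<Longrightarrow> lin a b (\<lambda>x. b c (f x))"
  by (auto simp: linear_iff vector_space_def module_def mult.commute)

lemma lin_smult_vec: "lin a (*) f \<Longrightarrow> vector_space b \<Longrightarrow> lin a b (\<lambda>x. b (f x) v)"
  by (auto simp: linear_iff vector_space_def module_def)

lemma lin_zero: "vector_space a \<Longrightarrow> vector_space b \<Longrightarrow> lin a b (\<lambda>x. 0)"
  using module.scale_zero_right[of b] by (auto simp: linear_iff module_iff_vector_space)

lemma lin_sum_fun: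
  assumes "vector_space a" "vector_space b" "\<And>i. i \<in> S \<Longrightarrow> lin a b (f i)"
  shows "lin a b (\<lambda>x. \<Sum>i\<in>S. f i x)"
  using assms(3) by (induction S rule: infinite_finite_induct)
    (auto intro: lin_zero lin_plus assms)

lemma lin_sum_list_fun:
  assumes "vector_space a" "vector_space b" "\<And>i. i \<in> set xs \<Longrightarrow> lin a b (f i)"
  shows "lin a b (\<lambda>x. \<Sum>i\<leftarrow>xs. f i x)"
  using assms(3) by (induction xs) (auto intro: lin_zero lin_plus assms)

lemma lin_eval: "lin tsc (*) (\<lambda>t. t \<phi>)"
  by (auto simp: linear_iff vector_space_tsc vector_space_times tsc_def)

lemma lin_eval_comp: "lin a tsc f \<Longrightarrow> lin a (*) (\<lambda>x. f x \<phi>)"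
  by (rule lin_comp[OF _ lin_eval])

lemma subspace_preimage: 
  assumes "lin a b f" "module.subspace b S"
  shows "module.subspace a {x. f x \<in> S}"
proof -
  interpret a: vector_space a using assms lin_vs1 by blast
  interpret b: vector_space b using assms lin_vs2 by blast
  show ?thesis using assms lin_add[OF assms(1)] lin_scale[OF assms(1)] lin_0[OF assms(1)]
    by (auto simp: a.subspace_def b.subspace_def)
qed

text \<open>The target is a separate vector space, so that scalar-, vector- and tensor-valued maps
  on pairs are treated by one notion.\<close>

definition bil :: "('k::field \<Rightarrow> 'v::ab_group_add \<Rightarrow> 'v) \<Rightarrow> ('k \<Rightarrow> 'w::ab_group_add \<Rightarrow> 'w) \<Rightarrow> ('v \<Rightarrow> 'v \<Rightarrow> 'w) \<Rightarrow> bool" where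
  "bil a b B \<longleftrightarrow> (\<forall>y. lin a b (\<lambda>x. B x y)) \<and> (\<forall>x. lin a b (\<lambda>y. B x y))"

lemma bilI: "(\<And>y. lin a b (\<lambda>x. B x y)) \<Longrightarrow> (\<And>x. lin a b (\<lambda>y. B x y)) \<Longrightarrow> bil a b B"
  by (simp add: bil_def)

lemma bil1: "bil a b B \<Longrightarrow> lin a b (\<lambda>x. B x y)" and bil2: "bil a b B \<Longrightarrow> lin a b (\<lambda>y. B x y)"
  by (simp_all add: bil_def)

lemma bil1': "bil a b B \<Longrightarrow> lin c a f \<Longrightarrow> lin c b (\<lambda>x. B (f x) y)"
  and bil2': "bil a b B \<Longrightarrow> lin c a f \<Longrightarrow> lin c b (\<lambda>x. B y (f x))"
  using lin_comp bil1 bil2 by fast+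

lemma bil_vs: assumes "bil a b B" shows "vector_space a" "vector_space b"
  using lin_vs1[OF bil1[OF assms]] lin_vs2[OF bil1[OF assms]] by auto

lemma bil_comp: "bil a b B \<Longrightarrow> lin b c h \<Longrightarrow> bil a c (\<lambda>x y. h (B x y))"
  by (auto simp: bil_def intro: lin_comp)

text \<open>\<open>mlin\<close> demands multilinearity at every list length, while the forms met in
  computations live at a single length \<open>m\<close>. They become admissible arguments of tensors
  after extension by zero, written \<open>rst m F\<close>.\<close>

definition mlN :: "('k::field \<Rightarrow> 'v::ab_group_add \<Rightarrow> 'v) \<Rightarrow> nat \<Rightarrow> ('v list \<Rightarrow> 'k) \<Rightarrow> bool" where
  "mlN sc m F \<longleftrightarrow> (\<forall>xs ys c u v. length xs + Suc (length ys) = m \<longrightarrow>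
      F (xs @ (sc c u + v) # ys) = c * F (xs @ u # ys) + F (xs @ v # ys))"

abbreviation rst :: "nat \<Rightarrow> ('v list \<Rightarrow> 'k::zero) \<Rightarrow> 'v list \<Rightarrow> 'k" where
  "rst m F \<equiv> (\<lambda>xs. if length xs = m then F xs else 0)"

text \<open>Changing one entry does not change the length of a list, so at all other lengths the
  extension by zero satisfies the condition trivially.\<close>

lemma mlin_rst_iff: "mlin sc (rst m F) \<longleftrightarrow> mlN sc m F"
proof
  assume a: "mlin sc (rst m F)"
  show "mlN sc m F"
    unfolding mlN_def
  proof (intro allI impI)
    fix xs ys :: "'b list" and c u v assume "length xs + Suc (length ys) = m"
    then show "F (xs @ (sc c u + v) # ys) = c * F (xs @ u # ys) + F (xs @ v # ys)"
      using a[unfolded mlin_def, rule_format, of xs c u v ys] by simp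
  qed
qed (auto simp: mlin_def mlN_def)

lemma mlin_mlN: "mlin sc \<phi> \<Longrightarrow> mlN sc m \<phi>"
  unfolding mlin_def mlN_def by blast

lemma mlN_cong: "(\<And>xs. length xs = m \<Longrightarrow> F xs = G xs) \<Longrightarrow> mlN sc m F \<longleftrightarrow> mlN sc m G"
  unfolding mlN_def by auto

lemma mlN_0: "mlN sc 0 F"
  unfolding mlN_def by auto

lemma mlN_append:
  fixes F :: "'v::ab_group_add list \<Rightarrow> 'k::field"
  assumes "\<And>xs. length xs = m \<Longrightarrow> mlN sc n (\<lambda>ys. F (xs @ ys))"
    and "\<And>ys. length ys = n \<Longrightarrow> mlN sc m (\<lambda>xs. F (xs @ ys))"
  shows "mlN sc (m + n) F"
  unfolding mlN_def
proof (intro allI impI)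
  fix xs ys :: "'v list" and c u v assume l: "length xs + Suc (length ys) = m + n"
  show "F (xs @ (sc c u + v) # ys) = c * F (xs @ u # ys) + F (xs @ v # ys)"
  proof (cases "length xs < m")
    case True
    \<comment> \<open>The changed entry lies in the first block; \<open>k\<close> counts the entries
      behind it that still belong to that block.\<close>
    define k where "k = m - Suc (length xs)"
    have "length (drop k ys) = n" "length xs + Suc (length (take k ys)) = m"
      using l True by (auto simp: k_def)
    from assms(2)[OF this(1), unfolded mlN_def, rule_format, OF this(2), of c u v]
    show ?thesis by simp
  next
    case False
    then have "length (take m xs) = m" "length (drop m xs) + Suc (length ys) = n" using l by auto
    from assms(1)[OF this(1), unfolded mlN_def, rule_format, OF this(2), of c u v]
    show ?thesis by (simp flip: append_assoc)
  qed
qed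

lemma mlN_Suc:
  assumes "\<And>x. mlN sc n (\<lambda>ys. F (x # ys))"
    and "\<And>ys. length ys = n \<Longrightarrow> lin sc (*) (\<lambda>x. F (x # ys))"
  shows "mlN sc (Suc n) F"
proof -
  have "mlN sc (1 + n) F"
  proof (rule mlN_append)
    show "mlN sc n (\<lambda>ys. F (xs @ ys))" if "length xs = 1" for xs
      using that assms(1) by (cases xs) auto
    show "mlN sc 1 (\<lambda>xs. F (xs @ ys))" if "length ys = n" for ys
      using lin_add[OF assms(2)[OF that]] lin_scale[OF assms(2)[OF that]] by (auto simp: mlN_def)
  qed
  then show ?thesis by simp
qed

lemma mlN_1: "lin sc (*) (\<lambda>x. F [x]) \<Longrightarrow> mlN sc (Suc 0) F"
  by (rule mlN_Suc) (auto intro: mlN_0)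

lemma mlN_2: "bil sc (*) (\<lambda>x y. F [x, y]) \<Longrightarrow> mlN sc 2 F"
  unfolding numeral_2_eq_2 by (intro mlN_Suc mlN_1) (auto simp: length_Suc_conv intro: bil1 bil2)

lemma mlin_append_left: "mlin sc \<phi> \<Longrightarrow> mlin sc (\<lambda>ys. \<phi> (xs @ ys))"
  unfolding mlin_def append_assoc[symmetric] by blast

lemma mlin_append_right: "mlin sc \<phi> \<Longrightarrow> mlin sc (\<lambda>ys. \<phi> (ys @ xs))"
  unfolding mlin_def by simp

lemma mlin_combo: "mlin sc \<phi> \<Longrightarrow> mlin sc \<psi> \<Longrightarrow> mlin sc (\<lambda>xs. c * \<phi> xs + \<psi> xs)"
  unfolding mlin_def by (simp add: algebra_simps)

lemma mlN_lin:
  assumes "mlN sc m F" "vector_space sc" "length xs + Suc (length ys) = m"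
  shows "lin sc (*) (\<lambda>x. F (xs @ x # ys))"
  using assms by (intro linI) (auto simp: mlN_def vector_space_times)

lemma mlin_lin: "mlin sc \<phi> \<Longrightarrow> vector_space sc \<Longrightarrow> lin sc (*) (\<lambda>x. \<phi> (xs @ x # ys))"
  by (rule mlN_lin[OF mlin_mlN]) auto

lemma mlin_bil: "mlin sc \<phi> \<Longrightarrow> vector_space sc \<Longrightarrow> bil sc (*) (\<lambda>x y. \<phi> [x, y])"
  using mlin_lin[of sc \<phi> "[]"] mlin_lin[of sc \<phi> "[_]"] by (auto intro!: bilI)

lemma et_mlin [simp]: "mlin sc \<phi> \<Longrightarrow> et sc vs \<phi> = \<phi> vs"
  by (simp add: et_def)

section \<open>Spans of elementary tensors, tensor products and induced maps\<close>

lemma tspan_induct [consumes 1, case_names base zero step]: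
  assumes "t \<in> tspan sc S" "\<And>s. s \<in> S \<Longrightarrow> P s" "P 0"
    "\<And>c s t. P s \<Longrightarrow> P t \<Longrightarrow> P (tsc c s + t)"
  shows "P t"
proof -
  have "P (tsc c x + y)" if "x \<in> S" "P y" for c x y
    by (rule assms(4)[OF assms(2)[OF that(1)] that(2)])
  then show ?thesis
    using tens.span_induct_alt[of t S P] assms(1,3) unfolding tspan_def by blast
qed

lemma tspan_mono: "S \<subseteq> T \<Longrightarrow> tspan sc S \<subseteq> tspan sc T"
  unfolding tspan_def by (rule tens.span_mono)

lemma tspan_base: "s \<in> S \<Longrightarrow> s \<in> tspan sc S"
  unfolding tspan_def by (rule tens.span_base)

lemma tspan_zero: "0 \<in> tspan sc S"
  and tspan_add: "x \<in> tspan sc S \<Longrightarrow> y \<in> tspan sc S \<Longrightarrow> x + y \<in> tspan sc S"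
  and tspan_diff: "x \<in> tspan sc S \<Longrightarrow> y \<in> tspan sc S \<Longrightarrow> x - y \<in> tspan sc S"
  and tspan_scale: "x \<in> tspan sc S \<Longrightarrow> tsc c x \<in> tspan sc S"
  unfolding tspan_def by (auto intro: tens.span_zero tens.span_add tens.span_diff tens.span_scale)

lemma tspan_sum: "(\<And>i. i \<in> A \<Longrightarrow> f i \<in> tspan sc S) \<Longrightarrow> sum f A \<in> tspan sc S"
  unfolding tspan_def by (rule tens.span_sum)

lemma subspace_tspan: "module.subspace tsc (tspan sc S)"
  unfolding tspan_def by (rule tens.subspace_span)

lemma tspan_subset: "(\<And>s. s \<in> S \<Longrightarrow> s \<in> tspan sc T) \<Longrightarrow> tspan sc S \<subseteq> tspan sc T"
  unfolding tspan_def by (rule tens.span_minimal) (auto simp: tens.subspace_span)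

lemma tspan_lin_image:
  assumes "t \<in> tspan sc S" "lin tsc tsc h" "\<And>s. s \<in> S \<Longrightarrow> h s \<in> tspan sc U"
  shows "h t \<in> tspan sc U"
  using assms(1)
proof (induction rule: tspan_induct)
  case zero
  show ?case unfolding lin_0[OF assms(2)] by (rule tspan_zero)
next
  case (step c s t)
  then show ?case unfolding lin_add[OF assms(2)] lin_scale[OF assms(2)] by (intro tspan_add tspan_scale)
qed (rule assms(3))

text \<open>One scheme for several spaces: \<open>P\<close> may fix the arity, prescribe degrees of
  the factors, or require a factor in an ideal.\<close>

definition etP :: "('k::field \<Rightarrow> 'v::ab_group_add \<Rightarrow> 'v) \<Rightarrow> ('v list \<Rightarrow> bool) \<Rightarrow> ('v,'k) tensor set" where
  "etP sc P = tspan sc {et sc vs | vs. P vs}"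

lemma etP_induct [consumes 1, case_names base zero step]:
  assumes "t \<in> etP sc P" "\<And>vs. P vs \<Longrightarrow> R (et sc vs)" "R 0"
    "\<And>c s t. R s \<Longrightarrow> R t \<Longrightarrow> R (tsc c s + t)"
  shows "R t"
  using assms(1)[unfolded etP_def] by (rule tspan_induct[where P = R]) (use assms in auto)

lemma etP_zero: "0 \<in> etP sc P"
  and etP_add: "x \<in> etP sc P \<Longrightarrow> y \<in> etP sc P \<Longrightarrow> x + y \<in> etP sc P"
  and etP_diff: "x \<in> etP sc P \<Longrightarrow> y \<in> etP sc P \<Longrightarrow> x - y \<in> etP sc P"
  and etP_scale: "x \<in> etP sc P \<Longrightarrow> tsc c x \<in> etP sc P"
  unfolding etP_def by (auto intro: tspan_zero tspan_add tspan_diff tspan_scale)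

lemma etP_sum: "(\<And>i. i \<in> A \<Longrightarrow> f i \<in> etP sc P) \<Longrightarrow> sum f A \<in> etP sc P"
  unfolding etP_def by (rule tspan_sum)

lemma etP_lin_image:
  assumes "t \<in> etP sc P" "lin tsc tsc h" "\<And>vs. P vs \<Longrightarrow> h (et sc vs) \<in> tspan sc U"
  shows "h t \<in> tspan sc U"
  using assms(1) unfolding etP_def by (rule tspan_lin_image) (use assms in auto)

abbreviation tens where "tens sc \<equiv> etP sc (\<lambda>_. True)"
abbreviation tensN where "tensN sc m \<equiv> etP sc (\<lambda>vs. length vs = m)"

lemma etP_mono: "(\<And>vs. P vs \<Longrightarrow> Q vs) \<Longrightarrow> t \<in> etP sc P \<Longrightarrow> t \<in> etP sc Q"
  using tspan_mono[of "{et sc vs | vs. P vs}" "{et sc vs | vs. Q vs}"] unfolding etP_def by blast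

lemma etP_tens: "t \<in> etP sc P \<Longrightarrow> t \<in> tens sc"
  by (rule etP_mono[rotated]) auto

lemma et_etP: "P vs \<Longrightarrow> et sc vs \<in> etP sc P"
  unfolding etP_def by (rule tspan_base) auto

lemma et_tens [simp]: "et sc vs \<in> tens sc"
  by (rule et_etP) simp

lemma tens_nonmlin: "t \<in> tens sc \<Longrightarrow> \<not> mlin sc \<phi> \<Longrightarrow> t \<phi> = 0"
  by (induction rule: etP_induct) (auto simp: et_def tsc_def)

text \<open>The type \<open>tensor\<close> contains arbitrary functions of the form. Linearity in
  the form is a property of the span of elementary tensors, inherited from evaluation.\<close>

lemma tens_combo: "t \<in> tens sc \<Longrightarrow> mlin sc \<phi> \<Longrightarrow> mlin sc \<psi> \<Longrightarrow> t (\<lambda>x. c * \<phi> x + \<psi> x) = c * t \<phi> + t \<psi>"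
proof (induction rule: etP_induct)
  case (base s)
  then show ?case by (auto simp: et_mlin[OF mlin_combo])
qed (simp_all add: tsc_def algebra_simps)

text \<open>A form may be replaced by one that agrees with it only on the lists that can occur. This
  is how the grading of \<open>gam\<close> enters later computations.\<close>

lemma etP_cong:
  "t \<in> etP sc P \<Longrightarrow> mlin sc \<phi> \<Longrightarrow> mlin sc \<psi> \<Longrightarrow> (\<And>vs. P vs \<Longrightarrow> \<phi> vs = \<psi> vs) \<Longrightarrow> t \<phi> = t \<psi>"
  by (induction rule: etP_induct) (auto simp: tsc_def)

lemma tens_sum:
  assumes "t \<in> tens sc" "finite A" "\<And>i. i \<in> A \<Longrightarrow> mlin sc (\<phi> i)"
  shows "t (\<lambda>x. \<Sum>i\<in>A. \<phi> i x) = (\<Sum>i\<in>A. t (\<phi> i)) \<and> mlin sc (\<lambda>x. \<Sum>i\<in>A. \<phi> i x)"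
proof -
  have 0: "mlin sc (\<lambda>x. 0)" by (auto simp: mlin_def)
  \<comment> \<open>With coefficient -1 the combination of the zero form with itself
    cancels.\<close>
  have t0: "t (\<lambda>x. 0) = 0" using tens_combo[OF assms(1) 0 0, of "-1"] by simp
  show ?thesis using assms(2,3)
  proof (induction A)
    case empty then show ?case using 0 t0 by simp
  next
    case (insert i A)
    then show ?case using tens_combo[OF assms(1), of "\<phi> i" "\<lambda>x. \<Sum>i\<in>A. \<phi> i x" 1]
      mlin_combo[of sc "\<phi> i" "\<lambda>x. \<Sum>i\<in>A. \<phi> i x" 1] by simp
  qed
qed

lemma mlin_tens_right:
  fixes \<phi> :: "'v::ab_group_add list \<Rightarrow> 'k::field"
  assumes t: "t \<in> tens sc" and "mlin sc \<phi>"
  shows "mlin sc (\<lambda>xs. t (\<lambda>ys. \<phi> (xs @ ys)))"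
  unfolding mlin_def
proof (intro allI)
  fix xs ys :: "'v list" and c u v
  have "(\<lambda>zs. \<phi> ((xs @ (sc c u + v) # ys) @ zs)) = (\<lambda>zs. c * \<phi> ((xs @ u # ys) @ zs) + \<phi> ((xs @ v # ys) @ zs))"
    using assms(2) by (auto simp: mlin_def)
  then show "t (\<lambda>zs. \<phi> ((xs @ (sc c u + v) # ys) @ zs)) =
       c * t (\<lambda>zs. \<phi> ((xs @ u # ys) @ zs)) + t (\<lambda>zs. \<phi> ((xs @ v # ys) @ zs))"
    by (simp only: tens_combo[OF t mlin_append_left[OF assms(2)] mlin_append_left[OF assms(2)]])
qed

lemma tprod_et_left: "t \<in> tens sc \<Longrightarrow> mlin sc \<phi> \<Longrightarrow> tprod sc (et sc xs) t \<phi> = t (\<lambda>ys. \<phi> (xs @ ys))"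
  by (simp add: tprod_def mlin_tens_right)

lemma tprod_et_et: "tprod sc (et sc xs) (et sc ys) = et sc (xs @ ys)"
  by (rule ext) (auto simp: tprod_def et_def mlin_append_left mlin_append_right)

lemma lin_tprod_left: "lin tsc tsc (\<lambda>s. tprod sc s t)"
  by (intro linI vector_space_tsc ext) (auto simp: tprod_def tsc_def)

text \<open>Here \<open>r\<close> is applied to a combination of forms, so it has to be linear in
  its form, and the inner tensors have to produce forms again.\<close>

lemma tprod_combo_right:
  assumes "r \<in> tens sc" "s \<in> tens sc" "t \<in> tens sc"
  shows "tprod sc r (tsc c s + t) = tsc c (tprod sc r s) + tprod sc r t"
  by (rule ext) (auto simp: tprod_def tsc_def mlin_tens_right assms tens_combo[OF assms(1) mlin_tens_right[OF assms(2)] mlin_tens_right[OF assms(3)]])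

lemma tprod_zero_right:
  assumes "r \<in> tens sc"
  shows "tprod sc r 0 = 0"
  using tprod_combo_right[OF assms etP_zero etP_zero, of "-1"] by simp

lemma tprod_in:
  assumes "s \<in> etP sc P" "t \<in> etP sc Q" "\<And>xs ys. P xs \<Longrightarrow> Q ys \<Longrightarrow> R (xs @ ys)"
  shows "tprod sc s t \<in> etP sc R"
  using assms(1)
  unfolding etP_def[of sc R]
proof (rule etP_lin_image[OF _ lin_tprod_left])
  fix xs assume xs: "P xs"
  from assms(2) have "tprod sc (et sc xs) t \<in> etP sc R \<and> t \<in> tens sc"
  proof (induction rule: etP_induct)
    case (base ys)
    then show ?case using assms(3)[OF xs base] by (simp add: tprod_et_et et_etP)
  next
    case zero
    show ?case unfolding tprod_zero_right[OF et_tens] by (intro conjI etP_zero)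
  next
    case (step c s t)
    then have "tprod sc (et sc xs) (tsc c s + t) \<in> etP sc R" "tsc c s + t \<in> tens sc"
      by (simp_all only: tprod_combo_right[OF et_tens] etP_add etP_scale)
    then show ?case by (rule conjI)
  qed
  then show "tprod sc (et sc xs) t \<in> tspan sc {et sc vs |vs. R vs}" by (simp add: etP_def)
qed

lemma tprod_list_tens: "(\<And>t. t \<in> set ts \<Longrightarrow> t \<in> tens sc) \<Longrightarrow> tprod_list sc ts \<in> tens sc"
  by (induction ts) (auto intro: tprod_in)

lemma lin_tapp: "lin tsc tsc (tapp sc m G)"
  by (intro linI vector_space_tsc ext) (auto simp: tapp_def tsc_def)

text \<open>On a form that is not multilinear the left side is 0 by definition; membership of
  \<open>G vs\<close> in \<open>tens\<close> makes the right side vanish there too.\<close>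

lemma tapp_et:
  assumes "\<And>\<phi>. mlin sc \<phi> \<Longrightarrow> mlN sc m (\<lambda>xs. G xs \<phi>)" "length vs = m" "G vs \<in> tens sc"
  shows "tapp sc m G (et sc vs) = G vs"
  using assms tens_nonmlin[OF assms(3)] by (auto simp: tapp_def mlin_rst_iff intro!: ext)

lemma tapp_in:
  assumes t: "t \<in> etP sc P" and P: "\<And>xs. P xs \<Longrightarrow> length xs = m"
    and ml: "\<And>\<phi>. mlin sc \<phi> \<Longrightarrow> mlN sc m (\<lambda>xs. G xs \<phi>)"
    and G: "\<And>xs. P xs \<Longrightarrow> G xs \<in> etP sc Q"
  shows "tapp sc m G t \<in> etP sc Q"
  using t unfolding etP_def[of sc Q]
  by (rule etP_lin_image[OF _ lin_tapp]) (use G in \<open>simp add: tapp_et[OF ml P etP_tens[OF G]] etP_def\<close>)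

section \<open>Tensors of arity two\<close>

\<comment> \<open>These rules also rewrite unapplied sums of tensors, into lambda terms that no lemma matches.\<close>
declare zero_fun_apply [simp del] plus_fun_apply [simp del] minus_apply [simp del] uminus_apply [simp del]

text \<open>Every tensor of arity two has this shape (\<open>T2_S2\<close>), which reduces
  statements about \<open>T2\<close> to inductions on a list of pairs.\<close>

definition S2 :: "('k::field \<Rightarrow> 'v::ab_group_add \<Rightarrow> 'v) \<Rightarrow> ('v \<times> 'v) list \<Rightarrow> ('v,'k) tensor" where
  "S2 sc ps = (\<Sum>(a,b)\<leftarrow>ps. et sc [a, b])"

text \<open>The linear map on \<open>V \<otimes> V\<close> induced by a bilinear map \<open>B\<close>; for bilinear \<open>B\<close> the value does
  not depend on the representation picked by \<open>SOME\<close> (\<open>lft_S2\<close>).\<close>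
definition lft :: "('k::field \<Rightarrow> 'v::ab_group_add \<Rightarrow> 'v) \<Rightarrow> ('v \<Rightarrow> 'v \<Rightarrow> 'w::comm_monoid_add) \<Rightarrow> ('v,'k) tensor \<Rightarrow> 'w" where
  "lft sc B t = (\<Sum>(a,b)\<leftarrow>(SOME ps. t = S2 sc ps). B a b)"

text \<open>A basis of the span stays independent after adding \<open>v\<close>, so the coordinate
  of \<open>v\<close> extends to a functional on the whole space.\<close>

lemma linear_extend_off_span:
  assumes "vector_space a" "v \<notin> module.span a S"
  obtains f where "lin a (*) f" "f v = 1" "\<And>x. x \<in> module.span a S \<Longrightarrow> f x = 0"
proof -
  interpret a: vector_space a by fact
  interpret k: vector_space "(*) :: 'a \<Rightarrow> 'a \<Rightarrow> 'a" by (rule vector_space_times)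
  interpret vector_space_pair a "(*)" ..
  obtain B where B: "B \<subseteq> a.span S" "a.independent B" "a.span S \<subseteq> a.span B"
    using a.maximal_independent_subset[of "a.span S"] by blast
  have sB: "a.span B = a.span S" using B a.span_minimal[of B "a.span S"] by auto
  have ind: "a.independent (insert v B)"
    using B assms(2) sB by (simp add: a.independent_insert)
  obtain g where g: "lin a (*) g" "\<forall>x\<in>insert v B. g x = (if x = v then 1 else 0)"
    using linear_independent_extend[OF ind, of "\<lambda>x. if x = v then 1 else 0"] by blast
  have vB: "v \<notin> B" using a.span_base assms(2) sB by auto
  have "g x = 0" if "x \<in> a.span S" for x
    using that unfolding sB[symmetric]
  proof (induction rule: a.span_induct_alt)
    case base then show ?case using lin_0[OF g(1)] .
  next
    case (step c x y)
    then show ?case using g vB by (auto simp: lin_add[OF g(1)] lin_scale[OF g(1)])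
  qed
  then show ?thesis using that[of g] g by auto
qed

text \<open>A nonzero difference lies outside the zero span and is detected by a functional. Vector-
  and tensor-valued identities are reduced to scalar ones this way.\<close>

lemma separation:
  assumes "vector_space b" "\<And>f. lin b (*) f \<Longrightarrow> f x = f y"
  shows "x = y"
proof (rule ccontr)
  interpret b: vector_space b by fact
  assume "x \<noteq> y"
  then have "x - y \<notin> b.span {}" by simp
  then obtain f where "lin b (*) f" "f (x - y) = 1"
    using linear_extend_off_span[OF assms(1)] by blast
  then show False using assms(2)[of f] lin_diff[of b "(*)" f x y] by simp
qed

section \<open>Bilinear maps evaluated on tensors of arity two\<close>

locale tensor_space = vector_space sc for sc :: "'k::field \<Rightarrow> 'v::ab_group_add \<Rightarrow> 'v"
begin

lemma vs: "vector_space sc" by unfold_locales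

abbreviation T2 where "T2 \<equiv> tensN sc 2"

lemma et2_T2 [simp]: "et sc [a, b] \<in> T2"
  by (rule et_etP) simp

lemma lin_et: "lin sc tsc (\<lambda>x. et sc (xs @ x # ys))"
proof (intro linI vs vector_space_tsc ext)
  show "et sc (xs @ (sc c x + y) # ys) \<phi> = (tsc c (et sc (xs @ x # ys)) + et sc (xs @ y # ys)) \<phi>" for c x y \<phi>
    by (cases "mlin sc \<phi>") (auto simp: plus_fun_apply et_def tsc_def mlin_def)
qed

lemma lin_et1: "lin sc tsc (\<lambda>x. et sc [x])"
  using lin_et[of "[]" "[]"] by simp

lemma bil_et2: "bil sc tsc (\<lambda>x y. et sc [x, y])"
  using lin_et[of "[]"] lin_et[of "[_]"] by (auto intro!: bilI)

text \<open>A functional extended by zero from arity one is a form. The lemma turns axioms stated in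
  arity-one tensors, such as the counit laws, into equations between vectors.\<close>

lemma et1_inj: "et sc [x] = et sc [y] \<longleftrightarrow> x = y"
proof
  assume e: "et sc [x] = et sc [y]"
  show "x = y"
  proof (rule separation[OF vs])
    fix f assume f: "lin sc (*) f"
    have "mlin sc (rst (Suc 0) (\<lambda>xs. f (hd xs)))"
      unfolding mlin_rst_iff by (rule mlN_1) (simp add: f)
    from et_mlin[OF this, of "[x]"] et_mlin[OF this, of "[y]"] e show "f x = f y" by simp
  qed
qed simp

lemma S2_Nil: "S2 sc [] = 0" and S2_Cons: "S2 sc ((a, b) # ps) = et sc [a, b] + S2 sc ps"
  and S2_append: "S2 sc (ps @ qs) = S2 sc ps + S2 sc qs"
  by (simp_all add: S2_def)

lemma S2_scale: "tsc c (S2 sc ps) = S2 sc (map (\<lambda>(a,b). (sc c a, b)) ps)"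
  by (induction ps) (auto simp: S2_Nil S2_Cons tens.scale_right_distrib lin_scale[OF bil1[OF bil_et2]])

lemma T2_S2: "t \<in> T2 \<Longrightarrow> \<exists>ps. t = S2 sc ps"
proof (induction rule: etP_induct)
  case (base vs)
  then obtain a b where "vs = [a, b]" by (auto simp: numeral_2_eq_2 length_Suc_conv)
  then show ?case by (intro exI[of _ "[(a, b)]"]) (simp add: S2_def)
next
  case zero
  show ?case using S2_Nil by metis
next
  case (step c s t)
  then show ?case by (metis S2_scale S2_append)
qed

lemma S2_T2: "S2 sc ps \<in> T2"
  by (induction ps) (auto simp: S2_Nil S2_Cons etP_zero intro!: etP_add)

lemma S2_eval:
  assumes "mlin sc (rst 2 F)"
  shows "S2 sc ps (rst 2 F) = (\<Sum>(a,b)\<leftarrow>ps. F [a, b])"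
  using assms by (induction ps) (auto simp: zero_fun_apply plus_fun_apply S2_Nil S2_Cons)

text \<open>Independence of the representation: for each functional \<open>f\<close> on the target,
  \<open>f\<close> composed with \<open>B\<close> is a form of arity two, and two representations of
  one tensor take the same value on it.\<close>

lemma lft_S2:
  assumes B: "bil sc w B"
  shows "lft sc B (S2 sc ps) = (\<Sum>(a,b)\<leftarrow>ps. B a b)"
proof -
  define qs where "qs = (SOME qs. S2 sc ps = S2 sc qs)"
  have q: "S2 sc ps = S2 sc qs" unfolding qs_def by (rule someI_ex) blast
  have "(\<Sum>(a,b)\<leftarrow>ps. B a b) = (\<Sum>(a,b)\<leftarrow>qs. B a b)"
  proof (rule separation[OF bil_vs(2)[OF B]])
    fix f assume f: "lin w (*) f"
    let ?F = "\<lambda>xs. f (B (xs ! 0) (xs ! 1))"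
    have ml: "mlin sc (rst 2 ?F)" unfolding mlin_rst_iff
      by (rule mlN_2) (use bil_comp[OF B f] in simp)
    have "f (\<Sum>(a,b)\<leftarrow>ps. B a b) = S2 sc ps (rst 2 ?F)" for ps
      unfolding S2_eval[OF ml] lin_sum_list[OF f] by (simp add: case_prod_unfold)
    then show "f (\<Sum>(a,b)\<leftarrow>ps. B a b) = f (\<Sum>(a,b)\<leftarrow>qs. B a b)" using q by simp
  qed
  then show ?thesis by (simp add: lft_def qs_def)
qed

lemma lft_et: "bil sc w B \<Longrightarrow> lft sc B (et sc [a, b]) = B a b"
  using lft_S2[of w B "[(a, b)]"] by (simp add: S2_def)

lemma lft_add: "bil sc w B \<Longrightarrow> s \<in> T2 \<Longrightarrow> t \<in> T2 \<Longrightarrow> lft sc B (s + t) = lft sc B s + lft sc B t"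
  using T2_S2[of s] T2_S2[of t] by (auto simp: lft_S2 S2_append[symmetric])

lemma lft_scale:
  assumes "bil sc w B" "t \<in> T2" 
  shows "lft sc B (tsc c t) = w c (lft sc B t)"
proof -
  interpret w: vector_space w using bil_vs[OF assms(1)] by simp
  obtain ps where ps: "t = S2 sc ps" using T2_S2[OF assms(2)] by blast
  show ?thesis unfolding ps S2_scale lft_S2[OF assms(1)]
    by (induction ps) (auto simp: w.scale_right_distrib lin_scale[OF bil1[OF assms(1)]])
qed

lemma lft_zero: "bil sc w B \<Longrightarrow> lft sc B 0 = 0"
  using lft_S2[of w B "[]"] by (simp add: S2_Nil)

lemma lft_lin: "bil sc w B \<Longrightarrow> lin a tsc f \<Longrightarrow> (\<And>x. f x \<in> T2) \<Longrightarrow> lin a w (\<lambda>x. lft sc B (f x))"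
  by (intro linI) (auto simp: lft_add lft_scale etP_scale lin_add lin_scale dest: lin_vs1 bil_vs(2))

lemma lft_diff:
  assumes "bil sc w B" "s \<in> T2" "t \<in> T2"
  shows "lft sc B (s - t) = lft sc B s - lft sc B t"
  using lft_add[OF assms(1) etP_diff[OF assms(2,3)] assms(3)] by simp

lemma lft_comp:
  assumes "bil sc w B" "lin w u h" "t \<in> T2"
  shows "h (lft sc B t) = lft sc (\<lambda>a b. h (B a b)) t"
proof -
  obtain ps where ps: "t = S2 sc ps" using T2_S2[OF assms(3)] by blast
  show ?thesis unfolding ps lft_S2[OF assms(1)] lft_S2[OF bil_comp[OF assms(1,2)]] lin_sum_list[OF assms(2)]
    by (simp add: case_prod_unfold)
qed

lemma lft_param:
  assumes "\<And>x. bil sc w (B x)" "\<And>a b. lin u w (\<lambda>x. B x a b)" "t \<in> T2"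
  shows "lin u w (\<lambda>x. lft sc (B x) t)"
proof -
  obtain ps where ps: "t = S2 sc ps" using T2_S2[OF assms(3)] by blast
  show ?thesis unfolding ps lft_S2[OF assms(1)]
    using lin_vs1[OF assms(2)] lin_vs2[OF assms(2)]
    by (intro lin_sum_list_fun) (auto simp: case_prod_unfold assms(2))
qed

lemma lft_in:
  assumes "bil sc w B" "t \<in> tspan sc {et sc [a, b] | a b. P a b}" "module.subspace w U"
    "\<And>a b. P a b \<Longrightarrow> B a b \<in> U"
  shows "lft sc B t \<in> U"
proof -
  interpret w: vector_space w using bil_vs[OF assms(1)] by simp
  \<comment> \<open>Membership in \<open>T2\<close> is carried along because \<open>lft\<close> is
    additive only on tensors of arity two.\<close>
  have "t \<in> T2 \<and> lft sc B t \<in> U" using assms(2)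
  proof (induction rule: tspan_induct)
    case (base s)
    then show ?case using assms(1,4) by (auto simp: lft_et)
  next
    case zero
    show ?case using lft_zero[OF assms(1)] etP_zero w.subspace_0[OF assms(3)] by metis
  next
    case (step c s t)
    then have "tsc c s + t \<in> T2" "lft sc B (tsc c s + t) = w c (lft sc B s) + lft sc B t"
      by (simp_all only: etP_add etP_scale lft_add[OF assms(1)] lft_scale[OF assms(1)])
    then show ?case using step assms(3) w.subspace_add w.subspace_scale by metis
  qed
  then show ?thesis ..
qed

lemma T2_tspan2: "t \<in> T2 \<Longrightarrow> t \<in> tspan sc {et sc [a, b] | a b. True}"
  unfolding etP_def
  using tspan_mono[of "{et sc vs | vs. length vs = 2}" "{et sc [a, b] | a b. True}"]
  by (fastforce simp: numeral_2_eq_2 length_Suc_conv)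

lemma lft_et_id: "t \<in> T2 \<Longrightarrow> lft sc (\<lambda>a b. et sc [a, b]) t = t"
  using T2_S2[of t] lft_S2[OF bil_et2] by (auto simp: S2_def)

lemma T2_eval:
  assumes "t \<in> T2" "mlin sc \<phi>"
  shows "t \<phi> = lft sc (\<lambda>a b. \<phi> [a, b]) t"
proof -
  obtain ps where ps: "t = S2 sc ps" using T2_S2[OF assms(1)] by blast
  show ?thesis unfolding ps lft_S2[OF mlin_bil[OF assms(2) vs]]
    using assms(2) by (induction ps) (auto simp: zero_fun_apply plus_fun_apply S2_Nil S2_Cons)
qed

text \<open>Translates the \<open>tapp\<close> of the definitions into \<open>lft\<close>, in which
  all calculations with the coproduct are done.\<close>

lemma tapp2_lft:
  assumes "bil sc tsc (\<lambda>a b. G [a, b])" "\<And>a b. G [a, b] \<in> tens sc" "t \<in> T2"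
  shows "tapp sc 2 G t = lft sc (\<lambda>a b. G [a, b]) t"
proof -
  obtain ps where ps: "t = S2 sc ps" using T2_S2[OF assms(3)] by blast
  have ml: "mlN sc 2 (\<lambda>xs. G xs \<phi>)" for \<phi>
    by (rule mlN_2) (rule bil_comp[OF assms(1) lin_eval])
  show ?thesis unfolding ps lft_S2[OF assms(1)]
    by (induction ps) (auto simp: S2_Nil S2_Cons lin_0[OF lin_tapp] lin_add[OF lin_tapp] tapp_et[OF ml] assms(2))
qed

text \<open>The coefficients belong to positions rather than to vectors, so repetitions in
  \<open>vs\<close> are harmless and the coefficients can be distributed over a list of
  pairs.\<close>

lemma span_scaleD:
  assumes "v \<in> span (Z \<union> set vs)" "subspace Z"
  shows "\<exists>z\<in>Z. \<exists>cs. v = z + (\<Sum>i<length vs. sc (cs i) (vs ! i))"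
  using assms(1)
proof (induction rule: span_induct_alt)
  case base
  show ?case using subspace_0[OF assms(2)] by (intro bexI[of _ 0] exI[of _ "\<lambda>_. 0"]) auto
next
  case (step c x y)
  then obtain z cs where z: "z \<in> Z" "y = z + (\<Sum>i<length vs. sc (cs i) (vs ! i))" by blast
  show ?case
  proof (cases "x \<in> Z")
    case True
    then have "sc c x + z \<in> Z" using z assms(2) by (intro subspace_add subspace_scale)
    then show ?thesis by (intro bexI[of _ "sc c x + z"] exI[of _ cs]) (auto simp: z add.assoc)
  next
    case False
    then obtain j where j: "j < length vs" "x = vs ! j" using step(1) by (auto simp: in_set_conv_nth)
    have "(\<Sum>i<length vs. sc (cs i + (if i = j then c else 0)) (vs ! i))
      = (\<Sum>i<length vs. sc (cs i) (vs ! i)) + (\<Sum>i<length vs. if i = j then sc c (vs ! i) else 0)"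
      unfolding sum.distrib[symmetric] by (intro sum.cong) (auto simp: scale_left_distrib)
    also have "(\<Sum>i<length vs. if i = j then sc c (vs ! i) else 0) = sc c x"
      using j by simp
    finally show ?thesis using z
      by (intro bexI[of _ z] exI[of _ "\<lambda>i. cs i + (if i = j then c else 0)"]) (auto simp: add_ac)
  qed
qed

text \<open>The contraction \<open>id \<otimes> f\<close> of the second factor.\<close>

abbreviation slice :: "('v \<Rightarrow> 'k) \<Rightarrow> ('v,'k) tensor \<Rightarrow> 'v" where
  "slice f t \<equiv> lft sc (\<lambda>a b. sc (f b) a) t"

lemma bil_slice: "lin sc (*) f \<Longrightarrow> bil sc sc (\<lambda>a b. sc (f b) a)"
  by (auto intro!: bilI lin_smult_vec vs lin_smult[OF lin_id[OF vs]])

text \<open>If the leading second factor \<open>v\<close> depends on the others modulo \<open>Z\<close>, the representation can be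
  shortened; otherwise some functional singles out the first factor of \<open>v\<close> as a slice.\<close>
lemma slice_mem:
  assumes "t \<in> T2" "subspace W" "subspace Z"
    and "\<And>f. lin sc (*) f \<Longrightarrow> (\<And>z. z \<in> Z \<Longrightarrow> f z = 0) \<Longrightarrow> slice f t \<in> W"
  shows "t \<in> tspan sc {et sc [a, b] | a b. a \<in> W \<or> b \<in> Z}"
proof -
  \<comment> \<open>Induction on the number of terms; \<open>t\<close> is kept general because the
    shortened sum represents a different tensor.\<close>
  have "t \<in> T2 \<Longrightarrow> (\<And>f. lin sc (*) f \<Longrightarrow> (\<And>z. z \<in> Z \<Longrightarrow> f z = 0) \<Longrightarrow> slice f t \<in> W) \<Longrightarrow> t = S2 sc ps
     \<Longrightarrow> length ps = n \<Longrightarrow> t \<in> tspan sc {et sc [a, b] | a b. a \<in> W \<or> b \<in> Z}" for t ps n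
  proof (induction n arbitrary: t ps)
    case 0
    then show ?case by (simp add: S2_Nil tspan_zero)
  next
    case (Suc n)
    then obtain u v qs where ps: "ps = (u, v) # qs" "length qs = n" by (auto simp: length_Suc_conv)
    let ?vs = "map snd qs"
    show ?case
    proof (cases "v \<in> span (Z \<union> set ?vs)")
      case True
      then obtain z cs where z: "z \<in> Z" "v = z + (\<Sum>i<length ?vs. sc (cs i) (?vs ! i))"
        using span_scaleD[OF _ assms(3)] by blast
      \<comment> \<open>Expanding \<open>v\<close> turns \<open>u \<otimes> v\<close> into
        \<open>u \<otimes> z\<close> plus multiples of \<open>u\<close> against the remaining second
        factors; these multiples are absorbed into the first factors, leaving \<open>n\<close>
        terms.\<close>
      define rs where "rs = map (\<lambda>i. (fst (qs ! i) + sc (cs i) u, snd (qs ! i))) [0..<n]"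
      have "S2 sc rs = S2 sc qs + (\<Sum>i<n. et sc [u, sc (cs i) (?vs ! i)])"
      proof -
        have "S2 sc rs = (\<Sum>i<n. et sc [fst (qs ! i) + sc (cs i) u, snd (qs ! i)])"
          unfolding S2_def rs_def by (simp add: o_def interv_sum_list_conv_sum_set_nat atLeast0LessThan)
        also have "\<dots> = (\<Sum>i<n. et sc [fst (qs ! i), snd (qs ! i)] + et sc [u, sc (cs i) (?vs ! i)])"
        proof (rule sum.cong, goal_cases)
          case (2 i)
          then show ?case using ps
            by (simp add: lin_add[OF bil1[OF bil_et2]] lin_scale[OF bil1[OF bil_et2]] lin_scale[OF bil2[OF bil_et2]])
        qed simp
        also have "\<dots> = (\<Sum>i<n. et sc [fst (qs ! i), snd (qs ! i)]) + (\<Sum>i<n. et sc [u, sc (cs i) (?vs ! i)])"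
          by (rule sum.distrib)
        also have "(\<Sum>i<n. et sc [fst (qs ! i), snd (qs ! i)]) = S2 sc qs"
          unfolding S2_def sum_list_sum_nth using ps by (simp add: atLeast0LessThan case_prod_unfold)
        finally show ?thesis .
      qed
      moreover have "et sc [u, v] = et sc [u, z] + (\<Sum>i<n. et sc [u, sc (cs i) (?vs ! i)])"
        using z ps by (simp add: lin_add[OF bil2[OF bil_et2]] lin_sum[OF bil2[OF bil_et2]])
      ultimately have t: "t = et sc [u, z] + S2 sc rs" using Suc.prems(3) ps by (simp add: S2_Cons)
      have 1: "slice f (S2 sc rs) \<in> W" if f: "lin sc (*) f" "\<And>z. z \<in> Z \<Longrightarrow> f z = 0" for f
      proof -
        have "slice f t = sc (f z) u + slice f (S2 sc rs)"
          unfolding t by (simp add: lft_add[OF bil_slice[OF f(1)]] S2_T2 lft_et[OF bil_slice[OF f(1)]])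
        then show ?thesis using f(2)[OF z(1)] Suc.prems(2)[OF f] by simp
      qed
      have "S2 sc rs \<in> tspan sc {et sc [a, b] | a b. a \<in> W \<or> b \<in> Z}"
        by (rule Suc.IH[OF S2_T2 1 refl]) (auto simp: rs_def)
      then show ?thesis unfolding t using z(1) by (intro tspan_add) (auto intro!: tspan_base[of "et sc [_, _]"])
    next
      case False
      then obtain f where f: "lin sc (*) f" "f v = 1" "\<And>x. x \<in> span (Z \<union> set ?vs) \<Longrightarrow> f x = 0"
        using linear_extend_off_span[OF vs] by metis
      have fq: "f b = 0" if "(a, b) \<in> set qs" for a b
        using that by (intro f(3) span_base) force
      have "map (\<lambda>(a,b). sc (f b) a) qs = map (\<lambda>_. 0) qs" using fq by auto
      then have "slice f (S2 sc qs) = 0" by (simp only: lft_S2[OF bil_slice[OF f(1)]] sum_list_0)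
      then have "slice f t = u"
        unfolding Suc.prems(3) ps S2_Cons by (simp add: lft_add[OF bil_slice[OF f(1)]] S2_T2 lft_et[OF bil_slice[OF f(1)]] f(2))
      then have u: "u \<in> W" using Suc.prems(2)[OF f(1)] f(3) span_base by (metis UnI1)
      have 1: "slice g (S2 sc qs) \<in> W" if g: "lin sc (*) g" "\<And>z. z \<in> Z \<Longrightarrow> g z = 0" for g
      proof -
        have "slice g t = sc (g v) u + slice g (S2 sc qs)"
          unfolding Suc.prems(3) ps S2_Cons by (simp add: lft_add[OF bil_slice[OF g(1)]] S2_T2 lft_et[OF bil_slice[OF g(1)]])
        then have "slice g (S2 sc qs) = slice g t - sc (g v) u" by simp
        then show ?thesis using u Suc.prems(2)[OF g] assms(2) by (simp add: subspace_diff subspace_scale)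
      qed
      have "S2 sc qs \<in> tspan sc {et sc [a, b] | a b. a \<in> W \<or> b \<in> Z}"
        by (rule Suc.IH[OF S2_T2 1 refl ps(2)])
      then show ?thesis unfolding Suc.prems(3) ps S2_Cons using u by (intro tspan_add) (auto intro!: tspan_base[of "et sc [_, _]"])
    qed
  qed
  then show ?thesis using assms(1,4) T2_S2 by blast
qed

lemma tprod_et_right_lft:
  assumes "t \<in> T2"
  shows "tprod sc t (et sc vs) = lft sc (\<lambda>a b. et sc (a # b # vs)) t"
proof -
  obtain ps where ps: "t = S2 sc ps" using T2_S2[OF assms] by blast
  have b: "bil sc tsc (\<lambda>a b. et sc (a # b # vs))"
    using lin_et[of "[]"] lin_et[of "[_]"] by (auto intro!: bilI)
  show ?thesis unfolding ps lft_S2[OF b]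
    by (induction ps) (auto simp: S2_Nil S2_Cons lin_0[OF lin_tprod_left] lin_add[OF lin_tprod_left] tprod_et_et)
qed

lemma lin_tprod_right:
  assumes "r \<in> tens sc" "lin a tsc f" "\<And>x. f x \<in> tens sc"
  shows "lin a tsc (\<lambda>x. tprod sc r (f x))"
  using lin_vs1[OF assms(2)]
  by (intro linI vector_space_tsc) (auto simp: lin_add[OF assms(2)] lin_scale[OF assms(2)] tprod_combo_right assms)

lemma tprod_et_left_lft:
  assumes "t \<in> T2"
  shows "tprod sc (et sc vs) t = lft sc (\<lambda>a b. et sc (vs @ [a, b])) t"
proof -
  obtain ps where ps: "t = S2 sc ps" using T2_S2[OF assms] by blast
  have b: "bil sc tsc (\<lambda>a b. et sc (vs @ [a, b]))"
    using lin_et[of "vs"] lin_et[of "vs @ [_]"] by (auto intro!: bilI)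
  have [simp]: "S2 sc ps \<in> tens sc" for ps using S2_T2 etP_tens by blast
  have a: "tprod sc (et sc vs) (s + t) = tprod sc (et sc vs) s + tprod sc (et sc vs) t"
    if "s \<in> tens sc" "t \<in> tens sc" for s t
    using tprod_combo_right[OF et_tens that, where c = 1] by simp
  show ?thesis unfolding ps lft_S2[OF b]
    by (induction ps) (auto simp: S2_Nil S2_Cons tprod_zero_right a tprod_et_et)
qed

end

section \<open>Partitions and their refinements\<close>

text \<open>Currying: a form of arity \<open>m + n\<close> is evaluated in two nested stages, each
  extended by zero from its own length.\<close>

lemma tprod_rst:
  assumes t: "t \<in> tensN sc m" and s: "s \<in> tens sc" and \<Psi>: "mlN sc (m + n) \<Psi>"
  shows "tprod sc t s (rst (m + n) \<Psi>) = t (rst m (\<lambda>xs. s (rst n (\<lambda>ys. \<Psi> (xs @ ys)))))"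
    and "mlin sc (rst m (\<lambda>xs. s (rst n (\<lambda>ys. \<Psi> (xs @ ys)))))"
proof -
  have ml: "mlin sc (rst (m + n) \<Psi>)" using \<Psi> by (simp add: mlin_rst_iff)
  have eq: "s (\<lambda>ys. rst (m + n) \<Psi> (xs @ ys)) = s (rst n (\<lambda>ys. \<Psi> (xs @ ys)))" if "length xs = m" for xs
    using that by (intro arg_cong[of _ _ s]) auto
  have 1: "mlin sc (\<lambda>xs. s (\<lambda>ys. rst (m + n) \<Psi> (xs @ ys)))"
    by (rule mlin_tens_right[OF s ml])
  show 2: "mlin sc (rst m (\<lambda>xs. s (rst n (\<lambda>ys. \<Psi> (xs @ ys)))))"
    unfolding mlin_rst_iff using mlN_cong[THEN iffD1, OF eq mlin_mlN[OF 1]] .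
  show "tprod sc t s (rst (m + n) \<Psi>) = t (rst m (\<lambda>xs. s (rst n (\<lambda>ys. \<Psi> (xs @ ys)))))"
    unfolding tprod_def using etP_cong[OF t 1 2] ml eq by simp
qed

lemma partitions_sum: "ns \<in> partitions n \<Longrightarrow> sum_list ns = n"
  by (auto simp: partitions_def)

lemma length_le_sum_list: "\<forall>x\<in>set ns. 0 < x \<Longrightarrow> length ns \<le> sum_list (ns :: nat list)"
  by (induction ns) auto

lemma finite_partitions: "finite (partitions n)"
proof (rule finite_subset)
  show "partitions n \<subseteq> {ns. set ns \<subseteq> {..n} \<and> length ns \<le> n}"
    using length_le_sum_list member_le_sum_list by (fastforce simp: partitions_def)
qed (rule finite_lists_length_le, simp)

lemma partitions_length: "ns \<in> partitions n \<Longrightarrow> 0 < length ns \<and> length ns \<le> n"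
  using length_le_sum_list[of ns] by (auto simp: partitions_def)

lemma partitions_append: "ms \<in> partitions n \<Longrightarrow> ms' \<in> partitions n' \<Longrightarrow> ms @ ms' \<in> partitions (n + n')"
  by (auto simp: partitions_def)

text \<open>Entries are positive, hence partial sums increase strictly and a prefix is determined by
  its sum.\<close>

lemma partition_prefix_unique:
  "\<forall>x\<in>set ms. 0 < x \<Longrightarrow> \<forall>x\<in>set ns. 0 < x \<Longrightarrow> sum_list ms = sum_list (ns :: nat list) \<Longrightarrow> ms @ ms' = ns @ ns' \<Longrightarrow> ms = ns"
proof (induction ms arbitrary: ns)
  case Nil
  then show ?case by (cases ns) auto
next
  case (Cons m ms)
  then show ?case by (cases ns) auto
qed

lemma finite_listset: "(\<And>A. A \<in> set As \<Longrightarrow> finite A) \<Longrightarrow> finite (listset As)"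
proof (induction As)
  case (Cons A As)
  have "listset (A # As) = (\<lambda>(x, xs). x # xs) ` (A \<times> listset As)" by (auto simp: set_Cons_def)
  then show ?case using Cons by (simp del: listset.simps)
qed simp

lemma sum_listset_Cons: "sum f (listset (A # As)) = (\<Sum>x\<in>A. \<Sum>xs\<in>listset As. f (x # xs))"
proof -
  have "listset (A # As) = (\<lambda>(x, xs). x # xs) ` (A \<times> listset As)" by (auto simp: set_Cons_def)
  then have "sum f (listset (A # As)) = (\<Sum>(x, xs)\<in>A \<times> listset As. f (x # xs))"
    by (simp only:) (subst sum.reindex, auto simp: inj_on_def case_prod_unfold)
  then show ?thesis by (simp add: sum.cartesian_product)
qed

lemma listset_iff: "xs \<in> listset As \<longleftrightarrow> list_all2 (\<in>) xs As"
proof (induction As arbitrary: xs)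
  case (Cons A As)
  then show ?case by (cases xs) (auto simp: set_Cons_def)
qed simp

text \<open>After the reordering \<open>pi_coass\<close> the tail of a list consists of blocks \<open>d # es\<close> with \<open>es\<close> of length \<open>l\<close>;
  \<open>fsts\<close> collects the heads and \<open>rests\<close> the remainders of these blocks.\<close>
fun fsts :: "nat list \<Rightarrow> 'v list \<Rightarrow> 'v list" where
  "fsts [] ys = []"
| "fsts (l # ls) ys = hd ys # fsts ls (drop (Suc l) ys)"

fun rests :: "nat list \<Rightarrow> 'v list \<Rightarrow> 'v list" where
  "rests [] ys = []"
| "rests (l # ls) ys = take l (tl ys) @ rests ls (drop (Suc l) ys)"

lemma pi_coass_split:
  assumes "length ds = length ls" "length es = sum_list ls"
  shows "hd (pi_coass ls (w # ds @ es)) = w" "length (pi_coass ls (w # ds @ es)) = Suc (length ls + sum_list ls)"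
    and "fsts ls (tl (pi_coass ls (w # ds @ es))) = ds" "rests ls (tl (pi_coass ls (w # ds @ es))) = es"
proof -
  \<comment> \<open>The part of \<open>pi_coass\<close> behind the head, with its two segments as
    separate arguments, so that removing the first block leaves an expression of the same
    shape.\<close>
  define itl where "itl = (\<lambda>ls ds es. concat (map (\<lambda>i. ds ! i # take (ls ! i) (drop (sum_list (take i ls)) es)) [0..<length ls]) :: 'a list)"
  have pi: "pi_coass ls (w # ds @ es) = w # itl ls ds es"
    unfolding pi_coass_def itl_def using assms
    by (auto intro!: arg_cong[of _ _ concat] simp: nth_append)
  have itl: "length (itl ls ds es) = length ls + sum_list ls \<and> fsts ls (itl ls ds es) = ds \<and> rests ls (itl ls ds es) = es"
    using assms
  proof (induction ls arbitrary: ds es)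
    case Nil
    then show ?case by (simp add: itl_def)
  next
    case (Cons l ls)
    obtain d ds' where ds: "ds = d # ds'" "length ds' = length ls" using Cons.prems by (cases ds) auto
    have "itl (l # ls) ds es = (d # take l es) @ itl ls ds' (drop l es)"
      unfolding itl_def ds by (simp add: map_upt_Suc add.commute del: upt_Suc)
    moreover have "length (drop l es) = sum_list ls" using Cons.prems by simp
    note IH = Cons.IH[OF ds(2) this]
    ultimately show ?case using Cons.prems ds IH by simp
  qed
  show "hd (pi_coass ls (w # ds @ es)) = w" "length (pi_coass ls (w # ds @ es)) = Suc (length ls + sum_list ls)"
    "fsts ls (tl (pi_coass ls (w # ds @ es))) = ds" "rests ls (tl (pi_coass ls (w # ds @ es))) = es"
    using itl by (simp_all add: pi)
qed

lemma split_by_lengths: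
  "sum_list ls = length xs \<Longrightarrow> \<exists>xss. map length xss = ls \<and> concat xss = xs"
proof (induction ls arbitrary: xs)
  case (Cons l ls)
  have "sum_list ls = length (drop l xs)" using Cons.prems by simp
  from Cons.IH[OF this] obtain xss where "map length xss = ls" "concat xss = drop l xs" by blast
  then show ?case using Cons.prems by (intro exI[of _ "take l xs # xss"]) auto
qed simp

lemma concat_lengths_inj: "concat xss = concat yss \<Longrightarrow> map length xss = map length yss \<Longrightarrow> xss = yss"
proof (induction xss arbitrary: yss)
  case (Cons xs xss)
  then show ?case by (cases yss) auto
qed simp

lemma sum_list_concat: "sum_list (concat xss) = sum_list (map sum_list xss :: 'a::monoid_add list)"
  by (induction xss) auto

text \<open>Injectivity holds because \<open>ms\<close> is the list of block sums of
  \<open>nss\<close>, and \<open>nss\<close> is determined by its concatenation and its block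
  lengths. Conversely \<open>ns\<close> is cut into blocks of lengths \<open>ls\<close>; as the
  entries of \<open>ls\<close> are positive, no block is empty.\<close>

lemma refinements_bij:
  "bij_betw (\<lambda>(ms, nss). (concat nss, map length nss))
     (SIGMA ms:partitions n. listset (map partitions ms))
     (SIGMA ns:partitions n. partitions (length ns))"
proof (rule bij_betwI')
  have ms: "ms = map sum_list nss" if "nss \<in> listset (map partitions ms)" for ms nss
    using that by (auto simp: listset_iff list_all2_conv_all_nth partitions_sum intro!: nth_equalityI)
  fix p q assume p: "p \<in> (SIGMA ms:partitions n. listset (map partitions ms))"
    and q: "q \<in> (SIGMA ms:partitions n. listset (map partitions ms))"
  show "((case p of (ms, nss) \<Rightarrow> (concat nss, map length nss)) = (case q of (ms, nss) \<Rightarrow> (concat nss, map length nss))) = (p = q)"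
  proof -
    obtain ms nss where p': "p = (ms, nss)" by (cases p)
    obtain ms' nss' where q': "q = (ms', nss')" by (cases q)
    have "ms = map sum_list nss" "ms' = map sum_list nss'" using p q ms by (auto simp: p' q')
    then show ?thesis using concat_lengths_inj[of nss nss'] by (auto simp: p' q')
  qed
next
  fix p assume "p \<in> (SIGMA ms:partitions n. listset (map partitions ms))"
  then obtain ms nss where p: "p = (ms, nss)" "ms \<in> partitions n" "list_all2 (\<in>) nss (map partitions ms)"
    by (auto simp: listset_iff)
  have l: "length nss = length ms" and i: "\<And>i. i < length ms \<Longrightarrow> nss ! i \<in> partitions (ms ! i)"
    using p(3) by (auto simp: list_all2_conv_all_nth)
  have ms: "map sum_list nss = ms" using l i by (auto simp: partitions_sum intro!: nth_equalityI)
  have el: "\<exists>m\<in>set ms. ns \<in> partitions m" if "ns \<in> set nss" for ns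
    using that l i by (metis in_set_conv_nth)
  have el': "ns \<noteq> [] \<and> (\<forall>x\<in>set ns. 0 < x)" if "ns \<in> set nss" for ns
    using el[OF that] by (auto simp: partitions_def)
  have "sum_list (concat nss) = n" unfolding sum_list_concat ms using p(2) by (rule partitions_sum)
  moreover have "\<forall>x\<in>set (concat nss). 0 < x" using el' by auto
  moreover have "nss \<noteq> []" using partitions_length[OF p(2)] l by auto
  moreover from this have "concat nss \<noteq> []" using el'[of "hd nss"] by (cases nss) auto
  moreover have "\<forall>x\<in>set (map length nss). 0 < x" using el' by auto
  moreover have "sum_list (map length nss) = length (concat nss)" by (simp add: length_concat)
  ultimately show "(case p of (ms, nss) \<Rightarrow> (concat nss, map length nss)) \<in> (SIGMA ns:partitions n. partitions (length ns))"
    by (auto simp: p(1) partitions_def)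
next
  fix q assume "q \<in> (SIGMA ns:partitions n. partitions (length ns))"
  then obtain ns ls where q: "q = (ns, ls)" "ns \<in> partitions n" "ls \<in> partitions (length ns)" by auto
  obtain nss where nss: "map length nss = ls" "concat nss = ns"
    using split_by_lengths partitions_sum[OF q(3)] by blast
  define ms where "ms = map sum_list nss"
  have 1: "ns' \<noteq> [] \<and> (\<forall>x\<in>set ns'. 0 < x)" if "ns' \<in> set nss" for ns'
  proof
    have "length ns' \<in> set ls" using that nss(1) by auto
    then show "ns' \<noteq> []" using q(3) by (auto simp: partitions_def)
    have "set ns' \<subseteq> set ns" using that nss(2) by auto
    then show "\<forall>x\<in>set ns'. 0 < x" using q(2) by (auto simp: partitions_def)
  qed
  have 2: "0 < sum_list ns'" if "ns' \<in> set nss" for ns'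
    using 1[OF that] length_le_sum_list[of ns'] by (cases ns') auto
  have "nss \<in> listset (map partitions ms)"
    unfolding listset_iff ms_def using 1[OF nth_mem] by (auto simp: list_all2_conv_all_nth partitions_def)
  moreover have "ms \<in> partitions n"
    unfolding partitions_def
  proof (intro CollectI conjI)
    show "ms \<noteq> []" using nss(1) partitions_length[OF q(3)] by (auto simp: ms_def)
    show "\<forall>x\<in>set ms. 0 < x" using 2 by (simp add: ms_def)
    show "sum_list ms = n" using partitions_sum[OF q(2)] unfolding nss(2)[symmetric] sum_list_concat ms_def .
  qed
  ultimately show "\<exists>p\<in>(SIGMA ms:partitions n. listset (map partitions ms)). q = (case p of (ms, nss) \<Rightarrow> (concat nss, map length nss))"
    using q nss by (intro bexI[of _ "(ms, nss)"]) auto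
qed

section \<open>Multiplicativity of the coproduct\<close>

locale cooperad = tensor_space sc
  for sc :: "'k::field \<Rightarrow> 'v::ab_group_add \<Rightarrow> 'v" +
  fixes Op :: "nat \<Rightarrow> 'v set"
    and one :: 'v
    and gam :: "nat list \<Rightarrow> 'v \<Rightarrow> ('v,'k) tensor"
    and mult :: "'v \<Rightarrow> 'v \<Rightarrow> 'v"
    and Dl :: "'v \<Rightarrow> ('v,'k) tensor"
  assumes cooperad_mult: "cooperad_mult sc Op one gam mult Dl"
begin

lemmas
  ax_direct_sum = cooperad_mult[unfolded cooperad_mult_def, THEN conjunct1] and
  ax_structure_maps = cooperad_mult[unfolded cooperad_mult_def, THEN conjunct2, THEN conjunct1] and
  ax_coassoc = cooperad_mult[unfolded cooperad_mult_def, THEN conjunct2, THEN conjunct2, THEN conjunct1] and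
  ax_lin_left = cooperad_mult[unfolded cooperad_mult_def, THEN conjunct2, THEN conjunct2, THEN conjunct2, THEN conjunct1] and
  ax_lin_right = cooperad_mult[unfolded cooperad_mult_def, THEN conjunct2, THEN conjunct2, THEN conjunct2, THEN conjunct2, THEN conjunct1] and
  ax_assoc = cooperad_mult[unfolded cooperad_mult_def, THEN conjunct2, THEN conjunct2, THEN conjunct2, THEN conjunct2, THEN conjunct2, THEN conjunct1] and
  ax_unit = cooperad_mult[unfolded cooperad_mult_def, THEN conjunct2, THEN conjunct2, THEN conjunct2, THEN conjunct2, THEN conjunct2, THEN conjunct2, THEN conjunct1] and
  ax_graded = cooperad_mult[unfolded cooperad_mult_def, THEN conjunct2, THEN conjunct2, THEN conjunct2, THEN conjunct2, THEN conjunct2, THEN conjunct2, THEN conjunct2, THEN conjunct1] and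
  ax_compat1 = cooperad_mult[unfolded cooperad_mult_def, THEN conjunct2, THEN conjunct2, THEN conjunct2, THEN conjunct2, THEN conjunct2, THEN conjunct2, THEN conjunct2, THEN conjunct2, THEN conjunct1] and
  ax_compat2 = cooperad_mult[unfolded cooperad_mult_def, THEN conjunct2, THEN conjunct2, THEN conjunct2, THEN conjunct2, THEN conjunct2, THEN conjunct2, THEN conjunct2, THEN conjunct2, THEN conjunct2, THEN conjunct1] and
  ax_lin_Dl = cooperad_mult[unfolded cooperad_mult_def, THEN conjunct2, THEN conjunct2, THEN conjunct2, THEN conjunct2, THEN conjunct2, THEN conjunct2, THEN conjunct2, THEN conjunct2, THEN conjunct2, THEN conjunct2, THEN conjunct1] and
  ax_Dl_one = cooperad_mult[unfolded cooperad_mult_def, THEN conjunct2, THEN conjunct2, THEN conjunct2, THEN conjunct2, THEN conjunct2, THEN conjunct2, THEN conjunct2, THEN conjunct2, THEN conjunct2, THEN conjunct2, THEN conjunct2, THEN conjunct1] and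
  ax_Dl_eq = cooperad_mult[unfolded cooperad_mult_def, THEN conjunct2, THEN conjunct2, THEN conjunct2, THEN conjunct2, THEN conjunct2, THEN conjunct2, THEN conjunct2, THEN conjunct2, THEN conjunct2, THEN conjunct2, THEN conjunct2, THEN conjunct2]

text \<open>Reduces an identity that is linear in \<open>v\<close> to the unit and to homogeneous
  elements.\<close>

lemma V_induct [case_names one Op zero step]:
  assumes "P one" "\<And>n x. n \<ge> 1 \<Longrightarrow> x \<in> Op n \<Longrightarrow> P x" "P 0" "\<And>c x y. P x \<Longrightarrow> P y \<Longrightarrow> P (sc c x + y)"
  shows "P v"
proof -
  from ax_direct_sum obtain p where p: "finite {n. p n \<noteq> 0}" "p 0 \<in> range (\<lambda>c. sc c one)" "\<And>n. n \<ge> 1 \<Longrightarrow> p n \<in> Op n"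
    "v = (\<Sum>n\<in>{n. p n \<noteq> 0}. p n)"
    unfolding unit_adjoined_sum_def by blast
  have sc: "P (sc c x)" if "P x" for c x using assms(4)[OF that assms(3), of c] by simp
  have ad: "P (x + y)" if "P x" "P y" for x y using assms(4)[OF that, of 1] by simp
  have Pp: "P (p n)" for n
  proof (cases "n = 0")
    case True
    then show ?thesis using p(2) assms(1) sc by auto
  next
    case False
    then show ?thesis using p(3)[of n] assms(2)[of n] by simp
  qed
  have "P (\<Sum>n\<in>A. p n)" if "finite A" for A using that
    by (induction A) (auto intro: assms ad Pp)
  then show ?thesis using p by simp
qed

lemma Op_subspace: "n \<ge> 1 \<Longrightarrow> subspace (Op n)"
  using ax_direct_sum unfolding unit_adjoined_sum_def by blast

lemma
  assumes "ns \<in> partitions n"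
  shows gam_lin: "lin sc tsc (gam ns)"
    and gam_tsub: "x \<in> Op n \<Longrightarrow> gam ns x \<in> tsub sc Op ns"
    and gam_zero: "m \<ge> 1 \<Longrightarrow> m \<noteq> n \<Longrightarrow> x \<in> Op m \<Longrightarrow> gam ns x = 0"
    and gam_one: "gam ns one = 0"
  using ax_structure_maps[rule_format, OF assms] by blast+

lemma lin_mult_left: "lin sc sc (mult x)" and lin_mult_right: "lin sc sc (\<lambda>x. mult x y)"
  and mult_assoc: "mult (mult x y) z = mult x (mult y z)"
  and mult_one [simp]: "mult one x = x" "mult x one = x"
  and mult_Op: "n \<ge> 1 \<Longrightarrow> m \<ge> 1 \<Longrightarrow> x \<in> Op n \<Longrightarrow> y \<in> Op m \<Longrightarrow> mult x y \<in> Op (n + m)"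
  and lin_Dl: "lin sc tsc Dl" and Dl_one: "Dl one = et sc [one, one]"
  using ax_lin_left ax_lin_right ax_assoc ax_unit ax_graded ax_lin_Dl ax_Dl_one by simp_all

lemma gam_mult_zero: "n \<ge> 1 \<Longrightarrow> n' \<ge> 1 \<Longrightarrow> x \<in> Op n \<Longrightarrow> y \<in> Op n' \<Longrightarrow> ms \<in> partitions (n + n') \<Longrightarrow>
        (\<And>i. sum_list (take i ms) \<noteq> n) \<Longrightarrow> gam ms (mult x y) = 0"
  using ax_compat2 by blast

lemma lin_mult_comp: "lin sc w h \<Longrightarrow> lin sc w (\<lambda>x. h (mult a x))" "lin sc w h \<Longrightarrow> lin sc w (\<lambda>x. h (mult x a))"
  using lin_comp lin_mult_left lin_mult_right by fast+

abbreviation pr :: "'v list \<Rightarrow> 'v" where "pr ws \<equiv> foldr mult ws one"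

lemma pr_append: "pr (xs @ ys) = mult (pr xs) (pr ys)"
  by (induction xs) (auto simp: mult_assoc)

text \<open>The condition on generators in \<open>tsub\<close>, isolated as a predicate so that
  \<open>etP_cong\<close> can be applied to \<open>gam ns x\<close>.\<close>

definition graded :: "nat list \<Rightarrow> 'v list \<Rightarrow> bool" where
  "graded ns vs \<longleftrightarrow> length vs = Suc (length ns) \<and> vs ! 0 \<in> Op (length ns) \<and> (\<forall>i<length ns. vs ! Suc i \<in> Op (ns ! i))"

lemma gradedD: "graded ns vs \<Longrightarrow> length vs = Suc (length ns)" "graded ns vs \<Longrightarrow> hd vs \<in> Op (length ns)"
  "graded ns vs \<Longrightarrow> list_all2 (\<lambda>v n. v \<in> Op n) (tl vs) ns"
  by (cases vs; auto simp: graded_def list_all2_conv_all_nth)+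

lemma gam_graded: "ns \<in> partitions n \<Longrightarrow> x \<in> Op n \<Longrightarrow> gam ns x \<in> etP sc (graded ns)"
  using gam_tsub unfolding tsub_def etP_def graded_def by simp

text \<open>The arity is right for every \<open>x\<close>, homogeneous or not, because
  \<open>gam ns\<close> is zero on the other summands.\<close>

lemma gam_tensN: "ns \<in> partitions n \<Longrightarrow> gam ns x \<in> tensN sc (Suc (length ns))"
proof (induction x rule: V_induct)
  case one
  then show ?case by (simp add: gam_one etP_zero)
next
  case (Op m x)
  show ?case
  proof (cases "m = n")
    case True
    then show ?thesis using gam_graded[OF Op(3)] Op(2) gradedD(1) by (blast intro: etP_mono[rotated])
  next
    case False
    then show ?thesis using gam_zero[OF Op(3,1) _ Op(2)] etP_zero by metis
  qed
next
  case zero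
  then show ?case using lin_0[OF gam_lin] etP_zero by metis
next
  case (step c x y)
  then show ?case using lin_add[OF gam_lin] lin_scale[OF gam_lin] etP_add etP_scale by metis
qed

lemma mlN_pr: "lin sc (*) h \<Longrightarrow> mlN sc l (\<lambda>zs. h (pr zs))"
proof (induction l arbitrary: h)
  case 0
  show ?case by (rule mlN_0)
next
  case (Suc l)
  show ?case
    by (rule mlN_Suc) (use Suc.IH[OF lin_mult_comp(1)[OF Suc.prems]] in \<open>auto intro: lin_mult_comp Suc.prems\<close>)
qed

lemma mlN_hd_pr: "bil sc (*) \<beta> \<Longrightarrow> mlN sc (Suc l) (\<lambda>zs. \<beta> (hd zs) (pr (tl zs)))"
  by (rule mlN_Suc) (auto intro: mlN_pr bil1 bil2)

lemma bil_mult_comp: "bil sc w \<beta> \<Longrightarrow> bil sc w (\<lambda>c d. \<beta> (mult a c) (mult b d))"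
  "bil sc w \<beta> \<Longrightarrow> bil sc w (\<lambda>a b. \<beta> (mult a c) (mult b d))"
  by (auto intro!: bilI intro: lin_comp[OF lin_mult_left] lin_comp[OF lin_mult_right] bil1 bil2)

text \<open>The head and the remainder of the first block are multiplied into the two arguments of
  \<open>\<gamma>\<close>, which leaves the same statement for fewer blocks; hence the induction
  over all \<open>\<gamma>\<close>.\<close>

lemma mlN_fsts_rests:
  "bil sc (*) \<gamma> \<Longrightarrow> mlN sc (length ls + sum_list ls) (\<lambda>ys. \<gamma> (pr (fsts ls ys)) (pr (rests ls ys)))"
proof (induction ls arbitrary: \<gamma>)
  case Nil
  then show ?case by (simp add: mlN_0)
next
  case (Cons l ls)
  have "mlN sc (Suc l + (length ls + sum_list ls)) (\<lambda>ys. \<gamma> (pr (fsts (l # ls) ys)) (pr (rests (l # ls) ys)))"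
  proof (rule mlN_append)
    fix xs :: "'v list" assume l: "length xs = Suc l"
    then have *: "hd (xs @ ys) = hd xs" "take l (tl (xs @ ys)) = tl xs" "drop (Suc l) (xs @ ys) = ys" for ys :: "'v list"
      by (auto simp: length_Suc_conv)
    show "mlN sc (length ls + sum_list ls) (\<lambda>ys. \<gamma> (pr (fsts (l # ls) (xs @ ys))) (pr (rests (l # ls) (xs @ ys))))"
      unfolding fsts.simps rests.simps * by (simp add: pr_append del: foldr_append) (intro Cons.IH bil_mult_comp Cons.prems)
  next
    fix ys :: "'v list"
    have *: "hd (xs @ ys) = hd xs" "take l (tl (xs @ ys)) = tl xs" "drop (Suc l) (xs @ ys) = ys" if "length xs = Suc l" for xs :: "'v list"
      using that by (auto simp: length_Suc_conv)
    show "mlN sc (Suc l) (\<lambda>xs. \<gamma> (pr (fsts (l # ls) (xs @ ys))) (pr (rests (l # ls) (xs @ ys))))"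
    proof (rule mlN_cong[THEN iffD2])
      show "mlN sc (Suc l) (\<lambda>xs. \<gamma> (mult (hd xs) (pr (fsts ls ys))) (mult (pr (tl xs)) (pr (rests ls ys))))"
        by (rule mlN_hd_pr) (rule bil_mult_comp[OF Cons.prems])
    qed (simp add: * pr_append del: foldr_append)
  qed
  then show ?case by (simp add: add_ac)
qed

lemma tapp_hd_pr_T2:
  assumes "ns \<in> partitions n"
  shows "tapp sc (Suc (length ns)) (\<lambda>zs. et sc [hd zs, pr (tl zs)]) (gam ns x) \<in> T2"
proof (rule tapp_in[OF gam_tensN[OF assms]])
  fix \<phi> assume "mlin sc \<phi>"
  then show "mlN sc (Suc (length ns)) (\<lambda>xs. et sc [hd xs, pr (tl xs)] \<phi>)"
    using mlN_hd_pr[OF mlin_bil[OF _ vs]] by simp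
qed auto

lemma Dl_Op: "n \<ge> 1 \<Longrightarrow> x \<in> Op n \<Longrightarrow> Dl x = (\<Sum>ns\<in>partitions n.
          tapp sc (Suc (length ns)) (\<lambda>zs. et sc [hd zs, pr (tl zs)]) (gam ns x))"
  using ax_Dl_eq by blast

lemma Dl_T2: "Dl x \<in> T2"
proof (induction x rule: V_induct)
  case one
  then show ?case by (simp add: Dl_one)
next
  case (Op n x)
  then show ?case by (simp only: Dl_Op) (intro etP_sum tapp_hd_pr_T2)
next
  case zero
  show ?case using lin_0[OF lin_Dl] etP_zero by metis
next
  case (step c x y)
  then show ?case using lin_add[OF lin_Dl] lin_scale[OF lin_Dl] etP_add etP_scale by metis
qed

text \<open>The form \<open>\<beta>\<close> is pulled back along
  \<open>zs \<mapsto> (hd zs, pr (tl zs))\<close>, after which only values of \<open>gam\<close>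
  remain. Multiplicativity and coassociativity are both computed from this formula.\<close>

lemma lft_Dl_Op:
  assumes "n \<ge> 1" "x \<in> Op n" "bil sc (*) \<beta>"
  shows "lft sc \<beta> (Dl x) = (\<Sum>ns\<in>partitions n. gam ns x (rst (Suc (length ns)) (\<lambda>zs. \<beta> (hd zs) (pr (tl zs)))))"
proof -
  let ?\<phi> = "rst 2 (\<lambda>xs. \<beta> (xs ! 0) (xs ! Suc 0))"
  have ml: "mlin sc ?\<phi>" unfolding mlin_rst_iff by (rule mlN_2) (use assms(3) in simp)
  have "lft sc \<beta> (Dl x) = Dl x ?\<phi>" using T2_eval[OF Dl_T2 ml] by simp
  also have "\<dots> = (\<Sum>ns\<in>partitions n. tapp sc (Suc (length ns)) (\<lambda>zs. et sc [hd zs, pr (tl zs)]) (gam ns x) ?\<phi>)"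
    unfolding Dl_Op[OF assms(1,2)] by (rule lin_sum[OF lin_eval])
  also have "\<dots> = (\<Sum>ns\<in>partitions n. gam ns x (rst (Suc (length ns)) (\<lambda>zs. \<beta> (hd zs) (pr (tl zs)))))"
    by (simp add: tapp_def ml cong: if_cong)
  finally show ?thesis .
qed

lemma lft_Dl_lin: "bil sc w \<beta> \<Longrightarrow> lin sc w (\<lambda>x. lft sc \<beta> (Dl x))"
  by (rule lft_lin[OF _ lin_Dl Dl_T2])

lemma bil_lft_mult:
  assumes "bil sc w \<beta>"
  shows "bil sc w (\<lambda>a b. lft sc (\<lambda>c d. \<beta> (mult a c) (mult b d)) (Dl y))"
    by (intro bilI lft_param[OF _ _ Dl_T2] bil_mult_comp(1)[OF assms]
      bil1'[OF assms lin_mult_right] bil2'[OF assms lin_mult_right])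

lemma lin_combo_eq:
  assumes "lin a b f" "lin a b g" "f x = g x" "f y = g y"
  shows "f (a c x + y) = g (a c x + y)"
  using assms(3,4) by (simp add: lin_add[OF assms(1)] lin_add[OF assms(2)] lin_scale[OF assms(1)] lin_scale[OF assms(2)])

text \<open>Compatibility (1) evaluated at a scalar form and written as a nested evaluation. The
  second claim is what permits exchanging the outer evaluation with the sum over
  \<open>ms'\<close>.\<close>

lemma gam_mult_append:
  assumes x: "x \<in> Op n" "ms \<in> partitions n" and y: "y \<in> Op n'" "ms' \<in> partitions n'" and \<beta>: "bil sc (*) \<beta>"
  shows "gam (ms @ ms') (mult x y) (rst (Suc (length (ms @ ms'))) (\<lambda>zs. \<beta> (hd zs) (pr (tl zs))))
    = gam ms x (rst (Suc (length ms)) (\<lambda>zs. gam ms' y (rst (Suc (length ms')) (\<lambda>ws. \<beta> (mult (hd zs) (hd ws)) (mult (pr (tl zs)) (pr (tl ws)))))))"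
    and "mlin sc (rst (Suc (length ms)) (\<lambda>zs. gam ms' y (rst (Suc (length ms')) (\<lambda>ws. \<beta> (mult (hd zs) (hd ws)) (mult (pr (tl zs)) (pr (tl ws)))))))"
proof -
  let ?k = "length ms" and ?k' = "length ms'"
  \<comment> \<open>The factors coming from \<open>x\<close> occupy the first \<open>Suc ?k\<close>
    places; indices 0 and \<open>Suc ?k\<close> hold the leading factors, which get
    multiplied.\<close>
  let ?\<Psi> = "\<lambda>zs. \<beta> (mult (zs ! 0) (zs ! Suc ?k)) (mult (pr (take ?k (tl zs))) (pr (drop (?k + 2) zs)))"
  let ?H = "\<lambda>zs. \<beta> (hd zs) (pr (tl zs))"
  have \<Psi>: "?\<Psi> (xs @ ys) = \<beta> (mult (hd xs) (hd ys)) (mult (pr (tl xs)) (pr (tl ys)))"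
    if "length xs = Suc ?k" "length ys = Suc ?k'" for xs ys
    using that by (auto simp: length_Suc_conv nth_append)
  have ml\<Psi>: "mlN sc (Suc ?k + Suc ?k') ?\<Psi>"
  proof (rule mlN_append)
    fix xs :: "'v list" assume l: "length xs = Suc ?k"
    have "mlN sc (Suc ?k') (\<lambda>ys. \<beta> (mult (hd xs) (hd ys)) (mult (pr (tl xs)) (pr (tl ys))))"
      by (rule mlN_hd_pr) (rule bil_mult_comp[OF \<beta>])
    then show "mlN sc (Suc ?k') (\<lambda>ys. ?\<Psi> (xs @ ys))"
      by (rule mlN_cong[THEN iffD1, rotated]) (rule \<Psi>[OF l, symmetric])
  next
    fix ys :: "'v list" assume l: "length ys = Suc ?k'"
    have "mlN sc (Suc ?k) (\<lambda>xs. \<beta> (mult (hd xs) (hd ys)) (mult (pr (tl xs)) (pr (tl ys))))"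
      by (rule mlN_hd_pr) (rule bil_mult_comp[OF \<beta>])
    then show "mlN sc (Suc ?k) (\<lambda>xs. ?\<Psi> (xs @ ys))"
      by (rule mlN_cong[THEN iffD1, rotated]) (rule \<Psi>[OF _ l, symmetric])
  qed
  have mlH: "mlin sc (rst (Suc (length (ms @ ms'))) ?H)"
    unfolding mlin_rst_iff by (rule mlN_hd_pr[OF \<beta>])
  have eq1: "gam (ms @ ms') (mult x y) =
        tapp sc (?k + ?k' + 2)
          (\<lambda>zs. et sc (mult (zs ! 0) (zs ! Suc ?k) # take ?k (tl zs) @ drop (?k + 2) zs))
          (tprod sc (gam ms x) (gam ms' y))"
    using ax_compat1 x y by blast
  have "gam (ms @ ms') (mult x y) (rst (Suc (length (ms @ ms'))) ?H) = tprod sc (gam ms x) (gam ms' y)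
    (rst (?k + ?k' + 2) (\<lambda>zs. et sc (mult (zs ! 0) (zs ! Suc ?k) # take ?k (tl zs) @ drop (?k + 2) zs) (rst (Suc (length (ms @ ms'))) ?H)))"
    unfolding eq1 by (simp only: tapp_def mlH if_True)
  also have "(rst (?k + ?k' + 2) (\<lambda>zs. et sc (mult (zs ! 0) (zs ! Suc ?k) # take ?k (tl zs) @ drop (?k + 2) zs) (rst (Suc (length (ms @ ms'))) ?H)))
     = rst (Suc ?k + Suc ?k') ?\<Psi>"
    unfolding et_mlin[OF mlH] by (rule ext) (auto simp: pr_append simp del: foldr_append)
  also have "tprod sc (gam ms x) (gam ms' y) (rst (Suc ?k + Suc ?k') ?\<Psi>) =
    gam ms x (rst (Suc ?k) (\<lambda>xs. gam ms' y (rst (Suc ?k') (\<lambda>ys. ?\<Psi> (xs @ ys)))))"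
    by (rule tprod_rst(1)[OF gam_tensN[OF x(2)] etP_tens[OF gam_tensN[OF y(2)]] ml\<Psi>])
  also have eq2: "(rst (Suc ?k) (\<lambda>xs. gam ms' y (rst (Suc ?k') (\<lambda>ys. ?\<Psi> (xs @ ys)))))
    = (rst (Suc ?k) (\<lambda>zs. gam ms' y (rst (Suc ?k') (\<lambda>ws. \<beta> (mult (hd zs) (hd ws)) (mult (pr (tl zs)) (pr (tl ws)))))))"
    by (intro ext if_cong arg_cong[of _ _ "gam ms' y"] refl \<Psi>)
  finally show "gam (ms @ ms') (mult x y) (rst (Suc (length (ms @ ms'))) ?H)
    = gam ms x (rst (Suc ?k) (\<lambda>zs. gam ms' y (rst (Suc ?k') (\<lambda>ws. \<beta> (mult (hd zs) (hd ws)) (mult (pr (tl zs)) (pr (tl ws)))))))" .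
  show "mlin sc (rst (Suc (length ms)) (\<lambda>zs. gam ms' y (rst (Suc (length ms')) (\<lambda>ws. \<beta> (mult (hd zs) (hd ws)) (mult (pr (tl zs)) (pr (tl ws)))))))"
    using tprod_rst(2)[OF gam_tensN[OF x(2)] etP_tens[OF gam_tensN[OF y(2), of y]] ml\<Psi>] unfolding eq2 .
qed

text \<open>By compatibility (2) a partition of \<open>n + n'\<close> contributes only if some
  prefix has sum \<open>n\<close>. Such a partition is uniquely a concatenation, and compatibility
  (1) then factors its term.\<close>

lemma lft_Dl_mult_Op:
  assumes x: "x \<in> Op n" "n \<ge> 1" and y: "y \<in> Op n'" "n' \<ge> 1" and \<beta>: "bil sc (*) \<beta>"
  shows "lft sc \<beta> (Dl (mult x y)) = lft sc (\<lambda>a b. lft sc (\<lambda>c d. \<beta> (mult a c) (mult b d)) (Dl y)) (Dl x)"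
proof -
  let ?H = "\<lambda>zs. \<beta> (hd zs) (pr (tl zs))"
  let ?R = "\<lambda>ms ms'. rst (Suc (length ms)) (\<lambda>zs. gam ms' y (rst (Suc (length ms')) (\<lambda>ws. \<beta> (mult (hd zs) (hd ws)) (mult (pr (tl zs)) (pr (tl ws))))))"
  let ?f = "\<lambda>ms. gam ms (mult x y) (rst (Suc (length ms)) ?H)"
  let ?A = "(\<lambda>(ms, ms'). ms @ ms') ` (partitions n \<times> partitions n')"
  have inj: "inj_on (\<lambda>(ms, ms'). ms @ ms') (partitions n \<times> partitions n')"
  proof (rule inj_onI)
    fix p q assume "p \<in> partitions n \<times> partitions n'" "q \<in> partitions n \<times> partitions n'"
      "(case p of (ms, ms') \<Rightarrow> ms @ ms') = (case q of (ms, ms') \<Rightarrow> ms @ ms')"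
    then show "p = q"
      using partition_prefix_unique[of "fst p" "fst q" "snd p" "snd q"]
      by (cases p; cases q) (auto simp: partitions_def)
  qed
  have z: "?f ms = 0" if ms: "ms \<in> partitions (n + n') - ?A" for ms
  proof -
    have "sum_list (take i ms) \<noteq> n" for i
    proof
      assume i: "sum_list (take i ms) = n"
      have "sum_list (take i ms) + sum_list (drop i ms) = n + n'"
        using partitions_sum[of ms "n + n'"] ms by (metis append_take_drop_id sum_list.append DiffD1)
      then have "sum_list (drop i ms) = n'" using i by simp
      \<comment> \<open>As \<open>n\<close> and \<open>n'\<close> are positive, neither piece is
        empty, as partitions require.\<close>
      then have "take i ms \<in> partitions n" "drop i ms \<in> partitions n'"
        using i x(2) y(2) ms unfolding partitions_def
        by (cases "take i ms = []", simp, cases "drop i ms = []", simp, force dest: in_set_takeD in_set_dropD)+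
      then have "(take i ms, drop i ms) \<in> partitions n \<times> partitions n'" by simp
      then have "(\<lambda>(ms, ms'). ms @ ms') (take i ms, drop i ms) \<in> ?A" by (rule imageI)
      then have "ms \<in> ?A" by simp
      then show False using ms by blast
    qed
    then have "gam ms (mult x y) = 0"
      using gam_mult_zero x y ms by simp
    then show ?thesis by (simp add: zero_fun_apply)
  qed
  have "lft sc \<beta> (Dl (mult x y)) = (\<Sum>ms\<in>partitions (n + n'). ?f ms)"
    by (rule lft_Dl_Op[OF _ mult_Op \<beta>]) (use x y in auto)
  also have "\<dots> = (\<Sum>ms\<in>?A. ?f ms)"
    by (rule sum.mono_neutral_right) (auto simp: finite_partitions z partitions_append)
  also have "\<dots> = (\<Sum>(ms, ms')\<in>partitions n \<times> partitions n'. ?f (ms @ ms'))"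
    unfolding sum.reindex[OF inj] by (simp add: o_def case_prod_unfold)
  also have "\<dots> = (\<Sum>(ms, ms')\<in>partitions n \<times> partitions n'. gam ms x (?R ms ms'))"
    by (rule sum.cong) (auto simp only: gam_mult_append(1)[OF x(1) _ y(1) _ \<beta>] split: prod.splits)
  also have "\<dots> = (\<Sum>ms\<in>partitions n. \<Sum>ms'\<in>partitions n'. gam ms x (?R ms ms'))"
    by (rule sum.cartesian_product[symmetric])
  also have "\<dots> = (\<Sum>ms\<in>partitions n. gam ms x (rst (Suc (length ms)) (\<lambda>zs. lft sc (\<lambda>c d. \<beta> (mult (hd zs) c) (mult (pr (tl zs)) d)) (Dl y))))"
  proof (rule sum.cong[OF refl])
    fix ms assume ms: "ms \<in> partitions n"
    have "(\<Sum>ms'\<in>partitions n'. gam ms x (?R ms ms')) = gam ms x (\<lambda>zs. \<Sum>ms'\<in>partitions n'. ?R ms ms' zs)"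
      using tens_sum[OF etP_tens[OF gam_tensN[OF ms]] finite_partitions gam_mult_append(2)[OF x(1) ms y(1) _ \<beta>]] by simp
    also have "(\<lambda>zs. \<Sum>ms'\<in>partitions n'. ?R ms ms' zs) = rst (Suc (length ms)) (\<lambda>zs. lft sc (\<lambda>c d. \<beta> (mult (hd zs) c) (mult (pr (tl zs)) d)) (Dl y))"
      by (rule ext) (simp add: lft_Dl_Op[OF y(2,1) bil_mult_comp(1)[OF \<beta>]])
    finally show "(\<Sum>ms'\<in>partitions n'. gam ms x (?R ms ms')) = gam ms x (rst (Suc (length ms)) (\<lambda>zs. lft sc (\<lambda>c d. \<beta> (mult (hd zs) c) (mult (pr (tl zs)) d)) (Dl y)))" .
  qed
  also have "\<dots> = lft sc (\<lambda>a b. lft sc (\<lambda>c d. \<beta> (mult a c) (mult b d)) (Dl y)) (Dl x)"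
    by (rule lft_Dl_Op[OF x(2,1) bil_lft_mult[OF \<beta>], symmetric])
  finally show ?thesis .
qed

text \<open>Both sides are linear in each variable. If one variable is \<open>one\<close>, the claim
  follows from \<open>one\<close> being group-like and the unit of the product.\<close>

lemma lft_Dl_mult_k:
  assumes \<beta>: "bil sc (*) \<beta>"
  shows "lft sc \<beta> (Dl (mult x y)) = lft sc (\<lambda>a b. lft sc (\<lambda>c d. \<beta> (mult a c) (mult b d)) (Dl y)) (Dl x)"
    (is "?L x y = ?R x y")
proof -
  have Ly: "lin sc (*) (\<lambda>y. ?L x y)" for x by (rule lin_mult_comp lft_Dl_lin[OF \<beta>])+
  have Lx: "lin sc (*) (\<lambda>x. ?L x y)" for y by (rule lin_mult_comp lft_Dl_lin[OF \<beta>])+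
  have Rx: "lin sc (*) (\<lambda>x. ?R x y)" for y by (rule lft_Dl_lin[OF bil_lft_mult[OF \<beta>]])
  have Ry: "lin sc (*) (\<lambda>y. ?R x y)" for x
    by (rule lft_param[OF bil_lft_mult[OF \<beta>] lft_Dl_lin[OF bil_mult_comp(1)[OF \<beta>]] Dl_T2])
  have 1: "?L one y = ?R one y" for y
    by (simp add: Dl_one lft_et[OF bil_lft_mult[OF \<beta>]])
  have 2: "?L x one = ?R x one" for x
    by (simp add: Dl_one lft_et[OF bil_mult_comp(1)[OF \<beta>]])
  have 3: "?L x y = ?R x y" if "n \<ge> 1" "x \<in> Op n" for n x y
  proof (induction y rule: V_induct)
    case one show ?case by (rule 2)
  next
    case (Op m y) then show ?case using lft_Dl_mult_Op[OF that(2,1) Op(2,1) \<beta>] by simp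
  next
    case zero show ?case by (simp add: lin_0[OF Ly] lin_0[OF Ry])
  next
    case (step c y z) then show ?case by (rule lin_combo_eq[OF Ly Ry])
  qed
  show ?thesis
  proof (induction x rule: V_induct)
    case one show ?case by (rule 1)
  next
    case (Op m y) then show ?case using 3 by simp
  next
    case zero show ?case by (simp add: lin_0[OF Lx] lin_0[OF Rx])
  next
    case (step c y z) then show ?case by (rule lin_combo_eq[OF Lx Rx])
  qed
qed

end

section \<open>Coassociativity of the coproduct\<close>

definition tri :: "('k::field \<Rightarrow> 'v::ab_group_add \<Rightarrow> 'v) \<Rightarrow> ('k \<Rightarrow> 'w::ab_group_add \<Rightarrow> 'w) \<Rightarrow> ('v \<Rightarrow> 'v \<Rightarrow> 'v \<Rightarrow> 'w) \<Rightarrow> bool" where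
  "tri a w C \<longleftrightarrow> (\<forall>y z. lin a w (\<lambda>x. C x y z)) \<and> (\<forall>x z. lin a w (\<lambda>y. C x y z)) \<and> (\<forall>x y. lin a w (\<lambda>z. C x y z))"

lemma triI: "(\<And>y z. lin a w (\<lambda>x. C x y z)) \<Longrightarrow> (\<And>x z. lin a w (\<lambda>y. C x y z)) \<Longrightarrow> (\<And>x y. lin a w (\<lambda>z. C x y z)) \<Longrightarrow> tri a w C"
  by (simp add: tri_def)

lemma triD: "tri a w C \<Longrightarrow> lin a w (\<lambda>x. C x y z)" "tri a w C \<Longrightarrow> lin a w (\<lambda>y. C x y z)" "tri a w C \<Longrightarrow> lin a w (\<lambda>z. C x y z)"
  by (simp_all add: tri_def)

lemma tri_bil: "tri a w C \<Longrightarrow> bil a w (C x)" "tri a w C \<Longrightarrow> bil a w (\<lambda>x y. C x y z)" "tri a w C \<Longrightarrow> bil a w (\<lambda>x. C x y)"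
  by (auto simp: tri_def bil_def)

lemma tri_comp: "tri a w C \<Longrightarrow> lin w u h \<Longrightarrow> tri a u (\<lambda>x y z. h (C x y z))"
  using lin_comp[of a w _ u h] by (simp add: tri_def)

context cooperad
begin

text \<open>The parallel application \<open>\<gamma> \<otimes> ... \<otimes> \<gamma>\<close>,
  zipped instead of indexed so that it unfolds along both lists.\<close>

definition gams :: "nat list list \<Rightarrow> 'v list \<Rightarrow> ('v,'k) tensor" where
  "gams nss ws = tprod_list sc (map2 gam nss ws)"

lemma gams_Nil: "gams [] ws = et sc []"
  and gams_Cons: "gams (ns # nss) (w # ws) = tprod sc (gam ns w) (gams nss ws)"
  by (simp_all add: gams_def)

abbreviation is_parts :: "nat list \<Rightarrow> bool" where
  "is_parts ns \<equiv> ns \<in> partitions (sum_list ns)"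

lemma gams_tens: "\<forall>ns\<in>set nss. is_parts ns \<Longrightarrow> gams nss ws \<in> tens sc"
  unfolding gams_def
  by (rule tprod_list_tens) (auto dest!: set_zip_leftD intro: etP_tens[OF gam_tensN])

lemma mlN_gams:
  assumes "\<forall>ns\<in>set nss. is_parts ns" "mlin sc \<phi>"
  shows "mlN sc (length nss) (\<lambda>ws. gams nss ws \<phi>)"
  using assms
proof (induction nss arbitrary: \<phi>)
  case Nil
  show ?case by (simp add: mlN_0)
next
  case (Cons ns nss)
  have ns: "is_parts ns" and nss: "\<forall>ns\<in>set nss. is_parts ns" using Cons.prems by auto
  have "mlN sc (length nss) (\<lambda>ws. gams (ns # nss) (w # ws) \<phi>)" for w
    unfolding gams_Cons using etP_tens[OF gam_tensN[OF ns, of w]]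
  proof (induction rule: etP_induct)
    case (base vs)
    have "tprod sc (et sc vs) (gams nss ws) \<phi> = gams nss ws (\<lambda>ys. \<phi> (vs @ ys))" for ws
      by (rule tprod_et_left[OF gams_tens[OF nss] Cons.prems(2)])
    then show ?case using Cons.IH[OF nss mlin_append_left[OF Cons.prems(2)]] by simp
  next
    case zero
    show ?case unfolding lin_0[OF lin_tprod_left] by (simp add: mlN_def zero_fun_apply)
  next
    case (step c s t)
    have "tprod sc (tsc c s + t) u \<phi> = c * tprod sc s u \<phi> + tprod sc t u \<phi>" for u
      unfolding lin_add[OF lin_tprod_left] lin_scale[OF lin_tprod_left] by (simp add: plus_fun_apply tsc_def)
    then show ?case using step by (simp add: mlN_def algebra_simps)
  qed
  moreover have "lin sc (*) (\<lambda>w. gams (ns # nss) (w # ws) \<phi>)" for ws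
    unfolding gams_Cons by (rule lin_eval_comp[OF lin_comp[OF gam_lin[OF ns] lin_tprod_left]])
  ultimately show ?case by (simp add: mlN_Suc)
qed

text \<open>Multiplicativity applied factor by factor: \<open>nss\<close> selects a partition for
  each factor, the block heads multiply to the first tensor factor and the remainders to the second.
  The products already formed are absorbed into \<open>\<gamma>\<close>.\<close>

lemma lft_Dl_pr:
  assumes "list_all2 (\<lambda>w m. w \<in> Op m) ws ms" "\<forall>m\<in>set ms. 0 < m" "bil sc (*) \<gamma>"
  shows "lft sc \<gamma> (Dl (pr ws)) = (\<Sum>nss\<in>listset (map partitions ms). gams nss ws
    (rst (length nss + length (concat nss)) (\<lambda>ys. \<gamma> (pr (fsts (map length nss) ys)) (pr (rests (map length nss) ys)))))"
  using assms
proof (induction ws ms arbitrary: \<gamma> rule: list_all2_induct)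
  case Nil
  have "mlin sc (rst 0 (\<lambda>ys. \<gamma> (pr []) (pr [])))" unfolding mlin_rst_iff by (rule mlN_0)
  from et_mlin[OF this, of "[]"]
  have "et sc [] (rst (length ([] :: nat list list) + length (concat ([] :: nat list list)))
      (\<lambda>ys. \<gamma> (pr (fsts (map length ([] :: nat list list)) ys)) (pr (rests (map length ([] :: nat list list)) ys)))) = \<gamma> one one"
    by (simp cong: if_cong)
  moreover have "listset (map partitions []) = {[]}" by simp
  ultimately show ?case using Nil(2) by (simp only: gams_Nil Dl_one foldr.simps id_apply lft_et) (simp add: gams_Nil cong: if_cong)
next
  case (Cons w ws m ms)
  let ?\<gamma> = "\<lambda>a b c d. \<gamma> (mult a c) (mult b d)"
  let ?F = "\<lambda>nss \<gamma> ys. \<gamma> (pr (fsts (map length nss) ys)) (pr (rests (map length nss) ys))"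
  let ?N = "\<lambda>nss. length nss + length (concat nss :: nat list)"
  have b: "bil sc (*) (?\<gamma> a b)" for a b by (rule bil_mult_comp[OF Cons.prems(2)])
  have "lft sc \<gamma> (Dl (pr (w # ws))) = lft sc (\<lambda>a b. lft sc (?\<gamma> a b) (Dl (pr ws))) (Dl w)"
    using lft_Dl_mult_k[OF Cons.prems(2)] by simp
  also have "\<dots> = (\<Sum>ns\<in>partitions m. gam ns w (rst (Suc (length ns)) (\<lambda>zs. lft sc (?\<gamma> (hd zs) (pr (tl zs))) (Dl (pr ws)))))"
    by (rule lft_Dl_Op) (use Cons bil_lft_mult in auto)
  also have "\<dots> = (\<Sum>ns\<in>partitions m. \<Sum>nss\<in>listset (map partitions ms). gams (ns # nss) (w # ws) (rst (?N (ns # nss)) (?F (ns # nss) \<gamma>)))"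
  proof (rule sum.cong[OF refl])
    fix ns assume ns: "ns \<in> partitions m"
    let ?k = "Suc (length ns)"
    let ?G = "\<lambda>nss xs. gams nss ws (rst (?N nss) (\<lambda>ys. ?F (ns # nss) \<gamma> (xs @ ys)))"
    have G: "?G nss xs = gams nss ws (rst (?N nss) (?F nss (?\<gamma> (hd xs) (pr (tl xs)))))" if "length xs = ?k" for nss xs
      using that by (intro arg_cong[of _ _ "gams nss ws"] ext if_cong refl)
        (auto simp: length_Suc_conv pr_append simp del: foldr_append)
    have t: "gams nss ws \<in> tens sc" if "nss \<in> listset (map partitions ms)" for nss
    proof (rule gams_tens, rule ballI)
      fix ns assume "ns \<in> set nss"
      then obtain i where "i < length nss" "ns = nss ! i" by (metis in_set_conv_nth)
      then show "is_parts ns" using that by (auto simp: listset_iff list_all2_conv_all_nth) (metis partitions_sum)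
    qed
    have ml: "mlN sc (?k + ?N nss) (?F (ns # nss) \<gamma>)" for nss
      using mlN_fsts_rests[OF Cons.prems(2), of "map length (ns # nss)"] by (simp add: length_concat add_ac del: fsts.simps rests.simps)
    note tr = tprod_rst[OF gam_tensN[OF ns, of w] t ml]
    have "gam ns w (rst ?k (\<lambda>zs. lft sc (?\<gamma> (hd zs) (pr (tl zs))) (Dl (pr ws))))
      = gam ns w (\<lambda>zs. \<Sum>nss\<in>listset (map partitions ms). rst ?k (?G nss) zs)"
      by (rule arg_cong[of _ _ "gam ns w"], rule ext) (use Cons.IH[OF _ b] Cons.prems(1) in \<open>simp add: G\<close>)
    also have "\<dots> = (\<Sum>nss\<in>listset (map partitions ms). gam ns w (rst ?k (?G nss)))"
      by (rule tens_sum[THEN conjunct1, OF etP_tens[OF gam_tensN[OF ns]]])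
        (auto intro!: finite_listset finite_partitions tr(2))
    also have "\<dots> = (\<Sum>nss\<in>listset (map partitions ms). gams (ns # nss) (w # ws) (rst (?N (ns # nss)) (?F (ns # nss) \<gamma>)))"
    proof (rule sum.cong[OF refl])
      fix nss assume "nss \<in> listset (map partitions ms)"
      have e: "?k + ?N nss = ?N (ns # nss)" by simp
      show "gam ns w (rst ?k (?G nss)) = gams (ns # nss) (w # ws) (rst (?N (ns # nss)) (?F (ns # nss) \<gamma>))"
        unfolding gams_Cons e[symmetric] by (rule tr(1)[symmetric]) fact
    qed
    finally show "gam ns w (rst ?k (\<lambda>zs. lft sc (?\<gamma> (hd zs) (pr (tl zs))) (Dl (pr ws))))
      = (\<Sum>nss\<in>listset (map partitions ms). gams (ns # nss) (w # ws) (rst (?N (ns # nss)) (?F (ns # nss) \<gamma>)))" .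
  qed
  also have "\<dots> = (\<Sum>nss\<in>listset (map partitions (m # ms)). gams nss (w # ws) (rst (?N nss) (?F nss \<gamma>)))"
    by (simp only: list.map(2) sum_listset_Cons)
  finally show ?case .
qed

text \<open>Both sides of the coassociativity axiom are evaluated at one form built from
  \<open>C\<close>. The two \<open>mlin\<close> claims allow the evaluations to be exchanged with
  finite sums.\<close>

lemma gam_coassoc:
  assumes ms: "ms \<in> partitions n" and nss: "nss \<in> listset (map partitions ms)" and x: "x \<in> Op n" and C: "tri sc (*) C"
  defines "ls \<equiv> map length nss" and "ns \<equiv> concat nss"
  shows "gam ms x (rst (Suc (length ms)) (\<lambda>zs. gams nss (tl zs) (rst (length nss + length ns)
           (\<lambda>ys. C (hd zs) (pr (fsts ls ys)) (pr (rests ls ys))))))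
       = gam ns x (rst (Suc (length ns)) (\<lambda>zs. gam ls (hd zs) (rst (Suc (length ls)) (\<lambda>cs. C (hd cs) (pr (tl cs)) (pr (tl zs))))))"
    and "mlin sc (rst (Suc (length ms)) (\<lambda>zs. gams nss (tl zs) (rst (length nss + length ns)
           (\<lambda>ys. C (hd zs) (pr (fsts ls ys)) (pr (rests ls ys))))))"
    and "mlin sc (rst (Suc (length ns)) (\<lambda>zs. gam ls (hd zs) (rst (Suc (length ls)) (\<lambda>cs. C (hd cs) (pr (tl cs)) (pr (tl zs))))))"
proof -
  let ?k = "length ms" and ?L = "length ns"
  have la: "list_all2 (\<in>) nss (map partitions ms)" using nss by (simp add: listset_iff)
  have lk: "length nss = ?k" "length ls = ?k" using la by (auto simp: ls_def dest: list_all2_lengthD)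
  have parts: "\<forall>i<length ms. nss ! i \<in> partitions (ms ! i)" using la by (auto simp: list_all2_conv_all_nth)
  have isp: "\<forall>ns\<in>set nss. is_parts ns" using parts lk partitions_sum by (metis in_set_conv_nth)
  have sl: "sum_list ls = ?L" by (simp add: ls_def ns_def length_concat)
  have ls: "ls \<in> partitions ?L"
  proof -
    have "(ms, nss) \<in> (SIGMA ms:partitions n. listset (map partitions ms))" using ms nss by simp
    from bij_betw_apply[OF refinements_bij this] show ?thesis by (simp add: ls_def ns_def)
  qed
  have ns: "ns \<in> partitions n"
  proof -
    have "(ms, nss) \<in> (SIGMA ms:partitions n. listset (map partitions ms))" using ms nss by simp
    from bij_betw_apply[OF refinements_bij this] show ?thesis by (simp add: ns_def)
  qed
  \<comment> \<open>The form as read after the reordering, where heads and remainders of the blocks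
    are interleaved.\<close>
  let ?\<psi> = "rst (Suc (?k + ?L)) (\<lambda>ys. C (hd ys) (pr (fsts ls (tl ys))) (pr (rests ls (tl ys))))"
  have ml\<psi>: "mlin sc ?\<psi>" unfolding mlin_rst_iff
  proof (rule mlN_Suc)
    show "mlN sc (?k + ?L) (\<lambda>ys. C (hd (x # ys)) (pr (fsts ls (tl (x # ys)))) (pr (rests ls (tl (x # ys)))))" for x
      using mlN_fsts_rests[OF tri_bil(1)[OF C], of ls x] lk sl by simp
  qed (simp add: triD[OF C])
  let ?G1 = "\<lambda>zs. tprod sc (et sc [hd zs]) (tprod_list sc (map (\<lambda>i. gam (nss ! i) (zs ! Suc i)) [0..<length ms]))"
  let ?U = "tapp sc (Suc ?L) (\<lambda>zs. tprod sc (gam ls (hd zs)) (et sc (tl zs))) (gam ns x)"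
  have co: "tapp sc (Suc ?k) ?G1 (gam ms x) = tapp sc (Suc ?k + ?L) (\<lambda>zs. et sc (pi_coass ls zs)) ?U"
    using ax_coassoc[rule_format, of ms n nss x] ms parts lk x unfolding ls_def ns_def by simp
  have gm: "tprod_list sc (map (\<lambda>i. gam (nss ! i) (zs ! Suc i)) [0..<length ms]) = gams nss (tl zs)" if "length zs = Suc ?k" for zs
  proof -
    have "map (\<lambda>i. gam (nss ! i) (zs ! Suc i)) [0..<length ms] = map2 gam nss (tl zs)"
      using that lk by (intro nth_equalityI) (auto simp: nth_tl)
    then show ?thesis by (simp add: gams_def)
  qed
  have G1: "?G1 zs ?\<psi> = gams nss (tl zs) (rst (length nss + length ns) (\<lambda>ys. C (hd zs) (pr (fsts ls ys)) (pr (rests ls ys))))"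
    if "length zs = Suc ?k" for zs
    unfolding gm[OF that] tprod_et_left[OF gams_tens[OF isp] ml\<psi>]
    using lk by (intro arg_cong[of _ _ "gams nss (tl zs)"]) auto
  have r1: "rst (Suc ?k) (\<lambda>zs. ?G1 zs ?\<psi>) = rst (Suc ?k) (\<lambda>zs. gams nss (tl zs) (rst (length nss + length ns) (\<lambda>ys. C (hd zs) (pr (fsts ls ys)) (pr (rests ls ys)))))"
    using G1 by (intro ext) simp
  have lhs: "tapp sc (Suc ?k) ?G1 (gam ms x) ?\<psi> = gam ms x (rst (Suc ?k) (\<lambda>zs. gams nss (tl zs) (rst (length nss + length ns) (\<lambda>ys. C (hd zs) (pr (fsts ls ys)) (pr (rests ls ys))))))"
    unfolding r1[symmetric] by (simp only: tapp_def ml\<psi> if_True)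
  \<comment> \<open>The same form before the reordering: behind the head come the \<open>?k\<close>
    factors produced by \<open>gam ls\<close>, then the \<open>?L\<close> remaining factors of
    \<open>gam ns\<close>.\<close>
  let ?\<Theta> = "\<lambda>zs. C (hd zs) (pr (take ?k (tl zs))) (pr (drop (Suc ?k) zs))"
  have \<Theta>: "?\<psi> (pi_coass ls zs) = ?\<Theta> zs" if l: "length zs = Suc ?k + ?L" for zs
  proof -
    obtain z zs' where zs: "zs = z # zs'" "length zs' = ?k + ?L" using l by (cases zs) auto
    have zz: "zs = z # take ?k zs' @ drop ?k zs'" using zs by simp
    have l1: "length (take ?k zs') = length ls" "length (drop ?k zs') = sum_list ls" using zs lk sl by auto
    note p = pi_coass_split[OF l1, of z, folded zz]
    show ?thesis using p zs lk sl by simp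
  qed
  have ml\<Theta>: "mlin sc (rst (Suc ?k + ?L) ?\<Theta>)"
    unfolding mlin_rst_iff
  proof (rule mlN_append)
    fix xs :: "'v list" assume l: "length xs = Suc ?k"
    have "(\<lambda>ys. ?\<Theta> (xs @ ys)) = (\<lambda>ys. C (hd xs) (pr (tl xs)) (pr ys))" using l by (auto simp: length_Suc_conv)
    then show "mlN sc ?L (\<lambda>ys. ?\<Theta> (xs @ ys))" using mlN_pr[OF triD(3)[OF C]] by simp
  next
    fix ys :: "'v list"
    have "?\<Theta> (xs @ ys) = C (hd xs) (pr (tl xs)) (pr ys)" if "length xs = Suc ?k" for xs
      using that by (auto simp: length_Suc_conv)
    moreover have "mlN sc (Suc ?k) (\<lambda>xs. C (hd xs) (pr (tl xs)) (pr ys))" by (rule mlN_hd_pr) (rule tri_bil(2)[OF C])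
    ultimately show "mlN sc (Suc ?k) (\<lambda>xs. ?\<Theta> (xs @ ys))" by (rule mlN_cong[THEN iffD2])
  qed
  have "tapp sc (Suc ?k + ?L) (\<lambda>zs. et sc (pi_coass ls zs)) ?U ?\<psi> = ?U (rst (Suc ?k + ?L) (\<lambda>zs. ?\<psi> (pi_coass ls zs)))"
    by (simp only: tapp_def ml\<psi> if_True et_mlin)
  also have "rst (Suc ?k + ?L) (\<lambda>zs. ?\<psi> (pi_coass ls zs)) = rst (Suc ?k + ?L) ?\<Theta>"
    using \<Theta> by (intro ext) simp
  also have "?U (rst (Suc ?k + ?L) ?\<Theta>) = gam ns x (rst (Suc ?L) (\<lambda>zs. tprod sc (gam ls (hd zs)) (et sc (tl zs)) (rst (Suc ?k + ?L) ?\<Theta>)))"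
    by (simp only: tapp_def ml\<Theta> if_True)
  also have "(rst (Suc ?L) (\<lambda>zs. tprod sc (gam ls (hd zs)) (et sc (tl zs)) (rst (Suc ?k + ?L) ?\<Theta>)))
    = rst (Suc ?L) (\<lambda>zs. gam ls (hd zs) (rst (Suc (length ls)) (\<lambda>cs. C (hd cs) (pr (tl cs)) (pr (tl zs)))))"
  proof (rule ext)
    fix zs :: "'v list"
    show "rst (Suc ?L) (\<lambda>zs. tprod sc (gam ls (hd zs)) (et sc (tl zs)) (rst (Suc ?k + ?L) ?\<Theta>)) zs
      = rst (Suc ?L) (\<lambda>zs. gam ls (hd zs) (rst (Suc (length ls)) (\<lambda>cs. C (hd cs) (pr (tl cs)) (pr (tl zs))))) zs"
    proof (cases "length zs = Suc ?L")
      case True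
      have "tprod sc (gam ls (hd zs)) (et sc (tl zs)) (rst (Suc ?k + ?L) ?\<Theta>) = gam ls (hd zs) (\<lambda>xs. et sc (tl zs) (\<lambda>ys. rst (Suc ?k + ?L) ?\<Theta> (xs @ ys)))"
        by (simp only: tprod_def ml\<Theta> if_True)
      also have "\<dots> = gam ls (hd zs) (\<lambda>xs. rst (Suc ?k + ?L) ?\<Theta> (xs @ tl zs))"
        by (simp only: et_mlin[OF mlin_append_left[OF ml\<Theta>]])
      also have "\<dots> = gam ls (hd zs) (rst (Suc (length ls)) (\<lambda>cs. C (hd cs) (pr (tl cs)) (pr (tl zs))))"
        using True lk by (intro arg_cong[of _ _ "gam ls (hd zs)"] ext) (auto simp: length_Suc_conv)
      finally show ?thesis using True by simp
    qed simp
  qed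
  finally have rhs: "tapp sc (Suc ?k + ?L) (\<lambda>zs. et sc (pi_coass ls zs)) ?U ?\<psi>
    = gam ns x (rst (Suc ?L) (\<lambda>zs. gam ls (hd zs) (rst (Suc (length ls)) (\<lambda>cs. C (hd cs) (pr (tl cs)) (pr (tl zs))))))" .
  show "gam ms x (rst (Suc (length ms)) (\<lambda>zs. gams nss (tl zs) (rst (length nss + length ns)
           (\<lambda>ys. C (hd zs) (pr (fsts ls ys)) (pr (rests ls ys))))))
       = gam ns x (rst (Suc (length ns)) (\<lambda>zs. gam ls (hd zs) (rst (Suc (length ls)) (\<lambda>cs. C (hd cs) (pr (tl cs)) (pr (tl zs))))))"
    unfolding lhs[symmetric] rhs[symmetric] co ..
  show "mlin sc (rst (Suc (length ms)) (\<lambda>zs. gams nss (tl zs) (rst (length nss + length ns)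
           (\<lambda>ys. C (hd zs) (pr (fsts ls ys)) (pr (rests ls ys))))))"
    unfolding mlin_rst_iff
  proof (rule mlN_Suc)
    fix z
    have "mlin sc (rst (length nss + length ns) (\<lambda>ys. C z (pr (fsts ls ys)) (pr (rests ls ys))))"
      unfolding mlin_rst_iff using mlN_fsts_rests[OF tri_bil(1)[OF C], of ls z] lk sl by simp
    from mlN_gams[OF isp this] show "mlN sc (length ms) (\<lambda>zs. gams nss (tl (z # zs)) (rst (length nss + length ns)
           (\<lambda>ys. C (hd (z # zs)) (pr (fsts ls ys)) (pr (rests ls ys)))))" using lk by (simp cong: if_cong)
  next
    fix zs :: "'v list"
    have "mlin sc (rst (length nss + length ns) (\<lambda>ys. C z (pr (fsts ls ys)) (pr (rests ls ys))))" for z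
      unfolding mlin_rst_iff using mlN_fsts_rests[OF tri_bil(1)[OF C], of ls z] lk sl by simp
    note tc = tens_combo[OF gams_tens[OF isp] this this]
    have e: "(rst (length nss + length ns) (\<lambda>ys. C (sc c z + z') (pr (fsts ls ys)) (pr (rests ls ys))))
      = (\<lambda>ys. c * rst (length nss + length ns) (\<lambda>ys. C z (pr (fsts ls ys)) (pr (rests ls ys))) ys
         + rst (length nss + length ns) (\<lambda>ys. C z' (pr (fsts ls ys)) (pr (rests ls ys))) ys)" for c z z'
      by (rule ext) (simp add: lin_add[OF triD(1)[OF C]] lin_scale[OF triD(1)[OF C]])
    show "lin sc (*) (\<lambda>z. gams nss (tl (z # zs)) (rst (length nss + length ns)
           (\<lambda>ys. C (hd (z # zs)) (pr (fsts ls ys)) (pr (rests ls ys)))))"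
      by (rule linI[OF vs vector_space_times]) (simp only: list.sel e tc)
  qed
  show "mlin sc (rst (Suc ?L) (\<lambda>zs. gam ls (hd zs) (rst (Suc (length ls)) (\<lambda>cs. C (hd cs) (pr (tl cs)) (pr (tl zs))))))"
    unfolding mlin_rst_iff
  proof (rule mlN_Suc)
    fix z
    have "mlin sc (rst (Suc (length ls)) (\<lambda>cs. C (hd cs) (pr (tl cs)) b))" for b
      unfolding mlin_rst_iff by (rule mlN_hd_pr) (rule tri_bil(2)[OF C])
    note tc = tens_combo[OF etP_tens[OF gam_tensN[OF ls]] this this]
    have e: "rst (Suc (length ls)) (\<lambda>cs. C (hd cs) (pr (tl cs)) (sc c b + b'))
      = (\<lambda>cs. c * rst (Suc (length ls)) (\<lambda>cs. C (hd cs) (pr (tl cs)) b) cs + rst (Suc (length ls)) (\<lambda>cs. C (hd cs) (pr (tl cs)) b') cs)" for c b b'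
      by (rule ext) (simp add: lin_add[OF triD(3)[OF C]] lin_scale[OF triD(3)[OF C]])
    have "lin sc (*) (\<lambda>b. gam ls z (rst (Suc (length ls)) (\<lambda>cs. C (hd cs) (pr (tl cs)) b)))"
      by (rule linI[OF vs vector_space_times]) (simp only: e tc)
    from mlN_pr[OF this] show "mlN sc ?L (\<lambda>zs. gam ls (hd (z # zs)) (rst (Suc (length ls)) (\<lambda>cs. C (hd cs) (pr (tl cs)) (pr (tl (z # zs))))))"
      by (simp cong: if_cong)
  qed (use lin_eval_comp[OF gam_lin[OF ls]] in \<open>simp cong: if_cong\<close>)
qed

lemma bil_lft_left: "tri sc w C \<Longrightarrow> bil sc w (\<lambda>a b. lft sc (\<lambda>c d. C c d b) (Dl a))"
  by (intro bilI lft_Dl_lin lft_param[OF _ _ Dl_T2]) (auto intro: tri_bil triD)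

lemma bil_lft_right: "tri sc w C \<Longrightarrow> bil sc w (\<lambda>a b. lft sc (\<lambda>c d. C a c d) (Dl b))"
  by (intro bilI lft_Dl_lin lft_param[OF _ _ Dl_T2]) (auto intro: tri_bil triD)

text \<open>Expanding both coproducts gives a sum over pairs \<open>(ns, ls)\<close> on the left and
  over pairs \<open>(ms, nss)\<close> on the right; \<open>gam_coassoc\<close> equates the terms
  matched by \<open>refinements_bij\<close>.\<close>

lemma Dl_coassoc_Op:
  assumes x: "x \<in> Op n" "n \<ge> 1" and C: "tri sc (*) C"
  shows "lft sc (\<lambda>a b. lft sc (\<lambda>c d. C c d b) (Dl a)) (Dl x) = lft sc (\<lambda>a b. lft sc (\<lambda>c d. C a c d) (Dl b)) (Dl x)"
proof -
  let ?A = "\<lambda>ns ls. rst (Suc (length ns)) (\<lambda>zs. gam ls (hd zs) (rst (Suc (length ls)) (\<lambda>cs. C (hd cs) (pr (tl cs)) (pr (tl zs)))))"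
  let ?B = "\<lambda>ms nss. rst (Suc (length ms)) (\<lambda>zs. gams nss (tl zs) (rst (length nss + length (concat nss))
           (\<lambda>ys. C (hd zs) (pr (fsts (map length nss) ys)) (pr (rests (map length nss) ys)))))"
  let ?h = "\<lambda>(ms, nss). (concat nss, map length nss)"
  have mlA: "mlin sc (?A ns ls)" if "ns \<in> partitions n" "ls \<in> partitions (length ns)" for ns ls
  proof -
    have "(ns, ls) \<in> ?h ` (SIGMA ms:partitions n. listset (map partitions ms))"
      unfolding bij_betw_imp_surj_on[OF refinements_bij] using that by simp
    then obtain ms nss where "ms \<in> partitions n" "nss \<in> listset (map partitions ms)" "ns = concat nss" "ls = map length nss"
      by auto
    then show ?thesis using gam_coassoc(3)[OF _ _ x(1) C, of ms nss] by (simp only:)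
  qed
  have "lft sc (\<lambda>a b. lft sc (\<lambda>c d. C c d b) (Dl a)) (Dl x)
    = (\<Sum>ns\<in>partitions n. gam ns x (rst (Suc (length ns)) (\<lambda>zs. lft sc (\<lambda>c d. C c d (pr (tl zs))) (Dl (hd zs)))))"
    by (rule lft_Dl_Op[OF x(2,1) bil_lft_left[OF C]])
  also have "\<dots> = (\<Sum>ns\<in>partitions n. \<Sum>ls\<in>partitions (length ns). gam ns x (?A ns ls))"
  proof (rule sum.cong[OF refl])
    fix ns assume ns: "ns \<in> partitions n"
    have "gam ns x (rst (Suc (length ns)) (\<lambda>zs. lft sc (\<lambda>c d. C c d (pr (tl zs))) (Dl (hd zs))))
      = gam ns x (\<lambda>zs. \<Sum>ls\<in>partitions (length ns). ?A ns ls zs)"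
    \<comment> \<open>\<open>Dl (hd zs)\<close> can be expanded over partitions of
      \<open>length ns\<close> only when \<open>hd zs\<close> has that degree, so the two forms are
      compared on graded lists alone.\<close>
    proof (rule etP_cong[OF gam_graded[OF ns x(1)]])
      show "mlin sc (rst (Suc (length ns)) (\<lambda>zs. lft sc (\<lambda>c d. C c d (pr (tl zs))) (Dl (hd zs))))"
        unfolding mlin_rst_iff by (rule mlN_hd_pr) (rule bil_lft_left[OF C])
      show "mlin sc (\<lambda>zs. \<Sum>ls\<in>partitions (length ns). ?A ns ls zs)"
        by (rule tens_sum[THEN conjunct2, OF et_tens finite_partitions mlA[OF ns]])
      fix zs assume g: "graded ns zs"
      show "rst (Suc (length ns)) (\<lambda>zs. lft sc (\<lambda>c d. C c d (pr (tl zs))) (Dl (hd zs))) zs = (\<Sum>ls\<in>partitions (length ns). ?A ns ls zs)"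
        using gradedD(1)[OF g] partitions_length[OF ns]
        by (simp add: lft_Dl_Op[OF _ gradedD(2)[OF g] tri_bil(2)[OF C, of "pr (tl zs)"]] Suc_le_eq cong: if_cong)
    qed
    also have "\<dots> = (\<Sum>ls\<in>partitions (length ns). gam ns x (?A ns ls))"
      by (rule tens_sum[THEN conjunct1, OF etP_tens[OF gam_tensN[OF ns]] finite_partitions mlA[OF ns]])
    finally show "gam ns x (rst (Suc (length ns)) (\<lambda>zs. lft sc (\<lambda>c d. C c d (pr (tl zs))) (Dl (hd zs))))
      = (\<Sum>ls\<in>partitions (length ns). gam ns x (?A ns ls))" .
  qed
  also have "\<dots> = (\<Sum>(ns, ls)\<in>(SIGMA ns:partitions n. partitions (length ns)). gam ns x (?A ns ls))"
    by (rule sum.Sigma) (auto simp: finite_partitions)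
  also have "\<dots> = (\<Sum>p\<in>(SIGMA ms:partitions n. listset (map partitions ms)). case ?h p of (ns, ls) \<Rightarrow> gam ns x (?A ns ls))"
    by (rule sum.reindex_bij_betw[OF refinements_bij, symmetric])
  also have "\<dots> = (\<Sum>(ms, nss)\<in>(SIGMA ms:partitions n. listset (map partitions ms)). gam ms x (?B ms nss))"
  proof (rule sum.cong[OF refl])
    fix p assume "p \<in> (SIGMA ms:partitions n. listset (map partitions ms))"
    then obtain ms nss where p: "p = (ms, nss)" "ms \<in> partitions n" "nss \<in> listset (map partitions ms)" by auto
    show "(case ?h p of (ns, ls) \<Rightarrow> gam ns x (?A ns ls)) = (case p of (ms, nss) \<Rightarrow> gam ms x (?B ms nss))"
      unfolding p(1) prod.case by (rule gam_coassoc(1)[OF p(2,3) x(1) C, symmetric])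
  qed
  also have "\<dots> = (\<Sum>ms\<in>partitions n. \<Sum>nss\<in>listset (map partitions ms). gam ms x (?B ms nss))"
    by (rule sum.Sigma[symmetric]) (auto simp: finite_partitions intro!: finite_listset)
  also have "\<dots> = (\<Sum>ms\<in>partitions n. gam ms x (rst (Suc (length ms)) (\<lambda>zs. lft sc (\<lambda>c d. C (hd zs) c d) (Dl (pr (tl zs))))))"
  proof (rule sum.cong[OF refl])
    fix ms assume ms: "ms \<in> partitions n"
    have fin: "finite (listset (map partitions ms))" by (auto intro!: finite_listset finite_partitions)
    have "(\<Sum>nss\<in>listset (map partitions ms). gam ms x (?B ms nss)) = gam ms x (\<lambda>zs. \<Sum>nss\<in>listset (map partitions ms). ?B ms nss zs)"
      by (rule tens_sum[THEN conjunct1, OF etP_tens[OF gam_tensN[OF ms]] fin gam_coassoc(2)[OF ms _ x(1) C], symmetric])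
    also have "\<dots> = gam ms x (rst (Suc (length ms)) (\<lambda>zs. lft sc (\<lambda>c d. C (hd zs) c d) (Dl (pr (tl zs)))))"
    \<comment> \<open>Likewise the expansion of \<open>Dl (pr (tl zs))\<close> needs the degrees of
      the factors to be given by \<open>ms\<close>.\<close>
    proof (rule etP_cong[OF gam_graded[OF ms x(1)]])
      show "mlin sc (rst (Suc (length ms)) (\<lambda>zs. lft sc (\<lambda>c d. C (hd zs) c d) (Dl (pr (tl zs)))))"
        unfolding mlin_rst_iff by (rule mlN_hd_pr) (rule bil_lft_right[OF C])
      show "mlin sc (\<lambda>zs. \<Sum>nss\<in>listset (map partitions ms). ?B ms nss zs)"
        by (rule tens_sum[THEN conjunct2, OF et_tens fin gam_coassoc(2)[OF ms _ x(1) C]])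
      fix zs assume g: "graded ms zs"
      have "\<forall>m\<in>set ms. 0 < m" using ms by (auto simp: partitions_def)
      from lft_Dl_pr[OF gradedD(3)[OF g] this tri_bil(1)[OF C]] gradedD(1)[OF g]
      show "(\<Sum>nss\<in>listset (map partitions ms). ?B ms nss zs) = rst (Suc (length ms)) (\<lambda>zs. lft sc (\<lambda>c d. C (hd zs) c d) (Dl (pr (tl zs)))) zs"
        by simp
    qed
    finally show "(\<Sum>nss\<in>listset (map partitions ms). gam ms x (?B ms nss)) = gam ms x (rst (Suc (length ms)) (\<lambda>zs. lft sc (\<lambda>c d. C (hd zs) c d) (Dl (pr (tl zs)))))" .
  qed
  also have "\<dots> = lft sc (\<lambda>a b. lft sc (\<lambda>c d. C a c d) (Dl b)) (Dl x)"
    by (rule lft_Dl_Op[OF x(2,1) bil_lft_right[OF C], symmetric])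
  finally show ?thesis .
qed

lemma Dl_coassoc_k:
  assumes C: "tri sc (*) C"
  shows "lft sc (\<lambda>a b. lft sc (\<lambda>c d. C c d b) (Dl a)) (Dl x) = lft sc (\<lambda>a b. lft sc (\<lambda>c d. C a c d) (Dl b)) (Dl x)"
    (is "?L x = ?R x")
proof (induction x rule: V_induct)
  case one
  show ?case by (simp add: Dl_one lft_et[OF bil_lft_left[OF C]] lft_et[OF bil_lft_right[OF C]] lft_et[OF tri_bil(1)[OF C]] lft_et[OF tri_bil(2)[OF C]])
next
  case (Op n x)
  then show ?case by (intro Dl_coassoc_Op C)
next
  case zero
  show ?case by (simp only: lin_0[OF lft_Dl_lin[OF bil_lft_left[OF C]]] lin_0[OF lft_Dl_lin[OF bil_lft_right[OF C]]])
next
  case (step c x y)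
  then show ?case by (rule lin_combo_eq[OF lft_Dl_lin[OF bil_lft_left[OF C]] lft_Dl_lin[OF bil_lft_right[OF C]]])
qed

lemma Dl_coassoc:
  assumes C: "tri sc w C"
  shows "lft sc (\<lambda>a b. lft sc (\<lambda>c d. C c d b) (Dl a)) (Dl x) = lft sc (\<lambda>a b. lft sc (\<lambda>c d. C a c d) (Dl b)) (Dl x)"
proof (rule separation)
  show "vector_space w" using triD(1)[OF C] lin_vs2 by blast
  fix f assume f: "lin w (*) f"
  show "f (lft sc (\<lambda>a b. lft sc (\<lambda>c d. C c d b) (Dl a)) (Dl x)) = f (lft sc (\<lambda>a b. lft sc (\<lambda>c d. C a c d) (Dl b)) (Dl x))"
    unfolding lft_comp[OF bil_lft_left[OF C] f Dl_T2] lft_comp[OF bil_lft_right[OF C] f Dl_T2]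
      lft_comp[OF tri_bil(1)[OF C] f Dl_T2] lft_comp[OF tri_bil(2)[OF C] f Dl_T2]
    by (rule Dl_coassoc_k[OF tri_comp[OF C f]])
qed

lemma lft_Dl_mult:
  assumes \<beta>: "bil sc w \<beta>"
  shows "lft sc \<beta> (Dl (mult x y)) = lft sc (\<lambda>a b. lft sc (\<lambda>c d. \<beta> (mult a c) (mult b d)) (Dl y)) (Dl x)"
proof (rule separation)
  show "vector_space w" using bil_vs[OF \<beta>] by blast
  fix f assume f: "lin w (*) f"
  show "f (lft sc \<beta> (Dl (mult x y))) = f (lft sc (\<lambda>a b. lft sc (\<lambda>c d. \<beta> (mult a c) (mult b d)) (Dl y)) (Dl x))"
    unfolding lft_comp[OF \<beta> f Dl_T2] lft_comp[OF bil_lft_mult[OF \<beta>] f Dl_T2] lft_comp[OF bil_mult_comp(1)[OF \<beta>] f Dl_T2]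
    by (rule lft_Dl_mult_k[OF bil_comp[OF \<beta> f]])
qed

text \<open>Keeps the degrees of both tensor factors in view; the induction on the degree in
  \<open>Op_Fil\<close> depends on them.\<close>

lemma Dl_pr_graded:
  assumes "n \<ge> 1" "x \<in> Op n"
  shows "Dl x \<in> tspan sc {et sc [a, b] | a b. \<exists>ns ws. ns \<in> partitions n \<and> a \<in> Op (length ns) \<and> list_all2 (\<lambda>w n. w \<in> Op n) ws ns \<and> b = pr ws}"
  unfolding Dl_Op[OF assms]
proof (rule tspan_sum)
  fix ns assume ns: "ns \<in> partitions n"
  have ml: "mlN sc (Suc (length ns)) (\<lambda>xs. et sc [hd xs, pr (tl xs)] \<phi>)" if "mlin sc \<phi>" for \<phi>
    using mlN_hd_pr[OF mlin_bil[OF that vs]] that by simp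
  from gam_graded[OF ns assms(2)]
  show "tapp sc (Suc (length ns)) (\<lambda>zs. et sc [hd zs, pr (tl zs)]) (gam ns x) \<in> tspan sc
       {et sc [a, b] | a b. \<exists>ns ws. ns \<in> partitions n \<and> a \<in> Op (length ns) \<and> list_all2 (\<lambda>w n. w \<in> Op n) ws ns \<and> b = pr ws}"
  proof (rule etP_lin_image[OF _ lin_tapp])
    fix zs assume g: "graded ns zs"
    show "tapp sc (Suc (length ns)) (\<lambda>zs. et sc [hd zs, pr (tl zs)]) (et sc zs) \<in> tspan sc
       {et sc [a, b] | a b. \<exists>ns ws. ns \<in> partitions n \<and> a \<in> Op (length ns) \<and> list_all2 (\<lambda>w n. w \<in> Op n) ws ns \<and> b = pr ws}"
    proof (rule tspan_base)
      have "tapp sc (Suc (length ns)) (\<lambda>zs. et sc [hd zs, pr (tl zs)]) (et sc zs) = et sc [hd zs, pr (tl zs)]"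
        by (rule tapp_et[OF ml gradedD(1)[OF g] et_tens])
      then show "tapp sc (Suc (length ns)) (\<lambda>zs. et sc [hd zs, pr (tl zs)]) (et sc zs) \<in>
         {et sc [a, b] | a b. \<exists>ns ws. ns \<in> partitions n \<and> a \<in> Op (length ns) \<and> list_all2 (\<lambda>w n. w \<in> Op n) ws ns \<and> b = pr ws}"
        using gradedD[OF g] ns by blast
    qed
  qed
qed

end

section \<open>The coideal and the filtration of the quotient\<close>

lemma mlin_tens_left:
  fixes \<phi> :: "'v::ab_group_add list \<Rightarrow> 'k::field"
  assumes t: "t \<in> tens sc" and "mlin sc \<phi>"
  shows "mlin sc (\<lambda>ys. t (\<lambda>xs. \<phi> (xs @ ys)))"
  unfolding mlin_def
proof (intro allI)
  fix xs ys :: "'v list" and c u v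
  have "(\<lambda>zs. \<phi> (zs @ xs @ (sc c u + v) # ys)) = (\<lambda>zs. c * \<phi> (zs @ xs @ u # ys) + \<phi> (zs @ xs @ v # ys))"
  proof
    show "\<phi> (zs @ xs @ (sc c u + v) # ys) = c * \<phi> (zs @ xs @ u # ys) + \<phi> (zs @ xs @ v # ys)" for zs
      using assms(2)[unfolded mlin_def, rule_format, of "zs @ xs" c u v ys] by simp
  qed
  then show "t (\<lambda>zs. \<phi> (zs @ xs @ (sc c u + v) # ys)) =
       c * t (\<lambda>zs. \<phi> (zs @ xs @ u # ys)) + t (\<lambda>zs. \<phi> (zs @ xs @ v # ys))"
    by (simp only: tens_combo[OF t mlin_append_right[OF assms(2)] mlin_append_right[OF assms(2)]])
qed

lemma etP_lin_eq:
  assumes "t \<in> etP sc P" "lin tsc w h" "lin tsc w h'" "\<And>vs. P vs \<Longrightarrow> h (et sc vs) = h' (et sc vs)"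
  shows "h t = h' t"
  using assms(1)
proof (induction rule: etP_induct)
  case zero
  show ?case by (simp only: lin_0[OF assms(2)] lin_0[OF assms(3)])
next
  case (step c s t)
  then show ?case
    by (simp only: lin_add[OF assms(2)] lin_add[OF assms(3)] lin_scale[OF assms(2)] lin_scale[OF assms(3)])
qed (rule assms(4))

text \<open>The subspace \<open>U \<otimes> V + V \<otimes> W\<close> of
  \<open>V \<otimes> V\<close> (for subspaces \<open>U\<close> and \<open>W\<close>).\<close>

abbreviation etN :: "('k::field \<Rightarrow> 'v::ab_group_add \<Rightarrow> 'v) \<Rightarrow> 'v set \<Rightarrow> 'v set \<Rightarrow> ('v,'k) tensor set" where
  "etN sc U W \<equiv> tspan sc {et sc [a, b] | a b. a \<in> U \<or> b \<in> W}"

lemma etN_mono: "U \<subseteq> U' \<Longrightarrow> W \<subseteq> W' \<Longrightarrow> t \<in> etN sc U W \<Longrightarrow> t \<in> etN sc U' W'"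
  by (rule subsetD[OF tspan_mono]) auto

lemma et_etN: "a \<in> U \<or> b \<in> W \<Longrightarrow> et sc [a, b] \<in> etN sc U W"
  by (rule tspan_base) blast

lemma qker_etP: "qker sc I = etP sc (\<lambda>vs. \<exists>v\<in>set vs. v \<in> I)"
  by (simp add: qker_def etP_def)

lemma
  shows ideal_gen_least: "module.subspace sc J \<Longrightarrow> (\<And>x y. x \<in> J \<Longrightarrow> mult x y \<in> J \<and> mult y x \<in> J) \<Longrightarrow> g \<in> J \<Longrightarrow> ideal_gen sc mult g \<subseteq> J"
    and ideal_gen_gen: "g \<in> ideal_gen sc mult g"
    and ideal_gen_mult: "x \<in> ideal_gen sc mult g \<Longrightarrow> mult x y \<in> ideal_gen sc mult g"
      "x \<in> ideal_gen sc mult g \<Longrightarrow> mult y x \<in> ideal_gen sc mult g"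
  unfolding ideal_gen_def by blast+

context tensor_space
begin

lemma subspace_ideal_gen: "subspace (ideal_gen sc mult g)"
  unfolding ideal_gen_def by (rule subspace_Inter) blast

lemma lft_minus_fun:
  assumes "bil sc w B" "bil sc w B'" "t \<in> T2"
  shows "lft sc (\<lambda>a b. B a b - B' a b) t = lft sc B t - lft sc B' t"
proof -
  have b: "bil sc w (\<lambda>a b. B a b - B' a b)"
    by (intro bilI lin_minus2 bil1[OF assms(1)] bil2[OF assms(1)] bil1[OF assms(2)] bil2[OF assms(2)])
  obtain ps where ps: "t = S2 sc ps" using T2_S2[OF assms(3)] by blast
  show ?thesis unfolding ps lft_S2[OF b] lft_S2[OF assms(1)] lft_S2[OF assms(2)]
    by (simp add: case_prod_unfold sum_list_subtractf)
qed

lemma tprod_lft: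
  assumes "s \<in> T2"
  shows "tprod sc s t = lft sc (\<lambda>a b. tprod sc (et sc [a, b]) t) s"
  using lft_comp[OF bil_et2 lin_tprod_left[where t = t] assms] lft_et_id[OF assms] by simp

lemma etN_subspace: "module.subspace tsc (etN sc U W)"
  by (rule subspace_tspan)

text \<open>If \<open>x\<close> were outside \<open>I\<close>, a functional vanishing on
  \<open>I\<close> with value 1 at \<open>x\<close>, extended by zero from arity one, would kill
  every generator of \<open>qker\<close> but not \<open>et sc [x]\<close>.\<close>

lemma et_qker_iff:
  assumes "subspace I"
  shows "et sc [x] \<in> qker sc I \<longleftrightarrow> x \<in> I"
proof
  assume e: "et sc [x] \<in> qker sc I"
  show "x \<in> I"
  proof (rule ccontr)
    assume "x \<notin> I"
    then have "x \<notin> span I" using span_eq_iff assms by blast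
    then obtain f where f: "lin sc (*) f" "f x = 1" "\<And>y. y \<in> span I \<Longrightarrow> f y = 0"
      using linear_extend_off_span[OF vs] by metis
    let ?\<phi> = "rst (Suc 0) (\<lambda>xs. f (hd xs))"
    have ml: "mlin sc ?\<phi>" unfolding mlin_rst_iff by (rule mlN_1) (simp add: f)
    have ml0: "mlin sc (\<lambda>x. 0)" by (simp add: mlin_def)
    have "et sc [x] (\<lambda>_. 0) = 0"
      using et_mlin[OF ml0, of "[x]"] .
    moreover have "et sc [x] ?\<phi> = et sc [x] (\<lambda>_. 0)"
      using e unfolding qker_etP
    proof (rule etP_cong[OF _ ml ml0])
      fix vs assume "\<exists>v\<in>set vs. v \<in> I"
      then show "?\<phi> vs = 0" using f(3) span_base by (auto simp: length_Suc_conv)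
    qed
    ultimately show False using et_mlin[OF ml, of "[x]"] f(2) by simp
  qed
next
  assume "x \<in> I"
  then show "et sc [x] \<in> qker sc I" unfolding qker_etP by (intro et_etP) simp
qed

text \<open>A basis of \<open>I\<close> is extended to the whole space and then sent to zero;
  \<open>P\<close> thereby chooses linear representatives of classes modulo
  \<open>I\<close>.\<close>

lemma projection_along:
  assumes "subspace I"
  obtains P where "lin sc sc P" "\<And>x. x \<in> I \<Longrightarrow> P x = 0" "\<And>x. x - P x \<in> I"
proof -
  interpret vector_space_pair sc sc ..
  obtain B where B: "B \<subseteq> I" "independent B" "I \<subseteq> span B"
    using maximal_independent_subset by blast
  let ?B = "extend_basis B"
  note eb = extend_basis_superset[OF B(2)] independent_extend_basis[OF B(2)] span_extend_basis[OF B(2)]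
  obtain P where P: "lin sc sc P" "\<forall>b\<in>?B. P b = (if b \<in> B then 0 else b)"
    using linear_independent_extend[OF eb(2), of "\<lambda>b. if b \<in> B then 0 else b"] by blast
  have "P x = 0" if "x \<in> span B" for x
    using that by (induction rule: span_induct_alt) (use P eb(1) in \<open>auto simp: lin_0[OF P(1)] lin_add[OF P(1)] lin_scale[OF P(1)]\<close>)
  moreover have "x - P x \<in> I" if "x \<in> span ?B" for x
    using that
  proof (induction rule: span_induct_alt)
    case base
    then show ?case by (simp add: lin_0[OF P(1)] subspace_0 assms)
  next
    case (step c x y)
    have "x - P x \<in> I" using step(1) P(2) B(1) subspace_0[OF assms] by auto
    moreover have "sc c x + y - P (sc c x + y) = sc c (x - P x) + (y - P y)"
      by (simp add: lin_add[OF P(1)] lin_scale[OF P(1)] scale_right_diff_distrib)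
    ultimately show ?case using step(2) assms by (metis subspace_add subspace_scale)
  qed
  ultimately show ?thesis using that[of P] P(1) B(3) eb(3) by auto
qed

end

locale almost_connected_cooperad = cooperad sc Op one gam mult Dl
  for sc :: "'k::field \<Rightarrow> 'v::ab_group_add \<Rightarrow> 'v"
    and Op one gam mult Dl +
  fixes eps :: "'v \<Rightarrow> 'k" and bar :: 'v and I :: "'v set"
  assumes counit: "bialg_counit sc one mult Dl eps"
    and almost_connected: "almost_connected sc Op Dl eps bar"
    and I_def: "I = ideal_gen sc mult (one - bar)"
begin

section \<open>The ideal generated by \<open>one - bar\<close> and its quotient\<close>

lemma lin_eps: "lin sc (*) eps" and eps_one [simp]: "eps one = 1" and eps_mult: "eps (mult x y) = eps x * eps y"
  using counit unfolding bialg_counit_def by blast+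

lemma bar_Op: "bar \<in> Op 1" and eps_bar [simp]: "eps bar = 1" and Dl_bar: "Dl bar = et sc [bar, bar]"
  and riter_bar: "a \<in> Op 1 \<Longrightarrow> eps a = 0 \<Longrightarrow> \<exists>m. riter sc Dl bar m a = 0"
  using almost_connected unfolding almost_connected_def by blast+

lemma I_subspace: "subspace I" and I_gen: "one - bar \<in> I" and I_mult: "x \<in> I \<Longrightarrow> mult x y \<in> I" "x \<in> I \<Longrightarrow> mult y x \<in> I"
  unfolding I_def by (auto intro: subspace_ideal_gen ideal_gen_gen ideal_gen_mult)

lemma bil_eps_left: "bil sc sc (\<lambda>a b. sc (eps a) b)"
  by (auto intro!: bilI lin_smult_vec vs lin_smult[OF lin_id[OF vs]] lin_eps)

lemma bil_eps_right: "bil sc sc (\<lambda>a b. sc (eps b) a)"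
  by (rule bil_slice[OF lin_eps])

lemma counit_left: "lft sc (\<lambda>a b. sc (eps a) b) (Dl x) = x"
proof -
  have "et sc [lft sc (\<lambda>a b. sc (eps a) b) (Dl x)] = lft sc (\<lambda>a b. et sc [sc (eps a) b]) (Dl x)"
    by (rule lft_comp[OF bil_eps_left lin_et1 Dl_T2])
  also have "\<dots> = tapp sc 2 (\<lambda>zs. et sc [sc (eps (zs ! 0)) (zs ! 1)]) (Dl x)"
    using tapp2_lft[OF _ _ Dl_T2, of "\<lambda>zs. et sc [sc (eps (zs ! 0)) (zs ! 1)]"] bil_comp[OF bil_eps_left lin_et1] by simp
  also have "\<dots> = et sc [x]" using counit unfolding bialg_counit_def by blast
  finally show ?thesis by (simp add: et1_inj)
qed

lemma counit_right: "lft sc (\<lambda>a b. sc (eps b) a) (Dl x) = x"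
proof -
  have "et sc [lft sc (\<lambda>a b. sc (eps b) a) (Dl x)] = lft sc (\<lambda>a b. et sc [sc (eps b) a]) (Dl x)"
    by (rule lft_comp[OF bil_eps_right lin_et1 Dl_T2])
  also have "\<dots> = tapp sc 2 (\<lambda>zs. et sc [sc (eps (zs ! 1)) (zs ! 0)]) (Dl x)"
    using tapp2_lft[OF _ _ Dl_T2, of "\<lambda>zs. et sc [sc (eps (zs ! 1)) (zs ! 0)]"] bil_comp[OF bil_eps_right lin_et1] by simp
  also have "\<dots> = et sc [x]" using counit unfolding bialg_counit_def by blast
  finally show ?thesis by (simp add: et1_inj)
qed

lemma Dl_mult: "Dl (mult x y) = lft sc (\<lambda>a b. lft sc (\<lambda>c d. et sc [mult a c, mult b d]) (Dl y)) (Dl x)"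
  using lft_Dl_mult[OF bil_et2] by (simp add: lft_et_id[OF Dl_T2])

lemma et_mult_in:
  assumes "t \<in> tspan sc {et sc [a, b] | a b. P a b}" "\<And>c d. P c d \<Longrightarrow> mult a c \<in> U \<or> mult b d \<in> W"
  shows "lft sc (\<lambda>c d. et sc [mult a c, mult b d]) t \<in> etN sc U W"
  by (rule lft_in[OF bil_mult_comp(1)[OF bil_et2] assms(1) etN_subspace]) (rule et_etN[OF assms(2)])

text \<open>The elements satisfying the conclusion form a two-sided ideal, since \<open>Dl\<close>
  and \<open>eps\<close> are multiplicative and \<open>I\<close> absorbs products. This ideal
  contains the generator, hence all of \<open>I\<close>.\<close>

lemma I_coideal: "x \<in> I \<Longrightarrow> Dl x \<in> etN sc I I \<and> eps x = 0"
proof -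
  let ?J = "{x. Dl x \<in> etN sc I I} \<inter> {x. eps x \<in> {0}}"
  have "I \<subseteq> ?J" unfolding I_def
  proof (rule ideal_gen_least, fold I_def)
    show "subspace ?J"
      by (intro subspace_inter subspace_preimage[OF lin_Dl etN_subspace] subspace_preimage[OF lin_eps])
        (simp add: module.subspace_def vector_space_times module_iff_vector_space)
  next
    fix x y assume x: "x \<in> ?J"
    have "Dl (mult x y) \<in> etN sc I I" unfolding Dl_mult
    proof (rule lft_in[OF bil_lft_mult[OF bil_et2] _ etN_subspace])
      show "Dl x \<in> etN sc I I" using x by simp
      show "lft sc (\<lambda>c d. et sc [mult a c, mult b d]) (Dl y) \<in> etN sc I I" if "a \<in> I \<or> b \<in> I" for a b
        by (rule et_mult_in[OF T2_tspan2[OF Dl_T2]]) (use that I_mult in blast)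
    qed
    moreover have "Dl (mult y x) \<in> etN sc I I" unfolding Dl_mult
    proof (rule lft_in[OF bil_lft_mult[OF bil_et2] T2_tspan2[OF Dl_T2] etN_subspace])
      show "lft sc (\<lambda>c d. et sc [mult a c, mult b d]) (Dl x) \<in> etN sc I I" for a b
        by (rule et_mult_in[of _ "\<lambda>c d. c \<in> I \<or> d \<in> I"]) (use x I_mult in auto)
    qed
    ultimately show "mult x y \<in> ?J \<and> mult y x \<in> ?J" using x by (simp add: eps_mult)
  next
    have "Dl (one - bar) = et sc [one - bar, one] + et sc [bar, one - bar]"
      by (simp add: lin_diff[OF lin_Dl] Dl_one Dl_bar lin_diff[OF bil1[OF bil_et2]] lin_diff[OF bil2[OF bil_et2]])
    then show "one - bar \<in> ?J"
      using I_gen by (auto simp: lin_diff[OF lin_eps] intro!: tspan_add et_etN)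
  qed
  then show "x \<in> I \<Longrightarrow> Dl x \<in> etN sc I I \<and> eps x = 0" by auto
qed

lemma coideal_I: "coideal sc Dl eps I"
  unfolding coideal_def using I_coideal by blast

lemma tri_et3: "tri sc tsc (\<lambda>a b c. et sc [a, b, c])"
  using lin_et[of "[]"] lin_et[of "[_]"] lin_et[of "[_,_]"] by (auto intro!: triI)

text \<open>All the identities hold already before passing to the quotient, so each difference to be
  placed in \<open>I\<close> or \<open>qker\<close> is 0.\<close>

lemma quotient_bialgebra_I: "quotient_bialgebra sc one mult Dl eps I"
proof -
  have z: "0 \<in> I" "0 \<in> qker sc I" using I_subspace subspace_0 by (auto simp: qker_def tspan_zero)
  have q: "Dl x \<in> qker sc I" if "x \<in> I" for x
    unfolding qker_def
    by (rule subsetD[OF tspan_mono, of "{et sc [a, b] |a b. a \<in> I \<or> b \<in> I}"]) (use I_coideal[OF that] in fastforce)+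
  have co: "tapp sc 2 (\<lambda>zs. tprod sc (Dl (zs ! 0)) (et sc [zs ! 1])) (Dl x) =
     tapp sc 2 (\<lambda>zs. tprod sc (et sc [zs ! 0]) (Dl (zs ! 1))) (Dl x)" for x
  proof -
    have l: "tapp sc 2 (\<lambda>zs. tprod sc (Dl (zs ! 0)) (et sc [zs ! 1])) (Dl x) = lft sc (\<lambda>a b. lft sc (\<lambda>c d. et sc [c, d, b]) (Dl a)) (Dl x)"
      using tapp2_lft[OF _ _ Dl_T2, of "\<lambda>zs. tprod sc (Dl (zs ! 0)) (et sc [zs ! 1])"] bil_lft_left[OF tri_et3]
      by (simp add: tprod_et_right_lft[OF Dl_T2, symmetric] tprod_in[OF etP_tens[OF Dl_T2] et_tens])
    have r: "tapp sc 2 (\<lambda>zs. tprod sc (et sc [zs ! 0]) (Dl (zs ! 1))) (Dl x) = lft sc (\<lambda>a b. lft sc (\<lambda>c d. et sc [a, c, d]) (Dl b)) (Dl x)"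
    proof -
      have e: "tprod sc (et sc [a]) (Dl b) = lft sc (\<lambda>c d. et sc [a, c, d]) (Dl b)" for a b
        using tprod_et_left_lft[OF Dl_T2, of "[a]"] by simp
      have t: "tprod sc (et sc [a]) (Dl b) \<in> tens sc" for a b
        by (rule tprod_in[OF et_tens etP_tens[OF Dl_T2]]) simp
      show ?thesis
        using tapp2_lft[OF _ _ Dl_T2, of "\<lambda>zs. tprod sc (et sc [zs ! 0]) (Dl (zs ! 1))"] bil_lft_right[OF tri_et3] t
        by (simp add: e)
    qed
    show ?thesis unfolding l r by (rule Dl_coassoc[OF tri_et3])
  qed
  have mu: "tapp sc 4 (\<lambda>zs. et sc [mult (zs ! 0) (zs ! 2), mult (zs ! 1) (zs ! 3)]) (tprod sc (Dl x) (Dl y)) = Dl (mult x y)" for x y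
  proof -
    let ?G = "\<lambda>zs. et sc [mult (zs ! 0) (zs ! 2), mult (zs ! 1) (zs ! 3)]"
    have ml: "mlN sc 4 (\<lambda>zs. ?G zs \<phi>)" for \<phi>
    proof -
      have "bil sc tsc (\<lambda>a b. et sc [mult a c, mult b d])" "bil sc tsc (\<lambda>c d. et sc [mult a c, mult b d])" for a b c d
        by (rule bil_mult_comp[OF bil_et2])+
      from bil_comp[OF this(1) lin_eval] bil_comp[OF this(2) lin_eval]
      have "mlN sc (2 + 2) (\<lambda>zs. ?G zs \<phi>)"
        by (intro mlN_append) (auto simp: numeral_2_eq_2 numeral_3_eq_3 length_Suc_conv intro!: mlN_2[unfolded numeral_2_eq_2])
      then show ?thesis by simp
    qed
    have b: "bil sc tsc (\<lambda>c d. et sc [a, b, c, d])" for a b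
      using lin_et[of "[a, b]"] lin_et[of "[a, b, _]"] by (auto intro!: bilI)
    have b': "bil sc tsc (\<lambda>a b. tprod sc (et sc [a, b]) (Dl y))"
      by (rule bil_comp[OF bil_et2 lin_tprod_left])
    have "tapp sc 4 ?G (tprod sc (et sc [a, b]) (Dl y)) = lft sc (\<lambda>c d. et sc [mult a c, mult b d]) (Dl y)" for a b
    proof -
      have "tapp sc 4 ?G (et sc [a, b, c, d]) = et sc [mult a c, mult b d]" for c d
        using tapp_et[of sc 4 ?G "[a, b, c, d]", OF ml] by (simp add: numeral_2_eq_2 numeral_3_eq_3)
      then show ?thesis
        unfolding tprod_et_left_lft[OF Dl_T2] by (simp add: lft_comp[OF b lin_tapp Dl_T2])
    qed
    then show ?thesis
      unfolding tprod_lft[OF Dl_T2, of x] lft_comp[OF b' lin_tapp Dl_T2] Dl_mult by simp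
  qed
  show ?thesis
    unfolding quotient_bialgebra_def using I_subspace I_mult q I_coideal z counit
    by (simp add: co mu mult_assoc Dl_one eps_mult bialg_counit_def del: One_nat_def)
qed

text \<open>Modulo \<open>I\<close> these are the iterated wedges of the line spanned by the unit.
  Only \<open>x \<otimes> one\<close> is subtracted: the other correction
  \<open>one \<otimes> x\<close> lies in \<open>Fil p \<otimes> V\<close> anyway, because
  \<open>one\<close> is in every \<open>Fil p\<close>.\<close>

fun Fil :: "nat \<Rightarrow> 'v set" where
  "Fil 0 = {x. \<exists>c. x - sc c one \<in> I}"
| "Fil (Suc p) = {x. Dl x - et sc [x, one] \<in> etN sc (Fil p) I}"

lemma lin_half: "lin sc tsc (\<lambda>x. Dl x - et sc [x, one])"
  by (intro lin_minus2 lin_Dl bil1[OF bil_et2])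

lemma Fil_subspace: "subspace (Fil p)"
proof (cases p)
  case 0
  show ?thesis unfolding 0 Fil.simps
  proof (rule subspaceI)
    show "0 \<in> {x. \<exists>c. x - sc c one \<in> I}" using I_subspace subspace_0 by (auto intro!: exI[of _ 0])
  next
    fix x y assume "x \<in> {x. \<exists>c. x - sc c one \<in> I}" "y \<in> {x. \<exists>c. x - sc c one \<in> I}"
    then obtain c d where "x - sc c one \<in> I" "y - sc d one \<in> I" by blast
    from subspace_add[OF I_subspace this] have "x + y - sc (c + d) one \<in> I" by (simp add: scale_left_distrib algebra_simps)
    then show "x + y \<in> {x. \<exists>c. x - sc c one \<in> I}" by blast
  next
    fix c x assume "x \<in> {x. \<exists>c. x - sc c one \<in> I}"
    then obtain d where "x - sc d one \<in> I" by blast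
    from subspace_scale[OF I_subspace this, of c] have "sc c x - sc (c * d) one \<in> I" by (simp add: scale_right_diff_distrib)
    then show "sc c x \<in> {x. \<exists>c. x - sc c one \<in> I}" by blast
  qed
next
  case (Suc q)
  show ?thesis unfolding Suc Fil.simps by (rule subspace_preimage[OF lin_half etN_subspace])
qed

lemma I_Fil: "I \<subseteq> Fil p"
proof (induction p)
  case 0
  show ?case by (auto intro!: exI[of _ 0])
next
  case (Suc p)
  show ?case
  proof
    fix x assume x: "x \<in> I"
    have "Dl x \<in> etN sc (Fil p) I" using I_coideal[OF x] etN_mono[OF Suc subset_refl] by blast
    moreover have "et sc [x, one] \<in> etN sc (Fil p) I" using x Suc by (intro et_etN) blast
    ultimately show "x \<in> Fil (Suc p)" by (simp add: tspan_diff)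
  qed
qed

lemma one_Fil: "one \<in> Fil p"
proof (cases p)
  case 0
  have "one - sc 1 one \<in> I" using subspace_0[OF I_subspace] by simp
  then show ?thesis unfolding 0 Fil.simps by blast
next
  case (Suc q)
  show ?thesis unfolding Suc by (simp add: Dl_one tspan_zero)
qed

lemma bar_Fil: "bar \<in> Fil p"
proof -
  have "one - (one - bar) \<in> Fil p" 
    by (intro subspace_diff[OF Fil_subspace one_Fil] subsetD[OF I_Fil] I_gen)
  then show ?thesis by simp
qed

lemma Fil_0_subset: "Fil 0 \<subseteq> Fil p"
proof
  fix x assume "x \<in> Fil 0"
  then obtain c where "x - sc c one \<in> I" by auto
  then have "(x - sc c one) + sc c one \<in> Fil p"
    using I_Fil by (intro subspace_add subspace_scale Fil_subspace one_Fil) blast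
  then show "x \<in> Fil p" by simp
qed

lemma Fil_Suc: "Fil p \<subseteq> Fil (Suc p)"
proof (induction p)
  case 0
  show ?case by (rule Fil_0_subset)
next
  case (Suc p)
  show ?case
  proof
    fix x assume "x \<in> Fil (Suc p)"
    then have "Dl x - et sc [x, one] \<in> etN sc (Fil p) I" by simp
    then have "Dl x - et sc [x, one] \<in> etN sc (Fil (Suc p)) I" by (rule etN_mono[OF Suc subset_refl])
    then show "x \<in> Fil (Suc (Suc p))" by simp
  qed
qed

lemma Fil_mono: "p \<le> q \<Longrightarrow> Fil p \<subseteq> Fil q"
  by (rule lift_Suc_mono_le[of Fil, OF Fil_Suc])

text \<open>With \<open>Dl x = x \<otimes> one + r\<close> and
  \<open>Dl y = y \<otimes> one + s\<close>, the product of the leading terms is exactly the one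
  subtracted in \<open>Fil\<close>; each other product involves \<open>r\<close> or \<open>s\<close>
  and drops by at least one degree. Degree 0 is treated apart, by writing the factor as a scalar
  plus an element of \<open>I\<close>.\<close>

lemma Fil_mult: "x \<in> Fil p \<Longrightarrow> y \<in> Fil q \<Longrightarrow> mult x y \<in> Fil (p + q)"
proof (induction "p + q" arbitrary: p q x y rule: less_induct)
  case less
  show ?case
  proof (cases p)
    case 0
    then obtain c where c: "x - sc c one \<in> I" using less.prems(1) by auto
    have "mult (x - sc c one) y + sc c y \<in> Fil q"
      using I_Fil I_mult(1)[OF c] less.prems(2) by (intro subspace_add subspace_scale Fil_subspace) auto
    then show ?thesis using 0 by (simp add: lin_diff[OF lin_mult_right] lin_scale[OF lin_mult_right])
  next
    case p: (Suc p')
    show ?thesis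
    proof (cases q)
      case 0
      then obtain c where c: "y - sc c one \<in> I" using less.prems(2) by auto
      have "mult x (y - sc c one) + sc c x \<in> Fil p"
        using I_Fil I_mult(2)[OF c] less.prems(1) by (intro subspace_add subspace_scale Fil_subspace) auto
      then show ?thesis using 0 by (simp add: lin_diff[OF lin_mult_left] lin_scale[OF lin_mult_left])
    next
      case q: (Suc q')
      \<comment> \<open>One less than \<open>p + q\<close>: the degree that first tensor factors
        must have.\<close>
      let ?n = "Suc (p' + q')"
      let ?\<Phi> = "\<lambda>a b. lft sc (\<lambda>c d. et sc [mult a c, mult b d])"
      note b1 = bil_mult_comp(1)[OF bil_et2]
      define r where "r = Dl x - et sc [x, one]"
      define s where "s = Dl y - et sc [y, one]"
      have r: "r \<in> etN sc (Fil p') I" and s: "s \<in> etN sc (Fil q') I" using less.prems p q by (auto simp: r_def s_def)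
      have rT: "r \<in> T2" and sT: "s \<in> T2" unfolding r_def s_def by (intro etP_diff Dl_T2 et2_T2)+
      have \<Phi>: "?\<Phi> a b (Dl y) = et sc [mult a y, b] + ?\<Phi> a b s" for a b
        using lft_add[OF b1[of a b] et2_T2[of y one] sT] by (simp add: s_def lft_et[OF b1])
      have "Dl (mult x y) = ?\<Phi> x one (Dl y) + lft sc (\<lambda>a b. ?\<Phi> a b (Dl y)) r"
        using lft_add[OF bil_lft_mult[OF bil_et2, of y] et2_T2[of x one] rT]
        by (simp add: Dl_mult r_def lft_et[OF bil_lft_mult[OF bil_et2]])
      then have e: "Dl (mult x y) - et sc [mult x y, one] = ?\<Phi> x one s + lft sc (\<lambda>a b. ?\<Phi> a b (Dl y)) r"
        unfolding \<Phi>[of x one] by simp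
      have "?\<Phi> x one s \<in> etN sc (Fil ?n) I"
        by (rule et_mult_in[OF s]) (use less.hyps[of "Suc p'" q' x] less.prems(1) p q in auto)
      moreover have "lft sc (\<lambda>a b. ?\<Phi> a b (Dl y)) r \<in> etN sc (Fil ?n) I"
      proof (rule lft_in[OF bil_lft_mult[OF bil_et2] r etN_subspace])
        fix a b assume ab: "a \<in> Fil p' \<or> b \<in> I"
        have "mult a y \<in> Fil ?n \<or> b \<in> I" using ab less.hyps[of p' "Suc q'" a y] less.prems(2) p q by auto
        moreover have "?\<Phi> a b s \<in> etN sc (Fil ?n) I"
        proof (rule et_mult_in[OF s])
          fix c d assume "c \<in> Fil q' \<or> d \<in> I"
          then show "mult a c \<in> Fil ?n \<or> mult b d \<in> I"
            using ab less.hyps[of p' q' a c] Fil_Suc[of "p' + q'"] I_mult p q by auto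
        qed
        ultimately show "?\<Phi> a b (Dl y) \<in> etN sc (Fil ?n) I" unfolding \<Phi> by (intro tspan_add et_etN)
      qed
      ultimately have "mult x y \<in> Fil (Suc ?n)" by (simp only: Fil.simps e mem_Collect_eq tspan_add)
      then show ?thesis using p q by simp
    qed
  qed
qed

text \<open>The projection onto the kernel of \<open>eps\<close> along \<open>one\<close>.\<close>

abbreviation Q :: "'v \<Rightarrow> 'v" where "Q x \<equiv> x - sc (eps x) one"

lemma lin_Q: "lin sc sc Q"
  by (intro lin_minus2 lin_id[OF vs] lin_smult_vec lin_eps vs)

lemma Q_I: "x \<in> I \<Longrightarrow> Q x = x"
  using I_coideal by simp

lemma Q_Fil_0: "x \<in> Fil 0 \<Longrightarrow> Q x \<in> I"
proof -
  assume "x \<in> Fil 0"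
  then obtain c where c: "x - sc c one \<in> I" by auto
  have "eps x = c" using I_coideal[OF c] by (simp add: lin_diff[OF lin_eps] lin_scale[OF lin_eps])
  then show "Q x \<in> I" using c by simp
qed

text \<open>The expression defining the filtration is thus \<open>(id \<otimes> Q) (Dl x)\<close>;
  by the right counit law, the part split off by \<open>Q\<close> is
  \<open>x \<otimes> one\<close>.\<close>

lemma Dl_right_reduced: "lft sc (\<lambda>a b. et sc [a, Q b]) (Dl x) = Dl x - et sc [x, one]"
proof -
  have "lft sc (\<lambda>a b. et sc [a, Q b]) (Dl x) = lft sc (\<lambda>a b. et sc [a, b] - et sc [sc (eps b) a, one]) (Dl x)"
    by (simp add: lin_diff[OF bil2[OF bil_et2]] lin_scale[OF bil2[OF bil_et2]] lin_scale[OF bil1[OF bil_et2]])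
  also have "\<dots> = Dl x - lft sc (\<lambda>a b. et sc [sc (eps b) a, one]) (Dl x)"
    by (simp add: lft_minus_fun[OF bil_et2 bil_comp[OF bil_eps_right bil1[OF bil_et2]] Dl_T2] lft_et_id[OF Dl_T2])
  also have "lft sc (\<lambda>a b. et sc [sc (eps b) a, one]) (Dl x) = et sc [x, one]"
    using lft_comp[OF bil_eps_right bil1[OF bil_et2, of one] Dl_T2, of x] by (simp add: counit_right)
  finally show ?thesis .
qed

lemma bil_et_Q: "bil sc tsc (\<lambda>a b. et sc [Q a, b])" "bil sc tsc (\<lambda>a b. et sc [a, Q b])" "bil sc tsc (\<lambda>a b. et sc [Q a, Q b])"
  by (auto intro!: bilI intro: bil1'[OF bil_et2 lin_Q] bil2'[OF bil_et2 lin_Q] bil1[OF bil_et2] bil2[OF bil_et2])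

text \<open>By the two counit laws the reduced coproduct of \<open>Q x\<close> is
  \<open>(Q \<otimes> Q) (Dl x)\<close>; since \<open>Q one = 0\<close>, the term
  \<open>x \<otimes> one\<close> may be subtracted first, which brings in the defining condition of
  \<open>Fil\<close>.\<close>

lemma Dl_reduced: "rD sc Dl one (Q x) = lft sc (\<lambda>a b. et sc [Q a, Q b]) (Dl x - et sc [x, one])"
proof -
  have s: "Dl x - et sc [x, one] \<in> T2" by (intro etP_diff Dl_T2 et2_T2)
  have "lft sc (\<lambda>a b. et sc [Q a, Q b]) (Dl x - et sc [x, one]) = lft sc (\<lambda>a b. et sc [Q a, Q b]) (Dl x)"
    by (simp add: lft_diff[OF bil_et_Q(3) Dl_T2 et2_T2] lft_et[OF bil_et_Q(3)] lin_0[OF bil2[OF bil_et2]])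
  also have "\<dots> = lft sc (\<lambda>a b. et sc [a, Q b] - et sc [one, sc (eps a) (Q b)]) (Dl x)"
    by (simp only: lin_diff[OF bil1[OF bil_et2]] lin_scale[OF bil1[OF bil_et2]] lin_scale[OF bil2[OF bil_et2]])
  also have "\<dots> = lft sc (\<lambda>a b. et sc [a, Q b]) (Dl x) - lft sc (\<lambda>a b. et sc [one, Q (sc (eps a) b)]) (Dl x)"
    unfolding lin_scale[OF lin_Q, symmetric]
    by (rule lft_minus_fun[OF bil_et_Q(2) bil_comp[OF bil_eps_left bil2'[OF bil_et2 lin_Q]] Dl_T2])
  also have "lft sc (\<lambda>a b. et sc [one, Q (sc (eps a) b)]) (Dl x) = et sc [one, Q x]"
    using lft_comp[OF bil_eps_left bil2'[OF bil_et2 lin_Q, of one] Dl_T2, of x] by (simp only: counit_left)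
  finally show ?thesis
    unfolding Dl_right_reduced rD_def
    by (simp add: lin_diff[OF lin_Dl] lin_scale[OF lin_Dl] Dl_one lin_diff[OF bil1[OF bil_et2]] lin_scale[OF bil1[OF bil_et2]])
qed

end

section \<open>Conilpotency\<close>

context almost_connected_cooperad
begin

lemma tprod_et_right: "mlin sc \<phi> \<Longrightarrow> tprod sc t (et sc ys) \<phi> = t (\<lambda>xs. \<phi> (xs @ ys))"
  by (simp add: tprod_def mlin_append_left)

lemma rD_T2: "rD sc Dl u x \<in> T2"
  unfolding rD_def by (intro etP_diff Dl_T2 et2_T2)

lemma lin_rD: "lin sc tsc (rD sc Dl u)"
  unfolding rD_def by (intro lin_minus2 lin_Dl bil1[OF bil_et2] bil2[OF bil_et2])

lemma mlN_rD_step: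
  assumes "mlin sc \<phi>"
  shows "mlN sc (Suc m) (\<lambda>zs. tprod sc (rD sc Dl u (hd zs)) (et sc (tl zs)) \<phi>)"
proof (rule mlN_Suc)
  show "mlN sc m (\<lambda>zs. tprod sc (rD sc Dl u (hd (x # zs))) (et sc (tl (x # zs))) \<phi>)" for x
    using mlin_mlN[OF mlin_tens_left[OF etP_tens[OF rD_T2] assms]] by (simp add: tprod_et_right[OF assms])
  show "lin sc (*) (\<lambda>x. tprod sc (rD sc Dl u (hd (x # zs))) (et sc (tl (x # zs))) \<phi>)" for zs
    using lin_eval_comp[OF lin_comp[OF lin_rD lin_tprod_left]] by simp
qed

abbreviation rstep :: "'v \<Rightarrow> nat \<Rightarrow> ('v,'k) tensor \<Rightarrow> ('v,'k) tensor" where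
  "rstep u m \<equiv> tapp sc (Suc m) (\<lambda>zs. tprod sc (rD sc Dl u (hd zs)) (et sc (tl zs)))"

lemma rstep_et: "length vs = Suc m \<Longrightarrow> rstep u m (et sc vs) = tprod sc (rD sc Dl u (hd vs)) (et sc (tl vs))"
  by (rule tapp_et[OF mlN_rD_step]) (auto intro!: tprod_in[OF etP_tens[OF rD_T2] et_tens])

lemma riter_tensN: "riter sc Dl u m x \<in> tensN sc (Suc m)"
proof (induction m)
  case 0
  show ?case by (simp add: et_etP)
next
  case (Suc m)
  show ?case unfolding riter.simps
    by (rule tapp_in[OF Suc _ mlN_rD_step]) (auto intro!: tprod_in[OF rD_T2 et_etP[of "\<lambda>ys. length ys = m"]])
qed

lemma lin_riter: "lin sc tsc (riter sc Dl u m)"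
proof (induction m)
  case 0
  show ?case using lin_et1 by simp
next
  case (Suc m)
  show ?case unfolding riter.simps by (rule lin_comp[OF Suc lin_tapp])
qed

lemma bil_tprod_et: "lin sc tsc f \<Longrightarrow> (\<And>x. f x \<in> tens sc) \<Longrightarrow> bil sc tsc (\<lambda>a b. tprod sc (f a) (et sc [b]))"
  by (intro bilI lin_comp[OF _ lin_tprod_left] lin_tprod_right lin_et1) auto

lemma bil_riter: "bil sc tsc (\<lambda>a b. tprod sc (riter sc Dl u m a) (et sc [b]))"
  by (rule bil_tprod_et[OF lin_riter etP_tens[OF riter_tensN]])

text \<open>The iterates are defined by expanding the first factor again and again; they may equally be
  computed by expanding the first factor of the first reduced coproduct.\<close>
lemma riter_Suc_outer: "riter sc Dl u (Suc m) x = lft sc (\<lambda>a b. tprod sc (riter sc Dl u m a) (et sc [b])) (rD sc Dl u x)"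
proof (induction m)
  case 0
  have "riter sc Dl u (Suc 0) x = tprod sc (rD sc Dl u x) (et sc [])"
    using rstep_et[of "[x]" 0] by simp
  also have "\<dots> = rD sc Dl u x"
    by (simp add: tprod_et_right_lft[OF rD_T2] lft_et_id[OF rD_T2])
  finally show ?case by (simp add: tprod_et_et lft_et_id[OF rD_T2])
next
  case (Suc m)
  have "rstep u (Suc m) (tprod sc t (et sc [b])) = tprod sc (rstep u m t) (et sc [b])"
    if "t \<in> tensN sc (Suc m)" for t b
  proof (rule etP_lin_eq[OF that, where w = tsc])
    show "lin tsc tsc (\<lambda>t. rstep u (Suc m) (tprod sc t (et sc [b])))"
      by (rule lin_comp[OF lin_tprod_left lin_tapp])
    show "lin tsc tsc (\<lambda>t. tprod sc (rstep u m t) (et sc [b]))"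
      by (rule lin_comp[OF lin_tapp lin_tprod_left])
    fix vs :: "'v list" assume l: "length vs = Suc m"
    then obtain v vs' where vs: "vs = v # vs'" by (cases vs) auto
    have a: "tprod sc (tprod sc t (et sc xs)) (et sc ys) = tprod sc t (et sc (xs @ ys))" for t xs ys
    proof
      show "tprod sc (tprod sc t (et sc xs)) (et sc ys) \<phi> = tprod sc t (et sc (xs @ ys)) \<phi>" for \<phi>
        by (cases "mlin sc \<phi>")
          (simp_all add: tprod_et_right[OF mlin_append_right] tprod_et_right, simp_all add: tprod_def)
    qed
    show "rstep u (Suc m) (tprod sc (et sc vs) (et sc [b])) = tprod sc (rstep u m (et sc vs)) (et sc [b])"
      using l vs by (simp add: tprod_et_et rstep_et a)
  qed
  from this[OF riter_tensN] show ?case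
    using lft_comp[OF bil_riter lin_tapp[of sc "Suc (Suc m)" "\<lambda>zs. tprod sc (rD sc Dl u (hd zs)) (et sc (tl zs))"] rD_T2, of u m u x]
    by (simp only: riter.simps(2)[of sc Dl u "Suc m"] Suc.IH riter.simps(2)[of sc Dl u m, symmetric])
qed

text \<open>The reduced coproduct of \<open>Q x\<close> lies in
  \<open>Q (Fil p) \<otimes> V + V \<otimes> I\<close>. Iterating further on the first factor, the
  former part is covered by induction, and the latter keeps its factor in \<open>I\<close>.\<close>

lemma riter_Fil: "x \<in> Fil p \<Longrightarrow> riter sc Dl one p (Q x) \<in> qker sc I"
proof (induction p arbitrary: x)
  case 0
  then show ?case unfolding riter.simps et_qker_iff[OF I_subspace] by (rule Q_Fil_0)
next
  case (Suc p)
  let ?R = "\<lambda>a b. (\<exists>a'\<in>Fil p. a = Q a') \<or> b \<in> I"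
  have "rD sc Dl one (Q x) \<in> tspan sc {et sc [a, b] | a b. ?R a b}" unfolding Dl_reduced
  proof (rule lft_in[OF bil_et_Q(3) _ subspace_tspan])
    show "Dl x - et sc [x, one] \<in> etN sc (Fil p) I" using Suc.prems by simp
    fix a b assume "a \<in> Fil p \<or> b \<in> I"
    then have "?R (Q a) (Q b)" using Q_I by fastforce
    then show "et sc [Q a, Q b] \<in> tspan sc {et sc [a, b] | a b. ?R a b}" by (intro tspan_base) blast
  qed
  then show ?case unfolding riter_Suc_outer
  proof (rule lft_in[OF bil_riter])
    show "module.subspace tsc (qker sc I)" unfolding qker_def by (rule subspace_tspan)
    fix a b assume "?R a b"
    then show "tprod sc (riter sc Dl one p a) (et sc [b]) \<in> qker sc I"
    proof
      assume "\<exists>a'\<in>Fil p. a = Q a'"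
      then have "riter sc Dl one p a \<in> qker sc I" using Suc.IH by blast
      then show ?thesis unfolding qker_etP by (rule tprod_in[OF _ et_tens]) auto
    next
      assume "b \<in> I"
      then have b: "et sc [b] \<in> etP sc (\<lambda>vs. \<exists>v\<in>set vs. v \<in> I)" by (intro et_etP) simp
      show ?thesis unfolding qker_etP by (rule tprod_in[OF riter_tensN b]) auto
    qed
  qed
qed

text \<open>Contracting the last factor with \<open>f\<close> undoes the product with
  \<open>b\<close>; this lets slices commute with iterated reduced coproducts.\<close>

lemma contract_last:
  assumes "t \<in> tensN sc (Suc m)" "lin sc (*) f"
  shows "tapp sc (Suc m + 1) (\<lambda>zs. tsc (f (last zs)) (et sc (butlast zs))) (tprod sc t (et sc [b])) = tsc (f b) t"
proof (rule etP_lin_eq[OF assms(1), where w = tsc])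
  show "lin tsc tsc (\<lambda>t. tapp sc (Suc m + 1) (\<lambda>zs. tsc (f (last zs)) (et sc (butlast zs))) (tprod sc t (et sc [b])))"
    by (rule lin_comp[OF lin_tprod_left lin_tapp])
  show "lin tsc tsc (tsc (f b))" by (rule lin_smult[OF lin_id[OF vector_space_tsc]])
  fix vs :: "'v list" assume l: "length vs = Suc m"
  have ml: "mlN sc (Suc m + 1) (\<lambda>zs. tsc (f (last zs)) (et sc (butlast zs)) \<phi>)" if "mlin sc \<phi>" for \<phi>
  proof (rule mlN_append)
    show "mlN sc 1 (\<lambda>ys. tsc (f (last (xs @ ys))) (et sc (butlast (xs @ ys))) \<phi>)" for xs :: "'v list"
      unfolding One_nat_def
      by (rule mlN_1) (simp add: tsc_def, rule lin_smult_vec[OF assms(2) vector_space_times])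
    fix ys :: "'v list" assume "length ys = 1"
    then obtain y where "ys = [y]" by (auto simp: length_Suc_conv)
    then show "mlN sc (Suc m) (\<lambda>xs. tsc (f (last (xs @ ys))) (et sc (butlast (xs @ ys))) \<phi>)"
      using mlin_mlN[OF that, of "Suc m"] that by (simp add: tsc_def mlN_def algebra_simps)
  qed
  show "tapp sc (Suc m + 1) (\<lambda>zs. tsc (f (last zs)) (et sc (butlast zs))) (tprod sc (et sc vs) (et sc [b])) = tsc (f b) (et sc vs)"
    unfolding tprod_et_et using l by (subst tapp_et[OF ml]) (auto intro: etP_scale)
qed

text \<open>A partition of 1 has a single part. With the empty set in second place,
  \<open>etN\<close> only records the first factor.\<close>

lemma Dl_Op_1:
  assumes "a \<in> Op 1"
  shows "Dl a \<in> etN sc (Op 1) {}"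
proof (rule subsetD[OF tspan_subset Dl_pr_graded[OF order_refl assms]])
  fix s assume "s \<in> {et sc [a, b] | a b. \<exists>ns ws. ns \<in> partitions 1 \<and> a \<in> Op (length ns) \<and> list_all2 (\<lambda>w n. w \<in> Op n) ws ns \<and> b = pr ws}"
  then obtain a b ns where s: "s = et sc [a, b]" "a \<in> Op (length ns)" "ns \<in> partitions 1" by blast
  have "length ns = 1" using partitions_length[OF s(3)] by linarith
  then show "s \<in> etN sc (Op 1) {}" unfolding s(1) using s(2) by (intro et_etN) simp
qed

text \<open>All slices of the reduced coproduct of \<open>a\<close> lie in \<open>Op 1\<close>, in
  the kernel of \<open>eps\<close> and in the kernel of the \<open>m\<close>-th iterate, so they lie
  in \<open>Fil m\<close> by induction. Replacing \<open>bar\<close> by \<open>one\<close>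
  afterwards costs only terms with a factor \<open>bar\<close>, which is in \<open>Fil m\<close>, or
  \<open>bar - one\<close>, which is in \<open>I\<close>.\<close>

lemma Op_1_Fil: "a \<in> Op 1 \<Longrightarrow> eps a = 0 \<Longrightarrow> riter sc Dl bar m a = 0 \<Longrightarrow> a \<in> Fil m"
proof (induction m arbitrary: a)
  case 0
  then have a: "a = 0" using et1_inj[of a 0] lin_0[OF lin_et1] by simp
  show ?case unfolding a by (rule subspace_0[OF Fil_subspace])
next
  case (Suc m)
  let ?r = "rD sc Dl bar a"
  let ?W = "Op 1 \<inter> {w. eps w \<in> {0}} \<inter> {w. riter sc Dl bar m w \<in> {0}}"
  have s0: "module.subspace (*) {0::'k}" "module.subspace tsc {0::('v,'k) tensor}"
    using module.subspace_single_0 vector_space_times vector_space_tsc module_iff_vector_space by metis+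
  have W: "subspace ?W"
    by (intro subspace_inter Op_subspace subspace_preimage[OF lin_eps] subspace_preimage[OF lin_riter] s0) simp
  have r1: "?r \<in> etN sc (Op 1) {}" unfolding rD_def
    using Dl_Op_1 Suc.prems(1) bar_Op by (intro tspan_diff et_etN) auto
  \<comment> \<open>The zero subspace in second place admits every functional as a slicing
    functional.\<close>
  have "?r \<in> etN sc ?W {0}"
  proof (rule slice_mem[OF rD_T2 W])
    show "subspace {0}" by (rule subspace_single_0)
    fix f assume f: "lin sc (*) f"
    have "slice f ?r \<in> Op 1"
      by (rule lft_in[OF bil_slice[OF f] r1 Op_subspace]) (auto intro: subspace_scale[OF Op_subspace])
    \<comment> \<open>Both \<open>eps (slice f ?r)\<close> and \<open>f\<close> of the contraction
      by \<open>eps\<close> on the left equal \<open>(eps \<otimes> f) ?r\<close>. By the counit law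
      that contraction is \<open>a - eps bar * a - eps a * bar\<close>, which is 0.\<close>
    moreover have "eps (slice f ?r) = 0"
    proof -
      have "lft sc (\<lambda>a b. sc (eps a) b) ?r = 0"
        unfolding rD_def using Suc.prems(2)
        by (simp add: lft_diff[OF bil_eps_left] etP_diff Dl_T2 counit_left lft_et[OF bil_eps_left])
      then have "0 = f (lft sc (\<lambda>a b. sc (eps a) b) ?r)" by (simp add: lin_0[OF f])
      also have "\<dots> = lft sc (\<lambda>a b. eps a * f b) ?r"
        by (simp add: lft_comp[OF bil_eps_left f rD_T2] lin_scale[OF f])
      also have "\<dots> = eps (slice f ?r)"
        by (simp add: lft_comp[OF bil_slice[OF f] lin_eps rD_T2] lin_scale[OF lin_eps] mult.commute)
      finally show ?thesis by simp
    qed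
    moreover have "riter sc Dl bar m (slice f ?r) = 0"
    proof -
      \<comment> \<open>Contracts the last of the \<open>m + 2\<close> factors of the next iterate
        at \<open>a\<close>, which vanishes by assumption.\<close>
      let ?K = "tapp sc (Suc m + 1) (\<lambda>zs. tsc (f (last zs)) (et sc (butlast zs)))"
      have "riter sc Dl bar m (slice f ?r) = lft sc (\<lambda>a b. tsc (f b) (riter sc Dl bar m a)) ?r"
        by (simp add: lft_comp[OF bil_slice[OF f] lin_riter rD_T2] lin_scale[OF lin_riter])
      also have "\<dots> = lft sc (\<lambda>a b. ?K (tprod sc (riter sc Dl bar m a) (et sc [b]))) ?r"
        by (simp only: contract_last[OF riter_tensN f])
      also have "\<dots> = ?K (riter sc Dl bar (Suc m) a)"
        unfolding riter_Suc_outer by (rule lft_comp[OF bil_riter lin_tapp rD_T2, symmetric])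
      also have "\<dots> = 0" unfolding Suc.prems(3) by (rule lin_0[OF lin_tapp])
      finally show ?thesis .
    qed
    ultimately show "slice f ?r \<in> ?W" by simp
  qed
  then have "?r \<in> etN sc (Fil m) I"
    by (rule etN_mono[rotated 2]) (use Suc.IH subspace_0[OF I_subspace] in auto)
  moreover have "bar - one \<in> I" using subspace_neg[OF I_subspace I_gen] by simp
  moreover have "Dl a - et sc [a, one] = ?r + (et sc [bar, a] + et sc [a, bar - one])"
    unfolding rD_def by (simp add: lin_diff[OF bil2[OF bil_et2]])
  ultimately have "Dl a - et sc [a, one] \<in> etN sc (Fil m) I"
    using bar_Fil by (simp only:) (intro tspan_add et_etN; simp)
  then show ?case by simp
qed

text \<open>Applying \<open>id \<otimes> Q\<close> sends a second factor from \<open>Fil 0\<close>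
  into \<open>I\<close>.\<close>

lemma wedge_0:
  assumes "Dl x \<in> etN sc (Fil a) (Fil 0)"
  shows "x \<in> Fil (Suc a)"
  unfolding Fil.simps mem_Collect_eq Dl_right_reduced[symmetric]
  by (rule lft_in[OF bil_et_Q(2) assms etN_subspace]) (intro et_etN, use Q_Fil_0 in blast)

text \<open>Slicing the second factor with functionals vanishing on \<open>Fil 0\<close> lowers the filtration
  degree of that factor, and by coassociativity a slice of \<open>Dl x\<close> satisfies the hypothesis again.\<close>
lemma wedge: "Dl x \<in> etN sc (Fil a) (Fil b) \<Longrightarrow> x \<in> Fil (Suc (a + b))"
proof (induction b arbitrary: x)
  case 0
  then show ?case using wedge_0 by simp
next
  case (Suc b)
  \<comment> \<open>The whole degree is moved to the first factor; \<open>wedge_0\<close> then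
    supplies the final increment.\<close>
  have "Dl x \<in> etN sc (Fil (Suc (a + b))) (Fil 0)"
  proof (rule slice_mem[OF Dl_T2 Fil_subspace Fil_subspace])
    fix f assume f: "lin sc (*) f" and f0: "\<And>z. z \<in> Fil 0 \<Longrightarrow> f z = 0"
    let ?C = "\<lambda>c d v. tsc (f v) (et sc [c, d])"
    have C: "tri sc tsc ?C"
      by (intro triI lin_smult_vec[OF f vector_space_tsc] lin_smult bil1[OF bil_et2] bil2[OF bil_et2])
    have "Dl (slice f (Dl x)) = lft sc (\<lambda>u v. tsc (f v) (Dl u)) (Dl x)"
      by (simp add: lft_comp[OF bil_slice[OF f] lin_Dl Dl_T2] lin_scale[OF lin_Dl])
    also have "\<dots> = lft sc (\<lambda>u v. lft sc (\<lambda>c d. ?C c d v) (Dl u)) (Dl x)"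
      using lft_comp[OF bil_et2 lin_smult[OF lin_id[OF vector_space_tsc]] Dl_T2] by (simp add: lft_et_id[OF Dl_T2])
    also have "\<dots> = lft sc (\<lambda>u v. lft sc (\<lambda>c d. ?C u c d) (Dl v)) (Dl x)"
      by (rule Dl_coassoc[OF C])
    also have "\<dots> \<in> etN sc (Fil a) (Fil b)"
    proof (rule lft_in[OF bil_lft_right[OF C] Suc.prems etN_subspace])
      fix u v assume uv: "u \<in> Fil a \<or> v \<in> Fil (Suc b)"
      have "lft sc (\<lambda>c d. ?C u c d) (Dl v) = et sc [u, slice f (Dl v)]"
        by (simp add: lft_comp[OF bil_slice[OF f] bil2[OF bil_et2] Dl_T2] lin_scale[OF bil2[OF bil_et2]])
      \<comment> \<open>Since \<open>f\<close> vanishes on \<open>one\<close> and on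
        \<open>I\<close>, subtracting \<open>v \<otimes> one\<close> is harmless and only terms with
        first factor in \<open>Fil b\<close> survive.\<close>
      moreover have "slice f (Dl v) \<in> Fil b" if v: "v \<in> Fil (Suc b)"
      proof -
        have "slice f (Dl v) = slice f (Dl v - et sc [v, one])"
          using f0[OF one_Fil] by (simp add: lft_diff[OF bil_slice[OF f] Dl_T2] lft_et[OF bil_slice[OF f]])
        also have "\<dots> \<in> Fil b"
        proof (rule lft_in[OF bil_slice[OF f] _ Fil_subspace])
          show "Dl v - et sc [v, one] \<in> etN sc (Fil b) I" using v by simp
          fix c d assume "c \<in> Fil b \<or> d \<in> I"
          then show "sc (f d) c \<in> Fil b"
            using f0[OF subsetD[OF I_Fil]] subspace_scale[OF Fil_subspace] subspace_0[OF Fil_subspace] by auto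
        qed
        finally show ?thesis .
      qed
      ultimately show "lft sc (\<lambda>c d. ?C u c d) (Dl v) \<in> etN sc (Fil a) (Fil b)"
        using uv by (simp only:) (intro et_etN; blast)
    qed
    finally show "slice f (Dl x) \<in> Fil (Suc (a + b))" by (rule Suc.IH)
  qed
  from wedge_0[OF this] show ?case by simp
qed

section \<open>Exhaustiveness of the filtration\<close>

lemma Fil_Union_mult: "\<exists>p. x \<in> Fil p \<Longrightarrow> \<exists>p. y \<in> Fil p \<Longrightarrow> \<exists>p. mult x y \<in> Fil p"
  using Fil_mult by blast

text \<open>A tensor is a finite sum, so the maximum of the degrees that occur serves for all
  terms.\<close>

lemma etN_Fil_Union:
  assumes "t \<in> tspan sc {et sc [a, b] | a b. (\<exists>p. a \<in> Fil p) \<or> (\<exists>p. b \<in> Fil p)}"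
  shows "\<exists>p. t \<in> etN sc (Fil p) (Fil p)"
  using assms
proof (induction rule: tspan_induct)
  case (base s)
  then obtain a b p where "s = et sc [a, b]" "a \<in> Fil p \<or> b \<in> Fil p" by blast
  then show ?case using et_etN by blast
next
  case zero
  show ?case using tspan_zero by blast
next
  case (step c s t)
  then obtain p q where "s \<in> etN sc (Fil p) (Fil p)" "t \<in> etN sc (Fil q) (Fil q)" by blast
  then have "s \<in> etN sc (Fil (max p q)) (Fil (max p q))" "t \<in> etN sc (Fil (max p q)) (Fil (max p q))"
    by (auto elim!: etN_mono[rotated 2] intro!: Fil_mono)
  then have "tsc c s + t \<in> etN sc (Fil (max p q)) (Fil (max p q))" by (intro tspan_add tspan_scale)
  then show ?case by (rule exI)
qed

lemma sum_list_eq_length: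
  "\<forall>x\<in>set ns. 0 < x \<Longrightarrow> sum_list ns = length (ns :: nat list) \<Longrightarrow> \<forall>x\<in>set ns. x = 1"
proof (induction ns)
  case (Cons n ns)
  then show ?case using length_le_sum_list[of ns] by auto
qed simp

lemma Op_Fil: "n \<ge> 1 \<Longrightarrow> x \<in> Op n \<Longrightarrow> \<exists>p. x \<in> Fil p"
proof (induction n arbitrary: x rule: less_induct)
  case (less n)
  have one: "\<exists>p. a \<in> Fil p" if a: "a \<in> Op 1" for a
  proof -
    \<comment> \<open>Nilpotency is given on the kernel of \<open>eps\<close>; the correction is a
      multiple of \<open>bar\<close>, which lies in every \<open>Fil m\<close>.\<close>
    let ?a = "a - sc (eps a) bar"
    have "?a \<in> Op 1" "eps ?a = 0"
      using a bar_Op by (auto simp: lin_diff[OF lin_eps] lin_scale[OF lin_eps] intro!: subspace_diff subspace_scale Op_subspace)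
    then obtain m where "?a \<in> Fil m" using riter_bar Op_1_Fil by blast
    then have "?a + sc (eps a) bar \<in> Fil m" by (intro subspace_add subspace_scale Fil_subspace bar_Fil)
    then show ?thesis by auto
  qed
  show ?case
  proof (cases "n = 1")
    case True
    then show ?thesis using one less.prems by simp
  next
    case False
    have "Dl x \<in> tspan sc {et sc [a, b] | a b. (\<exists>p. a \<in> Fil p) \<or> (\<exists>p. b \<in> Fil p)}"
    proof (rule subsetD[OF tspan_subset Dl_pr_graded[OF less.prems]])
      fix s assume "s \<in> {et sc [a, b] | a b. \<exists>ns ws. ns \<in> partitions n \<and> a \<in> Op (length ns) \<and> list_all2 (\<lambda>w n. w \<in> Op n) ws ns \<and> b = pr ws}"
      then obtain a ns ws where s: "s = et sc [a, pr ws]" and ns: "ns \<in> partitions n" and a: "a \<in> Op (length ns)"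
        and ws: "list_all2 (\<lambda>w n. w \<in> Op n) ws ns" by blast
      have "(\<exists>p. a \<in> Fil p) \<or> (\<exists>p. pr ws \<in> Fil p)"
      proof (cases "length ns < n")
        case True
        then show ?thesis using less.IH[OF True _ a] partitions_length[OF ns] by simp
      next
        case False
        \<comment> \<open>A partition of \<open>n\<close> has at most \<open>n\<close> parts, so
          here it has exactly \<open>n\<close>, all equal to 1.\<close>
        then have "\<forall>x\<in>set ns. x = 1"
          using ns partitions_length[OF ns] by (intro sum_list_eq_length) (auto simp: partitions_def)
        then have "\<forall>w\<in>set ws. w \<in> Op 1"
          using ws by (auto simp: list_all2_conv_all_nth all_set_conv_all_nth)
        then have "\<exists>p. pr ws \<in> Fil p"
          by (induction ws) (use one_Fil one Fil_Union_mult in auto)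
        then show ?thesis ..
      qed
      then show "s \<in> tspan sc {et sc [a, b] | a b. (\<exists>p. a \<in> Fil p) \<or> (\<exists>p. b \<in> Fil p)}"
        unfolding s by (intro tspan_base) blast
    qed
    then show ?thesis using etN_Fil_Union wedge by blast
  qed
qed

lemma Fil_exhaustive: "\<exists>p. x \<in> Fil p"
proof (induction x rule: V_induct)
  case one
  show ?case using one_Fil by blast
next
  case (Op n x)
  then show ?case by (rule Op_Fil)
next
  case zero
  show ?case using subspace_0[OF Fil_subspace] by blast
next
  case (step c x y)
  then obtain p q where "x \<in> Fil p" "y \<in> Fil q" by blast
  then have "x \<in> Fil (max p q)" "y \<in> Fil (max p q)" using Fil_mono[of p "max p q"] Fil_mono[of q "max p q"] by auto
  then have "sc c x + y \<in> Fil (max p q)" by (intro subspace_add subspace_scale Fil_subspace)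
  then show ?case by (rule exI)
qed

lemma quotient_conilpotent_I: "quotient_conilpotent sc one Dl eps I"
  unfolding quotient_conilpotent_def
proof (intro allI impI)
  fix x assume "eps x = 0"
  moreover obtain p where "x \<in> Fil p" using Fil_exhaustive by blast
  ultimately show "\<exists>m. riter sc Dl one m x \<in> qker sc I" using riter_Fil[of x p] by auto
qed

end

section \<open>The antipode\<close>

context almost_connected_cooperad
begin

text \<open>The convolution product, formed before passing to the quotient; its associativity and
  its unit \<open>cunit\<close> are exact there.\<close>

definition conv :: "('v \<Rightarrow> 'v) \<Rightarrow> ('v \<Rightarrow> 'v) \<Rightarrow> 'v \<Rightarrow> 'v" where
  "conv f g x = lft sc (\<lambda>a b. mult (f a) (g b)) (Dl x)"

abbreviation cunit :: "'v \<Rightarrow> 'v" where "cunit x \<equiv> sc (eps x) one"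

lemma lin_cunit: "lin sc sc cunit"
  by (rule lin_smult_vec[OF lin_eps vs])

lemma bil_conv: "lin sc sc f \<Longrightarrow> lin sc sc g \<Longrightarrow> bil sc sc (\<lambda>a b. mult (f a) (g b))"
  by (intro bilI lin_mult_comp lin_comp[OF _ lin_mult_left] lin_comp[OF _ lin_mult_right])

lemma lin_conv: "lin sc sc f \<Longrightarrow> lin sc sc g \<Longrightarrow> lin sc sc (conv f g)"
  unfolding conv_def by (rule lft_Dl_lin[OF bil_conv])

lemma conv_assoc:
  assumes f: "lin sc sc f" and g: "lin sc sc g" and h: "lin sc sc h"
  shows "conv (conv f g) h = conv f (conv g h)"
proof
  fix x
  have C: "tri sc sc (\<lambda>a b c. mult (f a) (mult (g b) (h c)))"
    by (intro triI lin_comp[OF f lin_mult_right] lin_comp[OF _ lin_mult_left] lin_comp[OF g lin_mult_right] h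
        lin_comp[OF lin_comp[OF g lin_mult_right] lin_mult_left] lin_comp[OF lin_comp[OF h lin_mult_left] lin_mult_left])
  have "conv (conv f g) h x = lft sc (\<lambda>a b. lft sc (\<lambda>c d. mult (f c) (mult (g d) (h b))) (Dl a)) (Dl x)"
    unfolding conv_def lft_comp[OF bil_conv[OF f g] lin_mult_right Dl_T2] by (simp add: mult_assoc)
  also have "\<dots> = lft sc (\<lambda>a b. lft sc (\<lambda>c d. mult (f a) (mult (g c) (h d))) (Dl b)) (Dl x)"
    by (rule Dl_coassoc[OF C])
  also have "\<dots> = conv f (conv g h) x"
    unfolding conv_def lft_comp[OF bil_conv[OF g h] lin_mult_left Dl_T2] ..
  finally show "conv (conv f g) h x = conv f (conv g h) x" .
qed

lemma conv_cunit_left: "lin sc sc g \<Longrightarrow> conv cunit g = g"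
proof
  fix x assume g: "lin sc sc g"
  have "conv cunit g x = lft sc (\<lambda>a b. g (sc (eps a) b)) (Dl x)"
    unfolding conv_def by (simp add: lin_scale[OF lin_mult_right] lin_scale[OF g])
  also have "\<dots> = g x" unfolding lft_comp[OF bil_eps_left g Dl_T2, symmetric] counit_left ..
  finally show "conv cunit g x = g x" .
qed

lemma conv_cunit_right: "lin sc sc f \<Longrightarrow> conv f cunit = f"
proof
  fix x assume f: "lin sc sc f"
  have "conv f cunit x = lft sc (\<lambda>a b. f (sc (eps b) a)) (Dl x)"
    unfolding conv_def by (simp add: lin_scale[OF lin_mult_left] lin_scale[OF f])
  also have "\<dots> = f x" unfolding lft_comp[OF bil_eps_right f Dl_T2, symmetric] counit_right ..
  finally show "conv f cunit x = f x" .
qed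

lemma conv_diff_left: "lin sc sc f \<Longrightarrow> lin sc sc f' \<Longrightarrow> lin sc sc g \<Longrightarrow> conv (\<lambda>x. f x - f' x) g x = conv f g x - conv f' g x"
  unfolding conv_def lin_diff[OF lin_mult_right] by (intro lft_minus_fun[where w = sc] bil_conv Dl_T2)

lemma conv_diff_right: "lin sc sc f \<Longrightarrow> lin sc sc g \<Longrightarrow> lin sc sc g' \<Longrightarrow> conv f (\<lambda>x. g x - g' x) x = conv f g x - conv f g' x"
  unfolding conv_def lin_diff[OF lin_mult_left] by (intro lft_minus_fun[where w = sc] bil_conv Dl_T2)

lemma conv_in_I_left: "lin sc sc f \<Longrightarrow> lin sc sc g \<Longrightarrow> (\<And>x. f x \<in> I) \<Longrightarrow> conv f g x \<in> I"
  unfolding conv_def by (rule lft_in[OF bil_conv T2_tspan2[OF Dl_T2] I_subspace]) (auto intro: I_mult)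

lemma conv_in_I_right: "lin sc sc f \<Longrightarrow> lin sc sc g \<Longrightarrow> (\<And>x. g x \<in> I) \<Longrightarrow> conv f g x \<in> I"
  unfolding conv_def by (rule lft_in[OF bil_conv T2_tspan2[OF Dl_T2] I_subspace]) (auto intro: I_mult)

lemma conv_cong_I_left:
  assumes "lin sc sc f" "lin sc sc f'" "lin sc sc g" "\<And>x. f x - f' x \<in> I"
  shows "conv f g x - conv f' g x \<in> I"
  using conv_in_I_left[OF lin_minus2[OF assms(1,2)] assms(3,4)] by (simp add: conv_diff_left assms)

lemma conv_cong_I_right:
  assumes "lin sc sc f" "lin sc sc g" "lin sc sc g'" "\<And>x. g x - g' x \<in> I"
  shows "conv f g x - conv f g' x \<in> I"
  using conv_in_I_right[OF assms(1) lin_minus2[OF assms(2,3)] assms(4)] by (simp add: conv_diff_right assms)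

lemma conv_preserves_I:
  assumes "lin sc sc f" "lin sc sc g" "\<And>x. x \<in> I \<Longrightarrow> f x \<in> I" "\<And>x. x \<in> I \<Longrightarrow> g x \<in> I" "x \<in> I"
  shows "conv f g x \<in> I"
  unfolding conv_def using I_coideal[OF assms(5)]
  by (intro lft_in[OF bil_conv[OF assms(1,2)] _ I_subspace, of _ "\<lambda>a b. a \<in> I \<or> b \<in> I"]) (auto intro: I_mult assms(3,4))

section \<open>Convolution powers and the geometric series\<close>

abbreviation aug :: "'v \<Rightarrow> 'v" where "aug x \<equiv> cunit x - x"

fun cpow :: "nat \<Rightarrow> 'v \<Rightarrow> 'v" where
  "cpow 0 = cunit"
| "cpow (Suc n) = conv (cpow n) aug"

lemma lin_aug: "lin sc sc aug"
  by (intro lin_minus2 lin_cunit lin_id[OF vs])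

lemma lin_cpow: "lin sc sc (cpow n)"
  by (induction n) (simp_all only: cpow.simps lin_cunit lin_conv lin_aug)

lemma aug_I: "x \<in> Fil 0 \<Longrightarrow> aug x \<in> I"
  using subspace_neg[OF I_subspace Q_Fil_0] by simp

text \<open>Powers are built by multiplying on the right; the left-handed recursion is needed for
  the other antipode identity.\<close>

lemma cpow_Suc_left: "cpow (Suc n) = conv aug (cpow n)"
proof (induction n)
  case 0
  show ?case by (simp only: cpow.simps conv_cunit_left[OF lin_aug] conv_cunit_right[OF lin_aug])
next
  case (Suc n)
  show ?case
    by (subst cpow.simps(2), subst Suc, subst conv_assoc[OF lin_aug lin_cpow lin_aug]) simp
qed

lemma cpow_I: "x \<in> I \<Longrightarrow> cpow n x \<in> I"
proof (induction n arbitrary: x)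
  case 0
  then show ?case using I_coideal[OF 0] subspace_0[OF I_subspace] by simp
next
  case (Suc n)
  show ?case unfolding cpow.simps
    by (rule conv_preserves_I[OF lin_cpow lin_aug Suc.IH]) (use aug_I[OF subsetD[OF I_Fil]] Suc.prems in auto)
qed

text \<open>The term \<open>x \<otimes> one\<close> contributes nothing because
  \<open>aug one = 0\<close>. In the rest, either the first factor lies in \<open>Fil p\<close>,
  where the previous power has values in \<open>I\<close>, or the second lies in \<open>I\<close>,
  which \<open>aug\<close> preserves. The shift by one comes from degree 0, where \<open>aug\<close>
  itself is needed to land in \<open>I\<close>.\<close>

lemma cpow_Fil: "x \<in> Fil p \<Longrightarrow> cpow (Suc p) x \<in> I"
proof (induction p arbitrary: x)
  case 0
  then show ?case unfolding cpow.simps conv_cunit_left[OF lin_aug] by (rule aug_I)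
next
  case (Suc p)
  note b = bil_conv[OF lin_cpow[of "Suc p"] lin_aug]
  have T: "Dl x - et sc [x, one] \<in> T2" by (intro etP_diff Dl_T2 et2_T2)
  have "cpow (Suc (Suc p)) x = lft sc (\<lambda>a b. mult (cpow (Suc p) a) (aug b)) (Dl x - et sc [x, one])"
    unfolding cpow.simps(2)[of "Suc p"] conv_def
    by (simp add: lft_diff[OF b Dl_T2 et2_T2] lft_et[OF b] lin_0[OF lin_mult_left] del: cpow.simps)
  also have "\<dots> \<in> I"
  proof (rule lft_in[OF b _ I_subspace])
    show "Dl x - et sc [x, one] \<in> etN sc (Fil p) I" using Suc.prems by simp
    fix a b assume "a \<in> Fil p \<or> b \<in> I"
    then show "mult (cpow (Suc p) a) (aug b) \<in> I"
      using Suc.IH[of a] aug_I[of b] I_Fil[of 0] I_mult by blast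
  qed
  finally show ?case .
qed

lemma cpow_Fil_less: "x \<in> Fil p \<Longrightarrow> p < n \<Longrightarrow> cpow n x \<in> I"
  using cpow_Fil[of x "n - 1"] Fil_mono[of p "n - 1"] by (cases n) auto

definition psum :: "nat \<Rightarrow> 'v \<Rightarrow> 'v" where
  "psum N x = (\<Sum>n<N. cpow n x)"

lemma lin_psum: "lin sc sc (psum N)"
  unfolding psum_def by (intro lin_sum_fun vs lin_cpow)

lemma psum_0: "psum 0 x = 0" and psum_Suc: "psum (Suc N) x = psum N x + cpow N x"
  by (simp_all add: psum_def)

lemma conv_id_left: "lin sc sc g \<Longrightarrow> conv (\<lambda>x. x) g x = g x - conv aug g x"
  by (simp add: conv_diff_left[OF lin_cunit lin_id[OF vs]] conv_cunit_left)

lemma conv_id_right: "lin sc sc f \<Longrightarrow> conv f (\<lambda>x. x) x = f x - conv f aug x"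
  by (simp add: conv_diff_right[OF _ lin_cunit lin_id[OF vs]] conv_cunit_right)

text \<open>Telescoping. As the identity map is \<open>cunit - aug\<close>, this says that
  \<open>psum N\<close> is a two-sided convolution inverse of the identity up to the error
  \<open>cpow N\<close>.\<close>

lemma conv_psum_aug: "psum N x - conv (psum N) aug x = cunit x - cpow N x"
  "psum N x - conv aug (psum N) x = cunit x - cpow N x"
proof -
  have "conv (psum N) aug x = (\<Sum>n<N. cpow (Suc n) x)"
  proof (induction N)
    case 0
    \<comment> \<open>The zero map is written as a difference so that \<open>conv_diff_left\<close>
      applies.\<close>
    have "conv (psum 0) aug x = conv (\<lambda>x. cunit x - cunit x) aug x" by (simp add: conv_def psum_0)
    also have "\<dots> = 0" unfolding conv_diff_left[OF lin_cunit lin_cunit lin_aug] by simp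
    finally show ?case by simp
  next
    case (Suc N)
    have "conv (psum N) aug x = conv (\<lambda>x. psum (Suc N) x - cpow N x) aug x"
      by (simp add: conv_def psum_Suc)
    also have "\<dots> = conv (psum (Suc N)) aug x - cpow (Suc N) x"
      by (simp add: conv_diff_left[OF lin_psum lin_cpow lin_aug])
    finally show ?case using Suc by (simp add: algebra_simps)
  qed
  moreover have "conv aug (psum N) x = (\<Sum>n<N. cpow (Suc n) x)"
  proof (induction N)
    case 0
    have "conv aug (psum 0) x = conv aug (\<lambda>x. cunit x - cunit x) x" by (simp add: conv_def psum_0)
    also have "\<dots> = 0" unfolding conv_diff_right[OF lin_aug lin_cunit lin_cunit] by simp
    finally show ?case by simp
  next
    case (Suc N)
    have "conv aug (psum N) x = conv aug (\<lambda>x. psum (Suc N) x - cpow N x) x"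
      by (simp add: conv_def psum_Suc)
    also have "\<dots> = conv aug (psum (Suc N)) x - cpow (Suc N) x"
      by (simp add: conv_diff_right[OF lin_aug lin_psum lin_cpow] cpow_Suc_left del: cpow.simps)
    finally show ?case using Suc by (simp add: algebra_simps)
  qed
  moreover have "psum N x - (\<Sum>n<N. cpow (Suc n) x) = cunit x - cpow N x"
    unfolding psum_def sum_subtractf[symmetric] using sum_lessThan_telescope'[of "\<lambda>n. cpow n x" N] by simp
  ultimately show "psum N x - conv (psum N) aug x = cunit x - cpow N x"
    "psum N x - conv aug (psum N) x = cunit x - cpow N x" by simp_all
qed

lemma antipode_iff:
  "quotient_antipode sc one mult Dl eps I S \<longleftrightarrow> lin sc sc S \<and> (\<forall>x\<in>I. S x \<in> I) \<and>
     (\<forall>x. conv S (\<lambda>x. x) x - cunit x \<in> I) \<and> (\<forall>x. conv (\<lambda>x. x) S x - cunit x \<in> I)"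
proof (cases "lin sc sc S")
  case True
  have i: "lin sc sc (\<lambda>x. x)" by (rule lin_id[OF vs])
  have l: "tapp sc 2 (\<lambda>zs. et sc [mult (S (zs ! 0)) (zs ! 1)]) (Dl x) = et sc [conv S (\<lambda>x. x) x]" for x
    unfolding conv_def lft_comp[OF bil_conv[OF True i] lin_et1 Dl_T2]
    using tapp2_lft[OF _ _ Dl_T2, of "\<lambda>zs. et sc [mult (S (zs ! 0)) (zs ! 1)]"] bil_comp[OF bil_conv[OF True i] lin_et1] by simp
  have r: "tapp sc 2 (\<lambda>zs. et sc [mult (zs ! 0) (S (zs ! 1))]) (Dl x) = et sc [conv (\<lambda>x. x) S x]" for x
    unfolding conv_def lft_comp[OF bil_conv[OF i True] lin_et1 Dl_T2]
    using tapp2_lft[OF _ _ Dl_T2, of "\<lambda>zs. et sc [mult (zs ! 0) (S (zs ! 1))]"] bil_comp[OF bil_conv[OF i True] lin_et1] by simp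
  show ?thesis
    unfolding quotient_antipode_def l r lin_diff[OF lin_et1, symmetric] et_qker_iff[OF I_subspace] ..
qed (simp add: quotient_antipode_def)

text \<open>The usual argument for inverses, modulo \<open>I\<close>: bracket the convolution of
  \<open>S\<close>, the identity and \<open>S'\<close> in the two possible ways.\<close>

lemma antipode_unique:
  assumes "quotient_antipode sc one mult Dl eps I S" "quotient_antipode sc one mult Dl eps I S'"
  shows "S x - S' x \<in> I"
proof -
  have i: "lin sc sc (\<lambda>x. x)" by (rule lin_id[OF vs])
  have S: "lin sc sc S" "\<And>x. conv S (\<lambda>x. x) x - cunit x \<in> I" and S': "lin sc sc S'" "\<And>x. conv (\<lambda>x. x) S' x - cunit x \<in> I"
    using assms unfolding antipode_iff by blast+
  have "conv S (conv (\<lambda>x. x) S') x - conv S cunit x \<in> I"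
    by (rule conv_cong_I_right[OF S(1) lin_conv[OF i S'(1)] lin_cunit S'(2)])
  moreover have "conv (conv S (\<lambda>x. x)) S' x - conv cunit S' x \<in> I"
    by (rule conv_cong_I_left[OF lin_conv[OF S(1) i] lin_cunit S'(1) S(2)])
  ultimately have "(conv (conv S (\<lambda>x. x)) S' x - conv cunit S' x) - (conv S (conv (\<lambda>x. x) S') x - conv S cunit x) \<in> I"
    using subspace_diff[OF I_subspace] by blast
  then show ?thesis
    by (simp add: conv_assoc[OF S(1) i S'(1)] conv_cunit_left[OF S'(1)] conv_cunit_right[OF S(1)])
qed

text \<open>The geometric series of \<open>aug\<close> is locally finite only modulo \<open>I\<close>; projecting along \<open>I\<close>
  makes it a genuine linear map on representatives.\<close>
lemma antipode_exists: "\<exists>S. quotient_antipode sc one mult Dl eps I S"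
proof -
  obtain P where P: "lin sc sc P" "\<And>x. x \<in> I \<Longrightarrow> P x = 0" "\<And>x. x - P x \<in> I"
    using projection_along[OF I_subspace] by blast
  define S where "S x = (\<Sum>n\<in>{n. P (cpow n x) \<noteq> 0}. P (cpow n x))" for x
  \<comment> \<open>On \<open>Fil p\<close> the powers beyond \<open>p\<close> lie in
    \<open>I\<close> and are killed by \<open>P\<close>, so the support is finite and every longer
    partial sum gives the same value.\<close>
  have S_eq: "S x = P (psum N x)" if "x \<in> Fil p" "p < N" for x p N
  proof -
    have "P (cpow n x) = 0" if "N \<le> n" for n
      using P(2) cpow_Fil_less[OF \<open>x \<in> Fil p\<close>, of n] \<open>p < N\<close> that by simp
    then have "{n. P (cpow n x) \<noteq> 0} \<subseteq> {..<N}" using leI by blast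
    then have "S x = (\<Sum>n<N. P (cpow n x))" unfolding S_def
      by (rule sum.mono_neutral_left[rotated]) auto
    then show ?thesis by (simp add: psum_def lin_sum[OF P(1)])
  qed
  have two: "\<exists>p. x \<in> Fil p \<and> y \<in> Fil p" for x y
  proof -
    obtain p q where "x \<in> Fil p" "y \<in> Fil q" using Fil_exhaustive by blast
    then show ?thesis using Fil_mono[of p "max p q"] Fil_mono[of q "max p q"] by (intro exI[of _ "max p q"]) auto
  qed
  have lin_S: "lin sc sc S"
  proof (rule linI[OF vs vs])
    fix c x y
    obtain p where p: "x \<in> Fil p" "y \<in> Fil p" using two by blast
    then have "sc c x + y \<in> Fil p" by (intro subspace_add subspace_scale Fil_subspace)
    with p show "S (sc c x + y) = sc c (S x) + S y"
      by (simp add: S_eq[of _ p "Suc p"] lin_add[OF lin_psum] lin_scale[OF lin_psum] lin_add[OF P(1)] lin_scale[OF P(1)])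
  qed
  have S_psum: "psum N x - S x \<in> I" if "x \<in> Fil p" "p < N" for x p N
    unfolding S_eq[OF that] by (rule P(3))
  have S_I: "S x \<in> I" if "x \<in> I" for x
  proof -
    have "psum (Suc 0) x - S x \<in> I" by (rule S_psum[OF subsetD[OF I_Fil that]]) simp
    moreover have "psum (Suc 0) x \<in> I" using cpow_I[OF that, of 0] by (simp add: psum_def)
    ultimately have "psum (Suc 0) x - (psum (Suc 0) x - S x) \<in> I" using subspace_diff[OF I_subspace] by blast
    then show ?thesis by simp
  qed
  have i: "lin sc sc (\<lambda>x. x)" by (rule lin_id[OF vs])
  define D where "D N x = psum N x - S x" for N x
  have lin_D: "lin sc sc (D N)" for N unfolding D_def by (intro lin_minus2 lin_psum lin_S)
  \<comment> \<open>How large \<open>N\<close> must be for \<open>D N a\<close> to lie in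
    \<open>I\<close> depends on \<open>a\<close>; a single tensor has finitely many terms, so one
    bound works for all of them.\<close>
  have approx: "\<exists>N0. \<forall>N\<ge>N0. lft sc (\<lambda>a b. mult (D N a) b) t \<in> I \<and> lft sc (\<lambda>a b. mult a (D N b)) t \<in> I"
    if t: "t \<in> T2" for t
  proof -
    obtain ps where ps: "t = S2 sc ps" using T2_S2[OF t] by blast
    note b = bil_conv[OF lin_D i] bil_conv[OF i lin_D]
    show ?thesis unfolding ps lft_S2[OF b(1)] lft_S2[OF b(2)]
    proof (induction ps)
      case Nil
      then show ?case by (simp add: subspace_0[OF I_subspace])
    next
      case (Cons p ps)
      obtain x y where xy: "p = (x, y)" by (cases p)
      obtain N0 where N0: "\<And>N. N \<ge> N0 \<Longrightarrow> (\<Sum>(a,b)\<leftarrow>ps. mult (D N a) b) \<in> I \<and> (\<Sum>(a,b)\<leftarrow>ps. mult a (D N b)) \<in> I"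
        using Cons by blast
      obtain q where q: "x \<in> Fil q" "y \<in> Fil q" using two by blast
      have "mult (D N x) y \<in> I \<and> mult x (D N y) \<in> I" if "N \<ge> Suc q" for N
        unfolding D_def using S_psum[OF q(1), of N] S_psum[OF q(2), of N] that by (intro conjI I_mult) auto
      then show ?case using N0 xy
        by (intro exI[of _ "max N0 (Suc q)"]) (auto intro!: subspace_add[OF I_subspace])
    qed
  qed
  have "conv S (\<lambda>x. x) x - cunit x \<in> I \<and> conv (\<lambda>x. x) S x - cunit x \<in> I" for x
  proof -
    obtain N0 where N0: "\<And>N. N \<ge> N0 \<Longrightarrow> conv (D N) (\<lambda>x. x) x \<in> I \<and> conv (\<lambda>x. x) (D N) x \<in> I"
      using approx[OF Dl_T2, of x] unfolding conv_def by blast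
    obtain p where p: "x \<in> Fil p" using Fil_exhaustive by blast
    \<comment> \<open>Large enough both for the error of replacing \<open>S\<close> by
      \<open>psum N\<close> on the factors of \<open>Dl x\<close> and for the remainder
      \<open>cpow N x\<close> to lie in \<open>I\<close>.\<close>
    define N where "N = max N0 (Suc p)"
    have c: "cpow N x \<in> I" by (rule cpow_Fil_less[OF p]) (simp add: N_def)
    have d: "conv (D N) (\<lambda>x. x) x \<in> I" "conv (\<lambda>x. x) (D N) x \<in> I" using N0[of N] by (auto simp: N_def)
    have "conv (D N) (\<lambda>x. x) x = cunit x - cpow N x - conv S (\<lambda>x. x) x"
      unfolding D_def by (simp only: conv_diff_left[OF lin_psum lin_S i] conv_id_right[OF lin_psum] conv_psum_aug)
    moreover have "conv (\<lambda>x. x) (D N) x = cunit x - cpow N x - conv (\<lambda>x. x) S x"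
      unfolding D_def by (simp only: conv_diff_right[OF i lin_psum lin_S] conv_id_left[OF lin_psum] conv_psum_aug)
    ultimately have e: "conv S (\<lambda>x. x) x - cunit x = - (conv (D N) (\<lambda>x. x) x + cpow N x)"
      "conv (\<lambda>x. x) S x - cunit x = - (conv (\<lambda>x. x) (D N) x + cpow N x)" by (simp_all add: algebra_simps)
    show ?thesis unfolding e using c d by (intro conjI subspace_neg subspace_add I_subspace)
  qed
  then show ?thesis using lin_S S_I unfolding antipode_iff by blast
qed

end

theorem theorem2p21:
  fixes sc :: "'k::field \<Rightarrow> 'v::ab_group_add \<Rightarrow> 'v"
    and Op :: "nat \<Rightarrow> 'v set"
    and one bar :: 'v
    and gam :: "nat list \<Rightarrow> 'v \<Rightarrow> ('v,'k) tensor"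
    and mult :: "'v \<Rightarrow> 'v \<Rightarrow> 'v"
    and Dl :: "'v \<Rightarrow> ('v,'k) tensor"
    and eps :: "'v \<Rightarrow> 'k"
  assumes "cooperad_mult sc Op one gam mult Dl"
    and "bialg_counit sc one mult Dl eps"
    and "almost_connected sc Op Dl eps bar"
  defines "I \<equiv> ideal_gen sc mult (one - bar)"
  shows "coideal sc Dl eps I \<and>
         quotient_bialgebra sc one mult Dl eps I \<and>
         quotient_conilpotent sc one Dl eps I \<and>
         (\<exists>S. quotient_antipode sc one mult Dl eps I S \<and>
            (\<forall>S'. quotient_antipode sc one mult Dl eps I S' \<longrightarrow> (\<forall>x. S x - S' x \<in> I)))"
proof -
  have "vector_space sc"
    using assms(1) unfolding cooperad_mult_def unit_adjoined_sum_def by blast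
  then interpret almost_connected_cooperad sc Op one gam mult Dl eps bar I
    by (intro almost_connected_cooperad.intro cooperad.intro cooperad_axioms.intro
        almost_connected_cooperad_axioms.intro tensor_space.intro assms I_def[THEN meta_eq_to_obj_eq])
  show ?thesis
    using coideal_I quotient_bialgebra_I quotient_conilpotent_I antipode_exists antipode_unique by blast
qed

end
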